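(* Let $(A,\bar{\mathfrak m})$ be a Cohen-Macaulay local DG-ring with constant amplitude. Then for any proper ideal $\bar I\subseteq\mathrm{H}^0(A)$, there is an equality $$\operatorname{seq.depth}_A(\bar I,A)=\dim(\mathrm{H}^0(A))-\dim(\mathrm{H}^0(A)/\bar I).$$
   Context: "DG-ring" means commutative non-positive DG-ring: a graded ring $A=\bigoplus_{n\le 0}A^n$ with a differential $d$ of degree $+1$, satisfying $d(ab)=d(a)b+(-1)^{\deg a}a\,d(b)$, $ba=(-1)^{\deg a\deg b}ab$, and $a^2=0$ for $\deg a$ odd. $\mathrm{D}(A)$ is the derived category of DG-modules over $A$. $\pi_A:A\to\mathrm{H}^0(A)$ is the natural map, with surjective degree-zero part $\pi^0_A:A^0\to\mathrm{H}^0(A)$. $A$ is noetherian if $\mathrm{H}^0(A)$ is noetherian and each $\mathrm{H}^n(A)$ is a finitely generated $\mathrm{H}^0(A)$-module; bounded cohomology means $\mathrm{H}^n(A)=0$ for $n\ll0$; $(A,\bar{\mathfrak m})$ is noetherian local if $A$ is noetherian and $\mathrm{H}^0(A)$ is local with maximal ideal $\bar{\mathfrak m}$. $\inf(M)=\inf\{n:\mathrm{H}^n(M)\ne0\}$. $\dim$ is Krull dimension. Localization: for $\bar{\mathfrak p}\in\operatorname{Spec}(\mathrm{H}^0(A))$, $A_{\bar{\mathfrak p}}=A\otimes_{A^0}A^0_{\mathfrak p}$ with $\mathfrak p=(\pi_A^0)^{-1}(\bar{\mathfrak p})$. For $(A,\bar{\mathfrak m})$ noetherian local and $M\in\mathrm{D}(A)$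 with cohomology bounded below: $\bar x\in\bar{\mathfrak m}$ is $M$-regular if multiplication by $\bar x$ on $\mathrm{H}^{\inf(M)}(M)$ is injective; a sequence $\bar a_1,\dots,\bar a_n\in\bar{\mathfrak m}$ is $M$-regular if $\bar a_1$ is $M$-regular and $\bar a_2,\dots,\bar a_n$ is $K(M;\bar a_1)$-regular, where $K(M;\bar a_1)$ is the cone of $\bar a_1:M\to M$ in $\mathrm{D}(A)$. For a proper ideal $\bar I\subseteq\mathrm{H}^0(A)$, $\operatorname{seq.depth}_A(\bar I,M)$ is the maximal length of an $M$-regular sequence contained in $\bar I$; $\operatorname{seq.depth}_A(M)=\operatorname{seq.depth}_A(\bar{\mathfrak m},M)$. A noetherian local DG-ring with bounded cohomology is local-Cohen-Macaulay if $\operatorname{seq.depth}_A(A)=\dim(\mathrm{H}^0(A))$; a noetherian DG-ring $A$ with bounded cohomology is Cohen-Macaulay if $A_{\bar{\mathfrak p}}$ is local-Cohen-Macaulay for every $\bar{\mathfrak p}\in\operatorname{Spec}(\mathrm{H}^0(A))$. $A$ has constant amplitude if $\operatorname{Supp}(\mathrm{H}^{\inf(A)}(A))=\operatorname{Spec}(\mathrm{H}^0(A))$. *)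

theory Defs
  imports "HOL-Algebra.Ring_Divisibility" "HOL-Algebra.Module"
    "HOL-Library.Extended_Real"
begin

section \<open>Commutative algebra\<close>

definition Spec :: "('a, 'b) ring_scheme \<Rightarrow> 'a set set" where
  "Spec R = {P. primeideal P R}"

definition local_ring :: "('a, 'b) ring_scheme \<Rightarrow> 'a set \<Rightarrow> bool" where
  "local_ring R m \<longleftrightarrow> cring R \<and> maximalideal m R \<and> (\<forall>J. maximalideal J R \<longrightarrow> J = m)"

text \<open>The zero ring has dimension \<open>-\<infinity>\<close>, the supremum of the empty set.\<close>

definition krull_dim :: "('a, 'b) ring_scheme \<Rightarrow> ereal" where
  "krull_dim R = Sup {ereal (real n) | n.
     \<exists>P :: nat \<Rightarrow> 'a set. (\<forall>i\<le>n. P i \<in> Spec R) \<and> (\<forall>i<n. P i \<subset> P (Suc i))}"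

definition fin_gen_module :: "('a, 'b) ring_scheme \<Rightarrow> ('a, 'm, 'c) module_scheme \<Rightarrow> bool" where
  "fin_gen_module R N \<longleftrightarrow> (\<exists>S. finite S \<and> S \<subseteq> carrier N \<and>
     (\<forall>y \<in> carrier N. \<exists>c \<in> S \<rightarrow> carrier R. y = (\<Oplus>\<^bsub>N\<^esub>x\<in>S. c x \<odot>\<^bsub>N\<^esub> x)))"

text \<open>The fraction \<open>x / s\<close> in \<open>S\<^sup>-\<^sup>1N\<close>, as an equivalence class of pairs.\<close>

definition mod_frac :: "('a, 'm, 'c) module_scheme \<Rightarrow> 'a set \<Rightarrow> 'm \<Rightarrow> 'a \<Rightarrow> ('m \<times> 'a) set" where
  "mod_frac N S x s = {(y, t). y \<in> carrier N \<and> t \<in> S \<and>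
     (\<exists>u\<in>S. u \<odot>\<^bsub>N\<^esub> (t \<odot>\<^bsub>N\<^esub> x) = u \<odot>\<^bsub>N\<^esub> (s \<odot>\<^bsub>N\<^esub> y))}"

definition fractions :: "('a, 'm, 'c) module_scheme \<Rightarrow> 'a set \<Rightarrow> ('m \<times> 'a) set set" where
  "fractions N S = {mod_frac N S x s | x s. x \<in> carrier N \<and> s \<in> S}"

text \<open>\<open>Supp N\<close> consists of the primes \<open>P\<close> with \<open>N\<^sub>P \<noteq> 0\<close>.\<close>

definition Supp :: "('a, 'b) ring_scheme \<Rightarrow> ('a, 'm, 'c) module_scheme \<Rightarrow> 'a set set" where
  "Supp R N = {P \<in> Spec R.
     fractions N (carrier R - P) \<noteq> {mod_frac N (carrier R - P) \<zero>\<^bsub>N\<^esub> \<one>\<^bsub>R\<^esub>}}"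


section \<open>Graded abelian groups\<close>

text \<open>Only the additive structure of \<open>R\<close> matters here, so that rings and modules are
  both covered. Components are indexed by all integers (cohomological grading).\<close>

definition decomposition ::
  "('a, 'b) ring_scheme \<Rightarrow> (int \<Rightarrow> 'a set) \<Rightarrow> 'a \<Rightarrow> (int \<Rightarrow> 'a) \<Rightarrow> bool" where
  "decomposition R G x c \<longleftrightarrow> (\<forall>n. c n \<in> G n) \<and> finite {n. c n \<noteq> \<zero>\<^bsub>R\<^esub>} \<and>
     x = (\<Oplus>\<^bsub>R\<^esub>n\<in>{n. c n \<noteq> \<zero>\<^bsub>R\<^esub>}. c n)"

definition direct_sum_grading :: "('a, 'b) ring_scheme \<Rightarrow> (int \<Rightarrow> 'a set) \<Rightarrow> bool" where
  "direct_sum_grading R G \<longleftrightarrow> (\<forall>n. additive_subgroup (G n) R) \<and>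
     (\<forall>x \<in> carrier R. \<exists>!c. decomposition R G x c)"

text \<open>\<open>sgn_pow R n x = (-1)\<^sup>n x\<close>; on a graded group, \<open>sgn_twist\<close> is \<open>(-1)\<^sup>n\<close> in degree \<open>n\<close>.\<close>

definition sgn_pow :: "('a, 'b) ring_scheme \<Rightarrow> int \<Rightarrow> 'a \<Rightarrow> 'a" where
  "sgn_pow R n x = (if even n then x else \<ominus>\<^bsub>R\<^esub> x)"

definition sgn_twist :: "('a, 'b) ring_scheme \<Rightarrow> (int \<Rightarrow> 'a set) \<Rightarrow> 'a \<Rightarrow> 'a" where
  "sgn_twist R G x = (let c = (THE c. decomposition R G x c)
     in \<Oplus>\<^bsub>R\<^esub>n\<in>{n. c n \<noteq> \<zero>\<^bsub>R\<^esub>}. sgn_pow R n (c n))"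


section \<open>DG-rings and DG-modules\<close>

record 'a dg_ring = "'a ring" +
  deg :: "int \<Rightarrow> 'a set"
  diff :: "'a \<Rightarrow> 'a"

text \<open>Commutative non-positive DG-rings.\<close>

locale comm_dg_ring = ring A for A :: "('a, 'b) dg_ring_scheme" (structure) +
  assumes grading: "direct_sum_grading A (deg A)"
    and one_deg: "\<one> \<in> deg A 0"
    and mult_deg: "\<lbrakk>a \<in> deg A i; b \<in> deg A j\<rbrakk> \<Longrightarrow> a \<otimes> b \<in> deg A (i + j)"
    and non_positive: "n > 0 \<Longrightarrow> deg A n = {\<zero>}"
    and diff_deg: "a \<in> deg A n \<Longrightarrow> diff A a \<in> deg A (n + 1)"
    and diff_add: "\<lbrakk>a \<in> carrier A; b \<in> carrier A\<rbrakk> \<Longrightarrow> diff A (a \<oplus> b) = diff A a \<oplus> diff A b"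
    and diff_diff: "a \<in> carrier A \<Longrightarrow> diff A (diff A a) = \<zero>"
    and leibniz: "\<lbrakk>a \<in> deg A i; b \<in> deg A j\<rbrakk> \<Longrightarrow>
      diff A (a \<otimes> b) = diff A a \<otimes> b \<oplus> sgn_pow A i (a \<otimes> diff A b)"
    and graded_comm: "\<lbrakk>a \<in> deg A i; b \<in> deg A j\<rbrakk> \<Longrightarrow> b \<otimes> a = sgn_pow A (i * j) (a \<otimes> b)"
    and odd_square: "\<lbrakk>a \<in> deg A i; odd i\<rbrakk> \<Longrightarrow> a \<otimes> a = \<zero>"

text \<open>As in \<open>HOL-Algebra\<close>, the multiplicative fields that a module record inherits from
  rings are not used.\<close>

record ('a, 'm) dg_module = "('a, 'm) module" +
  mdeg :: "int \<Rightarrow> 'm set"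
  mdiff :: "'m \<Rightarrow> 'm"

locale dg_module = A?: comm_dg_ring A + M?: abelian_group M
  for A :: "('a, 'b) dg_ring_scheme" and M :: "('a, 'm, 'c) dg_module_scheme" (structure) +
  assumes smult_closed: "\<lbrakk>a \<in> carrier A; x \<in> carrier M\<rbrakk> \<Longrightarrow> a \<odot> x \<in> carrier M"
    and smult_l_distr: "\<lbrakk>a \<in> carrier A; b \<in> carrier A; x \<in> carrier M\<rbrakk> \<Longrightarrow>
      (a \<oplus>\<^bsub>A\<^esub> b) \<odot> x = a \<odot> x \<oplus> b \<odot> x"
    and smult_r_distr: "\<lbrakk>a \<in> carrier A; x \<in> carrier M; y \<in> carrier M\<rbrakk> \<Longrightarrow>
      a \<odot> (x \<oplus> y) = a \<odot> x \<oplus> a \<odot> y"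
    and smult_assoc: "\<lbrakk>a \<in> carrier A; b \<in> carrier A; x \<in> carrier M\<rbrakk> \<Longrightarrow>
      (a \<otimes>\<^bsub>A\<^esub> b) \<odot> x = a \<odot> (b \<odot> x)"
    and smult_one: "x \<in> carrier M \<Longrightarrow> \<one>\<^bsub>A\<^esub> \<odot> x = x"
    and mgrading: "direct_sum_grading M (mdeg M)"
    and smult_deg: "\<lbrakk>a \<in> deg A i; x \<in> mdeg M j\<rbrakk> \<Longrightarrow> a \<odot> x \<in> mdeg M (i + j)"
    and mdiff_deg: "x \<in> mdeg M n \<Longrightarrow> mdiff M x \<in> mdeg M (n + 1)"
    and mdiff_add: "\<lbrakk>x \<in> carrier M; y \<in> carrier M\<rbrakk> \<Longrightarrow> mdiff M (x \<oplus> y) = mdiff M x \<oplus> mdiff M y"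
    and mdiff_mdiff: "x \<in> carrier M \<Longrightarrow> mdiff M (mdiff M x) = \<zero>"
    and mleibniz: "\<lbrakk>a \<in> deg A i; x \<in> mdeg M j\<rbrakk> \<Longrightarrow>
      mdiff M (a \<odot> x) = diff A a \<odot> x \<oplus> sgn_pow M i (a \<odot> mdiff M x)"

definition self_module :: "('a, 'b) dg_ring_scheme \<Rightarrow> ('a, 'a) dg_module" where
  "self_module A = \<lparr>carrier = carrier A, mult = mult A, one = one A,
     zero = zero A, add = add A,
     smult = mult A, mdeg = deg A, mdiff = diff A\<rparr>"


section \<open>Cohomology\<close>

definition cocycles :: "('a, 'm, 'c) dg_module_scheme \<Rightarrow> int \<Rightarrow> 'm set" where
  "cocycles M n = {x \<in> mdeg M n. mdiff M x = \<zero>\<^bsub>M\<^esub>}"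

definition coboundaries :: "('a, 'm, 'c) dg_module_scheme \<Rightarrow> int \<Rightarrow> 'm set" where
  "coboundaries M n = mdiff M ` mdeg M (n - 1)"

definition H0 :: "('a, 'b) dg_ring_scheme \<Rightarrow> 'a set ring" where
  "H0 A = (A\<lparr>carrier := cocycles (self_module A) 0\<rparr>) Quot (coboundaries (self_module A) 0)"

text \<open>The map \<open>\<pi>\<^sub>A\<^sup>0\<close>; recall that \<open>A\<^sup>1 = 0\<close>, so that degree zero elements are cocycles.\<close>

definition proj0 :: "('a, 'b) dg_ring_scheme \<Rightarrow> 'a \<Rightarrow> 'a set" where
  "proj0 A a = coboundaries (self_module A) 0 +>\<^bsub>A\<^esub> a"

text \<open>\<open>H\<^sup>n(M)\<close> as a module over \<open>H\<^sup>0(A)\<close>: elements of both are cosets, and the action is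
  given on representatives, as in \<^const>\<open>rcoset_mult\<close>.\<close>

definition cohomology :: "('a, 'm, 'c) dg_module_scheme \<Rightarrow> int \<Rightarrow> ('a set, 'm set) module" where
  "cohomology M n = \<lparr>
     carrier = a_rcosets\<^bsub>M\<lparr>carrier := cocycles M n\<rparr>\<^esub> (coboundaries M n),
     mult = undefined, one = undefined,
     zero = coboundaries M n, add = set_add M,
     smult = (\<lambda>X Y. \<Union>a\<in>X. \<Union>y\<in>Y. coboundaries M n +>\<^bsub>M\<^esub> (a \<odot>\<^bsub>M\<^esub> y))\<rparr>"

definition cohomology_nonzero :: "('a, 'm, 'c) dg_module_scheme \<Rightarrow> int \<Rightarrow> bool" where
  "cohomology_nonzero M n \<longleftrightarrow> carrier (cohomology M n) \<noteq> {\<zero>\<^bsub>cohomology M n\<^esub>}"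

text \<open>\<open>inf(M)\<close>. It is meaningful when the cohomology is bounded below and non-zero.\<close>

definition inf_dg :: "('a, 'm, 'c) dg_module_scheme \<Rightarrow> int" where
  "inf_dg M = Inf {n. cohomology_nonzero M n}"

definition bounded_dg_ring :: "('a, 'b) dg_ring_scheme \<Rightarrow> bool" where
  "bounded_dg_ring A \<longleftrightarrow> (\<exists>n0. \<forall>n<n0. \<not> cohomology_nonzero (self_module A) n)"

definition noetherian_dg_ring :: "('a, 'b) dg_ring_scheme \<Rightarrow> bool" where
  "noetherian_dg_ring A \<longleftrightarrow> comm_dg_ring A \<and> noetherian_ring (H0 A) \<and>
     (\<forall>n. fin_gen_module (H0 A) (cohomology (self_module A) n))"

definition noetherian_local_dg_ring :: "('a, 'b) dg_ring_scheme \<Rightarrow> 'a set set \<Rightarrow> bool" where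
  "noetherian_local_dg_ring A m \<longleftrightarrow> noetherian_dg_ring A \<and> local_ring (H0 A) m"


section \<open>Mapping cones and regular sequences\<close>

text \<open>Forming a cone replaces the carrier of a DG-module by pairs. To iterate this
  without changing the type, we use a type that is closed under pairing.\<close>

datatype 'm cone_elt = Elt (the_elt: 'm) | Cone_Pair (pfst: "'m cone_elt") (psnd: "'m cone_elt")

definition embed :: "('a, 'm, 'c) dg_module_scheme \<Rightarrow> ('a, 'm cone_elt) dg_module" where
  "embed M = \<lparr>carrier = Elt ` carrier M, mult = undefined, one = undefined,
     zero = Elt \<zero>\<^bsub>M\<^esub>, add = (\<lambda>x y. Elt (the_elt x \<oplus>\<^bsub>M\<^esub> the_elt y)),
     smult = (\<lambda>a x. Elt (a \<odot>\<^bsub>M\<^esub> the_elt x)),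
     mdeg = (\<lambda>n. Elt ` mdeg M n), mdiff = (\<lambda>x. Elt (mdiff M (the_elt x)))\<rparr>"

text \<open>The mapping cone \<open>M[1] \<oplus> N\<close> of a morphism \<open>f : M \<rightarrow> N\<close> of DG-modules. The action of \<open>A\<close>
  on \<open>M[1]\<close> carries the sign \<open>(-1)\<^sup>i\<close> for elements of degree \<open>i\<close> of \<open>A\<close>.\<close>

definition cone :: "('a, 'b) dg_ring_scheme \<Rightarrow> ('a, 'm cone_elt) dg_module \<Rightarrow>
    ('a, 'm cone_elt) dg_module \<Rightarrow> ('m cone_elt \<Rightarrow> 'm cone_elt) \<Rightarrow>
    ('a, 'm cone_elt) dg_module" where
  "cone A M N f = \<lparr>carrier = {Cone_Pair x y | x y. x \<in> carrier M \<and> y \<in> carrier N},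
     mult = undefined, one = undefined, zero = Cone_Pair \<zero>\<^bsub>M\<^esub> \<zero>\<^bsub>N\<^esub>,
     add = (\<lambda>p q. Cone_Pair (pfst p \<oplus>\<^bsub>M\<^esub> pfst q) (psnd p \<oplus>\<^bsub>N\<^esub> psnd q)),
     smult = (\<lambda>a p. Cone_Pair (sgn_twist A (deg A) a \<odot>\<^bsub>M\<^esub> pfst p) (a \<odot>\<^bsub>N\<^esub> psnd p)),
     mdeg = (\<lambda>n. {Cone_Pair x y | x y. x \<in> mdeg M (n + 1) \<and> y \<in> mdeg N n}),
     mdiff = (\<lambda>p. Cone_Pair (\<ominus>\<^bsub>M\<^esub> mdiff M (pfst p)) (f (pfst p) \<oplus>\<^bsub>N\<^esub> mdiff N (psnd p)))\<rparr>"

text \<open>\<open>K(M; x)\<close> for \<open>x \<in> H\<^sup>0(A)\<close>, on which \<open>x : M \<rightarrow> M\<close> is represented by multiplication with an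
  element \<open>a \<in> A\<^sup>0\<close> of the coset \<open>x\<close>. Different choices give homotopic morphisms, hence
  isomorphic cones.\<close>

definition koszul :: "('a, 'b) dg_ring_scheme \<Rightarrow> ('a, 'm cone_elt) dg_module \<Rightarrow> 'a set \<Rightarrow>
    ('a, 'm cone_elt) dg_module" where
  "koszul A M x = (let a = (SOME a. a \<in> x) in cone A M M (\<lambda>y. a \<odot>\<^bsub>M\<^esub> y))"

text \<open>Below, \<open>m\<close> is the maximal ideal of \<open>H\<^sup>0(A)\<close> and \<open>M\<close> is supposed to have cohomology
  bounded below.\<close>

definition regular_elt :: "'a set set \<Rightarrow> ('a, 'm, 'c) dg_module_scheme \<Rightarrow> 'a set \<Rightarrow> bool" where
  "regular_elt m M x \<longleftrightarrow> x \<in> m \<and>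
     (let H = cohomology M (inf_dg M) in inj_on (\<lambda>y. x \<odot>\<^bsub>H\<^esub> y) (carrier H))"

primrec regular_seq :: "('a, 'b) dg_ring_scheme \<Rightarrow> 'a set set \<Rightarrow> ('a, 'm cone_elt) dg_module \<Rightarrow>
    'a set list \<Rightarrow> bool" where
  "regular_seq A m M [] \<longleftrightarrow> True"
| "regular_seq A m M (x # xs) \<longleftrightarrow> regular_elt m M x \<and> regular_seq A m (koszul A M x) xs"

definition seq_depth :: "('a, 'b) dg_ring_scheme \<Rightarrow> 'a set set \<Rightarrow> 'a set set \<Rightarrow>
    ('a, 'm, 'c) dg_module_scheme \<Rightarrow> ereal" where
  "seq_depth A m I M =
     Sup {ereal (real (length xs)) | xs. set xs \<subseteq> I \<and> regular_seq A m (embed M) xs}"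


section \<open>Localization and the Cohen-Macaulay property\<close>

text \<open>The localization \<open>S\<^sup>-\<^sup>1A = A \<otimes> S\<^sup>-\<^sup>1A\<^sup>0\<close> (tensor product over \<open>A\<^sup>0\<close>) for a multiplicative
  subset \<open>S\<close> of \<open>A\<^sup>0\<close>, with differential \<open>d(a / s) = d(a) / s\<close>.\<close>

definition localize :: "('a, 'b) dg_ring_scheme \<Rightarrow> 'a set \<Rightarrow> ('a \<times> 'a) set dg_ring" where
  "localize A S = (let fr = mod_frac (self_module A) S in
     \<lparr>carrier = fractions (self_module A) S,
      mult = (\<lambda>X Y. \<Union>(a, s)\<in>X. \<Union>(b, t)\<in>Y. fr (a \<otimes>\<^bsub>A\<^esub> b) (s \<otimes>\<^bsub>A\<^esub> t)),
      one = fr \<one>\<^bsub>A\<^esub> \<one>\<^bsub>A\<^esub>, zero = fr \<zero>\<^bsub>A\<^esub> \<one>\<^bsub>A\<^esub>,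
      add = (\<lambda>X Y. \<Union>(a, s)\<in>X. \<Union>(b, t)\<in>Y.
        fr (t \<otimes>\<^bsub>A\<^esub> a \<oplus>\<^bsub>A\<^esub> s \<otimes>\<^bsub>A\<^esub> b) (s \<otimes>\<^bsub>A\<^esub> t)),
      deg = (\<lambda>n. {fr a s | a s. a \<in> deg A n \<and> s \<in> S}),
      diff = (\<lambda>X. \<Union>(a, s)\<in>X. fr (diff A a) s)\<rparr>)"

definition localize_at :: "('a, 'b) dg_ring_scheme \<Rightarrow> 'a set set \<Rightarrow> ('a \<times> 'a) set dg_ring" where
  "localize_at A P = localize A {a \<in> deg A 0. proj0 A a \<notin> P}"

definition local_cohen_macaulay :: "('a, 'b) dg_ring_scheme \<Rightarrow> bool" where
  "local_cohen_macaulay A \<longleftrightarrow> bounded_dg_ring A \<and> (\<exists>m. noetherian_local_dg_ring A m \<and>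
     seq_depth A m m (self_module A) = krull_dim (H0 A))"

definition cohen_macaulay :: "('a, 'b) dg_ring_scheme \<Rightarrow> bool" where
  "cohen_macaulay A \<longleftrightarrow> noetherian_dg_ring A \<and> bounded_dg_ring A \<and>
     (\<forall>P \<in> Spec (H0 A). local_cohen_macaulay (localize_at A P))"

definition constant_amplitude :: "('a, 'b) dg_ring_scheme \<Rightarrow> bool" where
  "constant_amplitude A \<longleftrightarrow>
     Supp (H0 A) (cohomology (self_module A) (inf_dg (self_module A))) = Spec (H0 A)"

end

theory Submission
  imports Defs
begin

text \<open>Let \<open>R = H\<^sup>0(A)\<close> and \<open>d = dim R\<close>. By Nakayama's lemma, \<open>inf K(M; x)\<close> equals \<open>inf(M)\<close> if \<open>x\<close> is
  \<open>M\<close>-regular and \<open>inf(M) - 1\<close> otherwise (\<open>koszul_inf_at\<close>). So a sequence is \<open>M\<close>-regular if and only if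
  its Koszul complex has the same infimum as \<open>M\<close>, and regular sequences can be permuted. The formula
  \<open>seq_depth_formula\<close> rests on three consequences.

  Exchange (\<open>regular_seq_exchange\<close>): if \<open>M\<close> has a regular sequence of length \<open>n + 1\<close> and \<open>x\<close> is
  \<open>M\<close>-regular, then \<open>K(M; x)\<close> has a regular sequence of length \<open>n\<close>. The reason is that for regular
  \<open>x\<close> and \<open>y\<close> the bottom cohomologies of \<open>K(M; x)\<close> and \<open>K(M; y)\<close> have the same socle, namely that of
  \<open>K(M; x, y)\<close> one degree lower. Together with the ascending chain condition, which ends each process
  of extending a regular sequence, this also bounds the lengths of regular sequences.

  Chains upwards (\<open>prime_chain_above_associated_prime\<close>): if \<open>P\<close> is an associated prime of the bottom
  cohomology of \<open>M\<close>, and \<open>M\<close> has a regular sequence of length \<open>k\<close>, then \<open>k \<le> dim R/P\<close>. Indeed,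
  \<open>P\<close> and a regular element \<open>x\<close> both kill some non-zero element of the bottom cohomology of
  \<open>K(M; x)\<close>.

  Chains downwards (\<open>prime_chain_below\<close>): if the bottom cohomology of \<open>M\<close> has the same support as
  \<open>M\<close>, this remains true for \<open>K(M; x)\<close> with regular \<open>x\<close>, and \<open>x\<close> avoids the minimal primes of this
  support. For \<open>A\<close> itself, where the support is all of \<open>Spec R\<close>, a regular sequence of length \<open>n\<close> in
  a prime \<open>P\<close> therefore gives a chain of \<open>n\<close> primes below \<open>P\<close>.

  Hence a regular sequence of length \<open>n\<close> in \<open>I\<close> satisfies \<open>n + dim R/I \<le> d\<close>. If it is maximal in
  \<open>I\<close>, the elements of \<open>I\<close> are zero divisors on the bottom cohomology of its Koszul complex \<open>K\<close>, so
  that \<open>I\<close> is contained in an associated prime \<open>P\<close> by prime avoidance. The Cohen-Macaulay condition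
  provides a regular sequence of length \<open>d\<close> on \<open>A\<close>, exchange one of length \<open>d - n\<close> on \<open>K\<close>, and
  \<open>d - n \<le> dim R/P \<le> dim R/I\<close>.

  Two points concern the DG-structure. The class of complexes of \<open>A\<^sup>0\<close>-modules on which coboundaries
  of \<open>A\<close> act by null-homotopic maps is closed under cones of multiplications, and carries all that
  the argument uses: exact sequences, independence of the chosen representatives, and the isomorphism
  of \<open>K(M; x, y)\<close> with \<open>K(M; y, x)\<close>. The Cohen-Macaulay condition speaks about \<open>A\<^sub>m\<close>, which is
  quasi-isomorphic to \<open>A\<close> but in general not isomorphic, because the elements of \<open>A\<^sup>0\<close> outside the
  preimage of \<open>m\<close> are invertible only up to coboundaries. So regular sequences are shown to be invariant under
  quasi-isomorphisms over different DG-rings (\<open>quasi_iso_regular_seq_iff\<close>).\<close>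

section \<open>Noetherian modules and their zero divisors\<close>

definition noetherian_module :: "('a, 'b) ring_scheme \<Rightarrow> ('a, 'm, 'c) module_scheme \<Rightarrow> bool" where
  "noetherian_module R N \<longleftrightarrow> module R N \<and>
     (\<forall>L. (\<forall>k::nat. submodule (L k) R N \<and> L k \<subseteq> L (Suc k)) \<longrightarrow> (\<exists>k. \<forall>j\<ge>k. L j = L k))"

definition ann :: "('a, 'b) ring_scheme \<Rightarrow> ('a, 'm, 'c) module_scheme \<Rightarrow> 'm \<Rightarrow> 'a set" where
  "ann R N z = {r \<in> carrier R. r \<odot>\<^bsub>N\<^esub> z = \<zero>\<^bsub>N\<^esub>}"

definition nonzerodivisor :: "('a, 'm, 'c) module_scheme \<Rightarrow> 'a \<Rightarrow> bool" where
  "nonzerodivisor N x \<longleftrightarrow> (\<forall>z\<in>carrier N. x \<odot>\<^bsub>N\<^esub> z = \<zero>\<^bsub>N\<^esub> \<longrightarrow> z = \<zero>\<^bsub>N\<^esub>)"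

definition linear_map :: "('a, 'b) ring_scheme \<Rightarrow> ('a, 'm, 'c) module_scheme \<Rightarrow>
    ('a, 'n, 'd) module_scheme \<Rightarrow> ('m \<Rightarrow> 'n) \<Rightarrow> bool" where
  "linear_map R N N' g \<longleftrightarrow> g \<in> carrier N \<rightarrow> carrier N' \<and>
     (\<forall>x\<in>carrier N. \<forall>y\<in>carrier N. g (x \<oplus>\<^bsub>N\<^esub> y) = g x \<oplus>\<^bsub>N'\<^esub> g y) \<and>
     (\<forall>r\<in>carrier R. \<forall>x\<in>carrier N. g (r \<odot>\<^bsub>N\<^esub> x) = r \<odot>\<^bsub>N'\<^esub> g x)"

lemma noetherian_moduleD:
  assumes "noetherian_module R N"
  shows "module R N"
    and "(\<And>k::nat. submodule (L k) R N) \<Longrightarrow> (\<And>k. L k \<subseteq> L (Suc k)) \<Longrightarrow> \<exists>k. \<forall>j\<ge>k. L j = L k"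
  using assms unfolding noetherian_module_def by blast+

lemma linear_mapD:
  assumes "linear_map R N N' g"
  shows "x \<in> carrier N \<Longrightarrow> g x \<in> carrier N'"
    and "x \<in> carrier N \<Longrightarrow> y \<in> carrier N \<Longrightarrow> g (x \<oplus>\<^bsub>N\<^esub> y) = g x \<oplus>\<^bsub>N'\<^esub> g y"
    and "r \<in> carrier R \<Longrightarrow> x \<in> carrier N \<Longrightarrow> g (r \<odot>\<^bsub>N\<^esub> x) = r \<odot>\<^bsub>N'\<^esub> g x"
  using assms unfolding linear_map_def by blast+

lemma linear_map_zero_minus:
  assumes "linear_map R N N' g" "module R N" "module R N'"
  shows "g \<zero>\<^bsub>N\<^esub> = \<zero>\<^bsub>N'\<^esub>"
    and "x \<in> carrier N \<Longrightarrow> g (\<ominus>\<^bsub>N\<^esub> x) = \<ominus>\<^bsub>N'\<^esub> g x"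
proof -
  interpret N: module R N by fact
  interpret N': module R N' by fact
  note g = linear_mapD[OF assms(1)]
  have "g (\<zero>\<^bsub>R\<^esub> \<odot>\<^bsub>N\<^esub> \<zero>\<^bsub>N\<^esub>) = \<zero>\<^bsub>R\<^esub> \<odot>\<^bsub>N'\<^esub> g \<zero>\<^bsub>N\<^esub>"
    by (rule g) auto
  then show "g \<zero>\<^bsub>N\<^esub> = \<zero>\<^bsub>N'\<^esub>" using g(1) by simp
  assume x: "x \<in> carrier N"
  have "g ((\<ominus>\<^bsub>R\<^esub> \<one>\<^bsub>R\<^esub>) \<odot>\<^bsub>N\<^esub> x) = (\<ominus>\<^bsub>R\<^esub> \<one>\<^bsub>R\<^esub>) \<odot>\<^bsub>N'\<^esub> g x"
    using x by (intro g) auto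
  then show "g (\<ominus>\<^bsub>N\<^esub> x) = \<ominus>\<^bsub>N'\<^esub> g x"
    using g(1) x by (simp add: N.smult_l_minus N'.smult_l_minus)
qed

text \<open>Negatives are multiples by \<open>-1\<close>, so that closure under them is automatic.\<close>

lemma (in module) submodule_iff:
  "submodule H R M \<longleftrightarrow> H \<subseteq> carrier M \<and> \<zero>\<^bsub>M\<^esub> \<in> H \<and> (\<forall>x\<in>H. \<forall>y\<in>H. x \<oplus>\<^bsub>M\<^esub> y \<in> H) \<and>
     (\<forall>r\<in>carrier R. \<forall>x\<in>H. r \<odot>\<^bsub>M\<^esub> x \<in> H)"
proof
  assume H: "submodule H R M"
  have "\<zero>\<^bsub>M\<^esub> \<in> H"
    using submoduleE(1,2,4)[OF H] smult_l_null by (metis R.zero_closed all_not_in_conv subsetD)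
  then show "H \<subseteq> carrier M \<and> \<zero>\<^bsub>M\<^esub> \<in> H \<and> (\<forall>x\<in>H. \<forall>y\<in>H. x \<oplus>\<^bsub>M\<^esub> y \<in> H) \<and>
     (\<forall>r\<in>carrier R. \<forall>x\<in>H. r \<odot>\<^bsub>M\<^esub> x \<in> H)"
    using submoduleE[OF H] by blast
next
  assume H: "H \<subseteq> carrier M \<and> \<zero>\<^bsub>M\<^esub> \<in> H \<and> (\<forall>x\<in>H. \<forall>y\<in>H. x \<oplus>\<^bsub>M\<^esub> y \<in> H) \<and>
     (\<forall>r\<in>carrier R. \<forall>x\<in>H. r \<odot>\<^bsub>M\<^esub> x \<in> H)"
  have "\<ominus>\<^bsub>M\<^esub> x \<in> H" if "x \<in> H" for x
  proof -
    have "(\<ominus> \<one>) \<odot>\<^bsub>M\<^esub> x \<in> H" using that H by auto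
    moreover have "x \<in> carrier M" using that H by blast
    ultimately show ?thesis by (simp add: smult_l_minus)
  qed
  then show "submodule H R M" using H by (intro submoduleI) blast+
qed

lemma (in module) ann_ideal:
  assumes "z \<in> carrier M"
  shows "ideal (ann R M z) R"
proof (rule idealI)
  show "ring R" by (rule R.ring_axioms)
  show "subgroup (ann R M z) (add_monoid R)"
  proof (rule R.add.subgroupI)
    show "ann R M z \<noteq> {}" using assms by (auto simp: ann_def intro: exI[of _ \<zero>])
  qed (use assms in \<open>auto simp: ann_def smult_l_distr smult_l_minus simp flip: a_inv_def\<close>)
next
  fix a x assume a: "a \<in> ann R M z" and x: "x \<in> carrier R"
  show "x \<otimes> a \<in> ann R M z" using a x assms by (auto simp: ann_def smult_assoc1)
  then show "a \<otimes> x \<in> ann R M z" using a x by (simp add: ann_def m_comm)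
qed

text \<open>Zorn's lemma, where the ascending chain condition bounds the chains inside the family.\<close>

lemma (in noetherian_ring) maximal_ideal_of_family:
  assumes "F \<subseteq> {I. ideal I R}" "I0 \<in> F"
  shows "\<exists>I\<in>F. I0 \<subseteq> I \<and> (\<forall>J\<in>F. I \<subseteq> J \<longrightarrow> J = I)"
proof -
  define F0 where "F0 = {I \<in> F. I0 \<subseteq> I}"
  have "\<exists>I\<in>F0. \<forall>J\<in>F0. I \<subseteq> J \<longrightarrow> J = I"
  proof (rule subset_Zorn_nonempty)
    show "F0 \<noteq> {}" using assms by (auto simp: F0_def)
    fix C assume C: "C \<noteq> {}" "subset.chain F0 C"
    have "F0 \<subseteq> {I. ideal I R}" using assms(1) by (auto simp: F0_def)
    then have "subset.chain {I. ideal I R} C"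
      using C(2) by (simp add: pred_on.chain_def) (meson order_trans)
    then have "\<Union>C \<in> C" by (rule ideal_chain_is_trivial[OF C(1)])
    moreover have "C \<subseteq> F0" using C(2) by (simp add: pred_on.chain_def)
    ultimately show "\<Union>C \<in> F0" by (rule rev_subsetD)
  qed
  then obtain I where I: "I \<in> F0" "\<And>J. J \<in> F0 \<Longrightarrow> I \<subseteq> J \<Longrightarrow> J = I" by auto
  have "J = I" if "J \<in> F" "I \<subseteq> J" for J
    using that I(1) I(2)[of J] unfolding F0_def by blast
  then show ?thesis using I(1) by (auto simp: F0_def)
qed

lemma (in noetherian_ring) ideal_seq_stabilizes:
  fixes J :: "nat \<Rightarrow> 'a set"
  assumes "\<And>k. ideal (J k) R" "\<And>k. J k \<subseteq> J (Suc k)"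
  shows "\<exists>k. \<forall>j\<ge>k. J j = J k"
proof -
  obtain k where k: "\<forall>I\<in>range J. J k \<subseteq> I \<longrightarrow> I = J k"
    using maximal_ideal_of_family[of "range J" "J 0"] assms(1) by auto
  have "J k \<subseteq> J j" if "j \<ge> k" for j
    by (rule lift_Suc_mono_le[of J, OF assms(2) that])
  then show ?thesis using k by blast
qed

lemma (in module) smult_commute:
  assumes "r \<in> carrier R" "s \<in> carrier R" "z \<in> carrier M"
  shows "s \<odot>\<^bsub>M\<^esub> (r \<odot>\<^bsub>M\<^esub> z) = r \<odot>\<^bsub>M\<^esub> (s \<odot>\<^bsub>M\<^esub> z)"
  using assms by (metis m_comm smult_assoc1)

lemma (in module) smult_in_ann_mono:
  assumes "z \<in> carrier M" "r \<in> carrier R"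
  shows "ann R M z \<subseteq> ann R M (r \<odot>\<^bsub>M\<^esub> z)"
proof
  fix s assume s: "s \<in> ann R M z"
  then have "s \<odot>\<^bsub>M\<^esub> (r \<odot>\<^bsub>M\<^esub> z) = r \<odot>\<^bsub>M\<^esub> (s \<odot>\<^bsub>M\<^esub> z)"
    using assms smult_commute by (simp add: ann_def)
  then show "s \<in> ann R M (r \<odot>\<^bsub>M\<^esub> z)" using s assms by (simp add: ann_def)
qed

text \<open>A maximal annihilator \<open>Ann y\<close> is prime: if \<open>ab y = 0\<close> and \<open>b y \<noteq> 0\<close>, then
  \<open>Ann (b y)\<close> contains \<open>a\<close> and equals \<open>Ann y\<close> by maximality.\<close>

lemma (in module) maximal_ann_prime:
  assumes y: "y \<in> carrier M" "y \<noteq> \<zero>\<^bsub>M\<^esub>"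
    and max: "\<And>w. \<lbrakk>w \<in> carrier M; w \<noteq> \<zero>\<^bsub>M\<^esub>; ann R M y \<subseteq> ann R M w\<rbrakk> \<Longrightarrow> ann R M w = ann R M y"
  shows "primeideal (ann R M y) R"
proof (rule primeidealI)
  show "ideal (ann R M y) R" using ann_ideal y by blast
  show "cring R" by (rule R.is_cring)
  show "carrier R \<noteq> ann R M y"
  proof
    assume "carrier R = ann R M y"
    then have "\<one> \<in> ann R M y" by auto
    then show False using y by (simp add: ann_def)
  qed
  fix a b assume ab: "a \<in> carrier R" "b \<in> carrier R" "a \<otimes> b \<in> ann R M y"
  show "a \<in> ann R M y \<or> b \<in> ann R M y"
  proof (cases "b \<odot>\<^bsub>M\<^esub> y = \<zero>\<^bsub>M\<^esub>")
    case False
    then have "ann R M (b \<odot>\<^bsub>M\<^esub> y) = ann R M y"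
      using max smult_in_ann_mono[OF y(1) ab(2)] ab y by simp
    moreover have "a \<in> ann R M (b \<odot>\<^bsub>M\<^esub> y)"
      using ab y by (simp add: ann_def smult_assoc1)
    ultimately show ?thesis by blast
  qed (use ab in \<open>simp add: ann_def\<close>)
qed

lemma exists_maximal_ann:
  assumes "noetherian_ring R" "module R M" "z \<in> carrier M" "z \<noteq> \<zero>\<^bsub>M\<^esub>"
  shows "\<exists>y\<in>carrier M. y \<noteq> \<zero>\<^bsub>M\<^esub> \<and> ann R M z \<subseteq> ann R M y \<and> primeideal (ann R M y) R \<and>
    (\<forall>w\<in>carrier M. w \<noteq> \<zero>\<^bsub>M\<^esub> \<longrightarrow> ann R M y \<subseteq> ann R M w \<longrightarrow> ann R M w = ann R M y)"
proof -
  interpret R: noetherian_ring R by fact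
  interpret module R M by fact
  define F where "F = {ann R M w | w. w \<in> carrier M \<and> w \<noteq> \<zero>\<^bsub>M\<^esub>}"
  have F: "ann R M w \<in> F" if "w \<in> carrier M" "w \<noteq> \<zero>\<^bsub>M\<^esub>" for w
    using that by (auto simp: F_def)
  have "F \<subseteq> {I. ideal I R}" using ann_ideal by (auto simp: F_def)
  from R.maximal_ideal_of_family[OF this F[OF assms(3,4)]]
  obtain I where I: "I \<in> F" "ann R M z \<subseteq> I" "\<forall>J\<in>F. I \<subseteq> J \<longrightarrow> J = I"
    by (elim bexE conjE) (rule that)
  obtain y where y: "y \<in> carrier M" "y \<noteq> \<zero>\<^bsub>M\<^esub>" "I = ann R M y"
    using I(1) unfolding F_def by auto
  have max: "ann R M w = ann R M y"
    if "w \<in> carrier M" "w \<noteq> \<zero>\<^bsub>M\<^esub>" "ann R M y \<subseteq> ann R M w" for w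
    using that I(3) F y(3) by simp
  have "primeideal (ann R M y) R" using y(1,2) max by (rule maximal_ann_prime)
  then show ?thesis using y I(2) max by (intro bexI[of _ y]) auto
qed


subsection \<open>Prime avoidance\<close>

text \<open>A product of elements of \<open>I\<close> and of all \<open>Q \<in> F\<close>, none of them in \<open>P\<close>.\<close>

lemma prime_not_containing_Inter:
  assumes P: "primeideal P R" and I: "ideal I R" "\<not> I \<subseteq> P" and F: "finite F"
    and FP: "\<And>Q. Q \<in> F \<Longrightarrow> ideal Q R \<and> \<not> Q \<subseteq> P"
  shows "\<exists>y\<in>I. y \<notin> P \<and> (\<forall>Q\<in>F. y \<in> Q)"
  using F FP
proof (induction F rule: finite_induct)
  case empty then show ?case using I by blast
next
  case (insert Q F)
  interpret P: primeideal P R by fact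
  obtain y where y: "y \<in> I" "y \<notin> P" "\<forall>Q\<in>F. y \<in> Q" using insert by blast
  obtain q where q: "q \<in> Q" "q \<notin> P" using insert by blast
  have c: "y \<in> carrier R" "q \<in> carrier R"
    using y q I insert by (meson ideal.Icarr insertI1)+
  have "q \<otimes>\<^bsub>R\<^esub> y \<in> I" using ideal.I_l_closed[OF I(1)] y c by blast
  moreover have "q \<otimes>\<^bsub>R\<^esub> y \<notin> P" using P.I_prime c y q by blast
  moreover have "q \<otimes>\<^bsub>R\<^esub> y \<in> Q" using q c insert by (meson ideal.I_r_closed insertI1)
  moreover have "q \<otimes>\<^bsub>R\<^esub> y \<in> Q'" if "Q' \<in> F" for Q'
    using that y c insert.prems[of Q'] by (meson ideal.I_l_closed insertI2)
  ultimately show ?case by blast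
qed

text \<open>By induction on the number of primes: remove a minimal member \<open>P\<close> of the family. If the
  element \<open>x\<close> found for the others lies in \<open>P\<close>, correct it by an element of \<open>I\<close> outside \<open>P\<close> that lies
  in all the others.\<close>

lemma prime_avoidance:
  assumes I: "ideal I R" and F: "finite F" and FP: "\<And>P. P \<in> F \<Longrightarrow> primeideal P R \<and> \<not> I \<subseteq> P"
  shows "\<exists>x\<in>I. \<forall>P\<in>F. x \<notin> P"
  using F FP
proof (induction "card F" arbitrary: F)
  case 0
  interpret ideal I R by fact
  have "\<zero>\<^bsub>R\<^esub> \<in> I" by (rule additive_subgroup.zero_closed[OF additive_subgroup_axioms])
  moreover have "F = {}" using 0 by simp
  ultimately show ?case by blast
next
  case (Suc n)
  interpret I: ideal I R by fact
  have "F \<noteq> {}" using Suc.hyps(2) by auto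
  then obtain P where P: "P \<in> F" "\<And>Q. Q \<in> F \<Longrightarrow> Q \<subseteq> P \<Longrightarrow> Q = P"
    using finite_has_minimal[OF Suc.prems(1)] by metis
  let ?F = "F - {P}"
  obtain x where x: "x \<in> I" "\<forall>Q\<in>?F. x \<notin> Q"
    using Suc.hyps(1)[of ?F] Suc.hyps(2) Suc.prems P(1) by force
  show ?case
  proof (cases "x \<in> P")
    case True
    obtain y where y: "y \<in> I" "y \<notin> P" "\<forall>Q\<in>?F. y \<in> Q"
      using prime_not_containing_Inter[of P R I ?F] I Suc.prems P
      by (metis Diff_iff finite_Diff insertI1 primeideal.axioms(1))
    have *: "u \<in> Q" if "ideal Q R" "u \<oplus>\<^bsub>R\<^esub> v \<in> Q" "v \<in> Q" "u \<in> carrier R" for u v Q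
    proof -
      interpret Q: ideal Q R by fact
      have "(u \<oplus>\<^bsub>R\<^esub> v) \<oplus>\<^bsub>R\<^esub> \<ominus>\<^bsub>R\<^esub> v \<in> Q" using that by blast
      then show ?thesis using that(3,4) by (simp add: I.a_assoc I.r_neg)
    qed
    have c: "x \<in> carrier R" "y \<in> carrier R" using x y by auto
    have "x \<oplus>\<^bsub>R\<^esub> y \<notin> Q" if Q: "Q \<in> F" for Q
    proof
      assume a: "x \<oplus>\<^bsub>R\<^esub> y \<in> Q"
      have "ideal Q R" using Suc.prems(2)[OF Q] primeideal.axioms(1) by blast
      then show False using *[of Q x y] *[of Q y x] a c x y True Q
        by (cases "Q = P") (auto simp: I.a_comm)
    qed
    then show ?thesis using x y by blast
  qed (use x in blast)
qed

text \<open>The maximal annihilators of a noetherian module are finite in number: for pairwise distinct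
  ones \<open>Q\<^sub>0, Q\<^sub>1, \<dots>\<close> the submodules of elements killed by \<open>Q\<^sub>0 \<inter> \<dots> \<inter> Q\<^sub>k\<close> would strictly increase.\<close>

lemma zero_divisors_finite_union:
  assumes R: "noetherian_ring R" and N: "noetherian_module R M"
  obtains F where "finite F" "\<forall>P\<in>F. primeideal P R"
    "\<forall>P\<in>F. \<exists>z\<in>carrier M. z \<noteq> \<zero>\<^bsub>M\<^esub> \<and> P = ann R M z"
    "\<forall>x\<in>carrier R. (\<forall>P\<in>F. x \<notin> P) \<longrightarrow> nonzerodivisor M x"
proof -
  interpret R: noetherian_ring R by fact
  interpret module R M using N noetherian_moduleD by blast
  define F where "F = {ann R M z | z. z \<in> carrier M \<and> z \<noteq> \<zero>\<^bsub>M\<^esub> \<and> primeideal (ann R M z) R \<and>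
    (\<forall>w\<in>carrier M. w \<noteq> \<zero>\<^bsub>M\<^esub> \<longrightarrow> ann R M z \<subseteq> ann R M w \<longrightarrow> ann R M w = ann R M z)}"
  have "nonzerodivisor M x" if "x \<in> carrier R" "\<forall>P\<in>F. x \<notin> P" for x
    unfolding nonzerodivisor_def
  proof (intro ballI impI, rule ccontr)
    fix z assume z: "z \<in> carrier M" "x \<odot>\<^bsub>M\<^esub> z = \<zero>\<^bsub>M\<^esub>" "z \<noteq> \<zero>\<^bsub>M\<^esub>"
    then have "x \<in> ann R M z" using that by (simp add: ann_def)
    then show False
      using exists_maximal_ann[OF R module_axioms z(1,3)] that(2) unfolding F_def
      by (elim bexE conjE) blast
  qed
  moreover have "finite F"
  proof (rule ccontr)
    assume "infinite F"
    then obtain Q :: "nat \<Rightarrow> 'a set" where Q: "inj Q" "range Q \<subseteq> F"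
      using infinite_countable_subset by blast
    define L where "L k = {y \<in> carrier M. \<forall>r\<in>carrier R. (\<forall>i<k. r \<in> Q i) \<longrightarrow> r \<odot>\<^bsub>M\<^esub> y = \<zero>\<^bsub>M\<^esub>}" for k
    have sub: "submodule (L k) R M" for k
      unfolding submodule_iff L_def
    proof (safe, goal_cases)
      case (6 r x s)
      have "s \<odot>\<^bsub>M\<^esub> (r \<odot>\<^bsub>M\<^esub> x) = r \<odot>\<^bsub>M\<^esub> (s \<odot>\<^bsub>M\<^esub> x)"
        using 6 smult_commute by simp
      then show ?case using 6 by simp
    qed (auto simp: smult_r_distr)
    have "L k \<subseteq> L (Suc k)" for k unfolding L_def by auto
    then have "\<exists>k. \<forall>j\<ge>k. L j = L k" by (rule noetherian_moduleD(2)[OF N sub])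
    then obtain k where k: "\<forall>j\<ge>k. L j = L k" by (elim exE) (rule that)
    have QF: "Q i \<in> F" for i using Q(2) by blast
    obtain z where z: "z \<in> carrier M" "z \<noteq> \<zero>\<^bsub>M\<^esub>" "Q k = ann R M z" "primeideal (ann R M z) R"
      using QF[of k] unfolding F_def mem_Collect_eq by (elim exE conjE) (rule that)
    have "z \<in> L (Suc k)" unfolding L_def using z by (auto simp: ann_def)
    then have zk: "z \<in> L k" using k by (metis le_SucI order_refl)
    have ideals: "ideal (Q i) R" for i
      using QF[of i] ann_ideal unfolding F_def by auto
    have "\<not> Q i \<subseteq> Q k" if "i < k" for i
    proof
      assume s: "Q i \<subseteq> Q k"
      obtain w where w: "Q i = ann R M w"
        "\<forall>v\<in>carrier M. v \<noteq> \<zero>\<^bsub>M\<^esub> \<longrightarrow> ann R M w \<subseteq> ann R M v \<longrightarrow> ann R M v = ann R M w"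
        using QF[of i] unfolding F_def mem_Collect_eq by (elim exE conjE) (rule that)
      then have "Q k = Q i" using z(1-3) s by metis
      then show False using Q(1) that by (metis inj_eq less_irrefl)
    qed
    moreover have "carrier R \<noteq> Q k" using z by (metis primeideal.I_notcarr)
    then have "\<not> carrier R \<subseteq> Q k" using ideals[of k] by (meson ideal.Icarr subsetI subset_antisym)
    ultimately have "\<exists>y\<in>carrier R. y \<notin> Q k \<and> (\<forall>J\<in>Q ` {..<k}. y \<in> J)"
      using z(3,4) ideals R.oneideal
      by (intro prime_not_containing_Inter[where R = R]) auto
    then show False using zk z unfolding L_def by (auto simp: ann_def)
  qed
  ultimately show ?thesis by (intro that[of F]) (auto simp: F_def)
qed

text \<open>Prime avoidance for the maximal annihilators of both modules together.\<close>

lemma common_nonzerodivisor: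
  assumes R: "noetherian_ring R" and I: "ideal I R"
    and M: "noetherian_module R M" "\<And>z. \<lbrakk>z \<in> carrier M; I \<subseteq> ann R M z\<rbrakk> \<Longrightarrow> z = \<zero>\<^bsub>M\<^esub>"
    and N: "noetherian_module R N" "\<And>z. \<lbrakk>z \<in> carrier N; I \<subseteq> ann R N z\<rbrakk> \<Longrightarrow> z = \<zero>\<^bsub>N\<^esub>"
  shows "\<exists>x\<in>I. nonzerodivisor M x \<and> nonzerodivisor N x"
proof -
  obtain F where F: "finite F" "\<forall>P\<in>F. primeideal P R"
    "\<forall>P\<in>F. \<exists>z\<in>carrier M. z \<noteq> \<zero>\<^bsub>M\<^esub> \<and> P = ann R M z"
    "\<forall>x\<in>carrier R. (\<forall>P\<in>F. x \<notin> P) \<longrightarrow> nonzerodivisor M x"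
    by (rule zero_divisors_finite_union[OF R M(1)])
  obtain G where G: "finite G" "\<forall>P\<in>G. primeideal P R"
    "\<forall>P\<in>G. \<exists>z\<in>carrier N. z \<noteq> \<zero>\<^bsub>N\<^esub> \<and> P = ann R N z"
    "\<forall>x\<in>carrier R. (\<forall>P\<in>G. x \<notin> P) \<longrightarrow> nonzerodivisor N x"
    by (rule zero_divisors_finite_union[OF R N(1)])
  have "primeideal P R \<and> \<not> I \<subseteq> P" if "P \<in> F \<union> G" for P
    using that F(2,3) G(2,3) M(2) N(2) by (metis Un_iff)
  moreover have "finite (F \<union> G)" using F(1) G(1) by simp
  ultimately have "\<exists>x\<in>I. \<forall>P\<in>F \<union> G. x \<notin> P" by (intro prime_avoidance[OF I])
  then obtain x where x: "x \<in> I" "\<forall>P\<in>F \<union> G. x \<notin> P" by (elim bexE) (rule that)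
  have "x \<in> carrier R" using ideal.Icarr[OF I x(1)] .
  then show ?thesis using F(4) G(4) x by (intro bexI[of _ x] conjI) auto
qed

lemma (in module) smult_assoc_swap:
  assumes "r \<in> carrier R" "s \<in> carrier R" "z \<in> carrier M"
  shows "(r \<otimes> s) \<odot>\<^bsub>M\<^esub> z = s \<odot>\<^bsub>M\<^esub> (r \<odot>\<^bsub>M\<^esub> z)"
  using assms by (metis m_comm smult_assoc1)

text \<open>The element \<open>s z\<close> being outside \<open>x W\<close> for all \<open>s \<notin> P\<close> says that \<open>z\<close> is non-zero in
  \<open>(W / x W)\<^sub>P\<close>; this is Nakayama's lemma for the module \<open>W\<^sub>P\<close> over \<open>R\<^sub>P\<close>. If it failed, one could
  divide by \<open>x\<close> again and again: \<open>s\<^sub>k z\<^sub>k = x z\<^sub>k\<^sub>+\<^sub>1\<close> with \<open>s\<^sub>k \<notin> P\<close>. The submodules generated by the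
  \<open>z\<^sub>k\<close> in \<open>W\<^sub>P\<close> stabilize, so that \<open>z\<^sub>k\<^sub>+\<^sub>1\<close> is a multiple of \<open>z\<^sub>k\<close>, hence of \<open>x z\<^sub>k\<^sub>+\<^sub>1\<close>, up to
  elements outside \<open>P\<close>, and therefore \<open>z\<^sub>0\<close> vanishes in \<open>W\<^sub>P\<close>.\<close>

lemma nakayama_at_prime:
  fixes R (structure)
  assumes N: "noetherian_module R M" and W: "submodule W R M" and P: "primeideal P R"
    and x: "x \<in> P" and z0: "z0 \<in> W" "ann R M z0 \<subseteq> P"
  shows "\<exists>z\<in>W. \<forall>s\<in>carrier R - P. \<forall>w\<in>W. s \<odot>\<^bsub>M\<^esub> z \<noteq> x \<odot>\<^bsub>M\<^esub> w"
proof (rule ccontr)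
  assume neg: "\<not> ?thesis"
  interpret P: primeideal P R by fact
  interpret module R M using N noetherian_moduleD by blast
  note WE = W[unfolded submodule_iff]
  have xc: "x \<in> carrier R" using x P.Icarr by blast
  have mult: "s \<otimes> t \<in> carrier R - P" if "s \<in> carrier R - P" "t \<in> carrier R - P" for s t
    using that P.I_prime by blast
  have "\<forall>z\<in>W. \<exists>s w. s \<in> carrier R - P \<and> w \<in> W \<and> s \<odot>\<^bsub>M\<^esub> z = x \<odot>\<^bsub>M\<^esub> w" using neg by blast
  then obtain S F where SF: "\<And>z. z \<in> W \<Longrightarrow> S z \<in> carrier R - P \<and> F z \<in> W \<and> S z \<odot>\<^bsub>M\<^esub> z = x \<odot>\<^bsub>M\<^esub> F z"
    by metis
  define z where "z k = (F ^^ k) z0" for k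
  have zW: "z k \<in> W" for k unfolding z_def using z0 SF by (induction k) auto
  have zc: "z k \<in> carrier M" for k using zW WE by blast
  have step: "S (z k) \<in> carrier R - P" "S (z k) \<odot>\<^bsub>M\<^esub> z k = x \<odot>\<^bsub>M\<^esub> z (Suc k)" for k
    using SF[OF zW[of k]] by (auto simp: z_def)
  have Sc: "S (z k) \<in> carrier R" for k using step by blast
  have nonzero: "s \<odot>\<^bsub>M\<^esub> z k \<noteq> \<zero>\<^bsub>M\<^esub>" if "s \<in> carrier R - P" for k s
    using that
  proof (induction k arbitrary: s)
    case 0
    then show ?case using z0(2) by (auto simp: z_def ann_def)
  next
    case (Suc k)
    show ?case
    proof
      assume a: "s \<odot>\<^bsub>M\<^esub> z (Suc k) = \<zero>\<^bsub>M\<^esub>"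
      have sc: "s \<in> carrier R" using Suc.prems by blast
      have "(s \<otimes> S (z k)) \<odot>\<^bsub>M\<^esub> z k = s \<odot>\<^bsub>M\<^esub> (x \<odot>\<^bsub>M\<^esub> z (Suc k))"
        using smult_assoc1[OF sc Sc zc] step(2) by simp
      also have "\<dots> = x \<odot>\<^bsub>M\<^esub> (s \<odot>\<^bsub>M\<^esub> z (Suc k))"
        by (rule smult_commute[OF xc sc zc])
      also have "\<dots> = \<zero>\<^bsub>M\<^esub>" using a xc by simp
      finally show False using Suc.IH[OF mult[OF Suc.prems step(1)]] by blast
    qed
  qed
  define L where "L k = {y \<in> carrier M. \<exists>s\<in>carrier R - P. \<exists>r\<in>carrier R. s \<odot>\<^bsub>M\<^esub> y = r \<odot>\<^bsub>M\<^esub> z k}" for k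
  have LI: "y \<in> L k" if "y \<in> carrier M" "s \<in> carrier R - P" "r \<in> carrier R" "s \<odot>\<^bsub>M\<^esub> y = r \<odot>\<^bsub>M\<^esub> z k" for y s r k
    using that unfolding L_def by blast
  have one: "\<one> \<in> carrier R - P" using P.I_notcarr P.one_imp_carrier by blast
  have sub: "submodule (L k) R M" for k
    unfolding submodule_iff
  proof (intro conjI ballI)
    show "L k \<subseteq> carrier M" by (auto simp: L_def)
    show "\<zero>\<^bsub>M\<^esub> \<in> L k" using one zc by (rule_tac LI[of _ \<one> \<zero>]) auto
  next
    fix y y' assume "y \<in> L k" "y' \<in> L k"
    then obtain s r s' r' where c: "y \<in> carrier M" "y' \<in> carrier M"
      "s \<in> carrier R - P" "s' \<in> carrier R - P" "r \<in> carrier R" "r' \<in> carrier R"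
      "s \<odot>\<^bsub>M\<^esub> y = r \<odot>\<^bsub>M\<^esub> z k" "s' \<odot>\<^bsub>M\<^esub> y' = r' \<odot>\<^bsub>M\<^esub> z k" unfolding L_def by auto
    have sc: "s \<in> carrier R" "s' \<in> carrier R" using c by auto
    have "(s \<otimes> s') \<odot>\<^bsub>M\<^esub> (y \<oplus>\<^bsub>M\<^esub> y') = s' \<odot>\<^bsub>M\<^esub> (s \<odot>\<^bsub>M\<^esub> y) \<oplus>\<^bsub>M\<^esub> s \<odot>\<^bsub>M\<^esub> (s' \<odot>\<^bsub>M\<^esub> y')"
      using c sc by (simp add: smult_r_distr smult_assoc1 smult_commute[of s' s y])
    also have "\<dots> = (s' \<otimes> r \<oplus> s \<otimes> r') \<odot>\<^bsub>M\<^esub> z k"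
      using c sc zc by (simp add: smult_l_distr smult_assoc1)
    finally show "y \<oplus>\<^bsub>M\<^esub> y' \<in> L k" using c sc mult[OF c(3,4)]
      by (rule_tac LI[of _ "s \<otimes> s'" "s' \<otimes> r \<oplus> s \<otimes> r'"]) auto
  next
    fix t y assume t: "t \<in> carrier R" and "y \<in> L k"
    then obtain s r where c: "y \<in> carrier M" "s \<in> carrier R - P" "r \<in> carrier R"
      "s \<odot>\<^bsub>M\<^esub> y = r \<odot>\<^bsub>M\<^esub> z k" unfolding L_def by auto
    have sc: "s \<in> carrier R" using c by auto
    have "s \<odot>\<^bsub>M\<^esub> (t \<odot>\<^bsub>M\<^esub> y) = (t \<otimes> r) \<odot>\<^bsub>M\<^esub> z k"
      using c t zc sc smult_commute[of t s y] by (simp add: smult_assoc1)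
    then show "t \<odot>\<^bsub>M\<^esub> y \<in> L k" using c t
      by (rule_tac LI[of _ s "t \<otimes> r"]) auto
  qed
  have "L k \<subseteq> L (Suc k)" for k
  proof
    fix y assume "y \<in> L k"
    then obtain s r where c: "y \<in> carrier M" "s \<in> carrier R - P" "r \<in> carrier R"
      "s \<odot>\<^bsub>M\<^esub> y = r \<odot>\<^bsub>M\<^esub> z k" unfolding L_def by auto
    have sc: "s \<in> carrier R" using c by auto
    have "(S (z k) \<otimes> s) \<odot>\<^bsub>M\<^esub> y = r \<odot>\<^bsub>M\<^esub> (S (z k) \<odot>\<^bsub>M\<^esub> z k)"
      using smult_assoc1[OF Sc sc c(1)] smult_commute[OF c(3) Sc zc] c(4) by simp
    also have "\<dots> = (r \<otimes> x) \<odot>\<^bsub>M\<^esub> z (Suc k)" using step c xc zc by (simp add: smult_assoc1)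
    finally show "y \<in> L (Suc k)" using c xc mult[OF step(1) c(2)]
      by (rule_tac LI[of _ "S (z k) \<otimes> s" "r \<otimes> x"]) auto
  qed
  then have "\<exists>k. \<forall>j\<ge>k. L j = L k" by (rule noetherian_moduleD(2)[OF N sub])
  then obtain k where k: "\<forall>j\<ge>k. L j = L k" by (elim exE) (rule that)
  have "z (Suc k) \<in> L (Suc k)" using one zc by (rule_tac LI[of _ \<one> \<one>]) auto
  then have "z (Suc k) \<in> L k" using k by (metis le_SucI order_refl)
  then obtain s r where c: "s \<in> carrier R - P" "r \<in> carrier R" "s \<odot>\<^bsub>M\<^esub> z (Suc k) = r \<odot>\<^bsub>M\<^esub> z k"
    unfolding L_def by auto
  have sc: "s \<in> carrier R" using c by auto
  have e1: "(S (z k) \<otimes> s) \<odot>\<^bsub>M\<^esub> z (Suc k) = (r \<otimes> x) \<odot>\<^bsub>M\<^esub> z (Suc k)"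
    using smult_assoc1[OF Sc sc zc] smult_commute[OF c(2) Sc zc] c step xc zc by (simp add: smult_assoc1)
  let ?t = "S (z k) \<otimes> s \<oplus> \<ominus> (r \<otimes> x)"
  have "?t \<odot>\<^bsub>M\<^esub> z (Suc k) = (S (z k) \<otimes> s) \<odot>\<^bsub>M\<^esub> z (Suc k) \<oplus>\<^bsub>M\<^esub> (\<ominus> (r \<otimes> x)) \<odot>\<^bsub>M\<^esub> z (Suc k)"
    using Sc[of k] sc c(2) xc zc by (intro smult_l_distr) auto
  also have "\<dots> = \<zero>\<^bsub>M\<^esub>"
    using c xc zc e1 by (simp add: smult_l_minus M.r_neg)
  finally have "?t \<odot>\<^bsub>M\<^esub> z (Suc k) = \<zero>\<^bsub>M\<^esub>" .
  moreover have "?t \<in> carrier R - P"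
  proof -
    have rx: "r \<otimes> x \<in> P" using c x P.I_l_closed by blast
    have "?t \<notin> P"
    proof
      assume "?t \<in> P"
      then have "?t \<oplus> r \<otimes> x \<in> P" using rx by blast
      moreover have "?t \<oplus> r \<otimes> x = S (z k) \<otimes> s"
        using Sc[of k] sc c(2) xc by (simp add: P.a_assoc P.l_neg)
      ultimately show False using mult[OF step(1) c(1)] by auto
    qed
    then show ?thesis using c Sc[of k] sc xc by simp
  qed
  ultimately show False using nonzero by blast
qed

subsection \<open>Supports\<close>

text \<open>The primes \<open>P\<close> with \<open>N\<^sub>P \<noteq> 0\<close>, written without localizing: the fraction \<open>z / 1\<close> is non-zero
  when no element outside \<open>P\<close> kills \<open>z\<close>.\<close>

definition module_support :: "('a, 'b) ring_scheme \<Rightarrow> ('a, 'm, 'c) module_scheme \<Rightarrow> 'a set set" where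
  "module_support R N = {P. primeideal P R \<and> (\<exists>z\<in>carrier N. ann R N z \<subseteq> P)}"

text \<open>If every element of \<open>N\<close> is killed by an element outside \<open>P\<close>, then all fractions coincide.\<close>

lemma Supp_subset_module_support:
  fixes R (structure)
  assumes "module R N"
  shows "Supp R N \<subseteq> module_support R N"
proof
  interpret module R N by fact
  fix P assume "P \<in> Supp R N"
  then have P: "primeideal P R"
    and ne: "fractions N (carrier R - P) \<noteq> {mod_frac N (carrier R - P) \<zero>\<^bsub>N\<^esub> \<one>\<^bsub>R\<^esub>}"
    by (auto simp: Supp_def Spec_def)
  interpret P: primeideal P R by fact
  let ?S = "carrier R - P"
  have one: "\<one> \<in> ?S" using P.I_notcarr P.one_imp_carrier by blast
  have "\<exists>z\<in>carrier N. ann R N z \<subseteq> P"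
  proof (rule ccontr)
    assume "\<not> (\<exists>z\<in>carrier N. ann R N z \<subseteq> P)"
    then have kill: "\<exists>u\<in>?S. u \<odot>\<^bsub>N\<^esub> z = \<zero>\<^bsub>N\<^esub>" if "z \<in> carrier N" for z
      using that by (auto simp: ann_def)
    have "mod_frac N ?S x s = carrier N \<times> ?S" if x: "x \<in> carrier N" and s: "s \<in> ?S" for x s
    proof -
      have "\<exists>u\<in>?S. u \<odot>\<^bsub>N\<^esub> (t \<odot>\<^bsub>N\<^esub> x) = u \<odot>\<^bsub>N\<^esub> (s \<odot>\<^bsub>N\<^esub> y)" if y: "y \<in> carrier N" and t: "t \<in> ?S" for y t
      proof -
        obtain u where u: "u \<in> ?S" "u \<odot>\<^bsub>N\<^esub> (t \<odot>\<^bsub>N\<^esub> x) = \<zero>\<^bsub>N\<^esub>" using kill[of "t \<odot>\<^bsub>N\<^esub> x"] x t by auto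
        obtain v where v: "v \<in> ?S" "v \<odot>\<^bsub>N\<^esub> (s \<odot>\<^bsub>N\<^esub> y) = \<zero>\<^bsub>N\<^esub>" using kill[of "s \<odot>\<^bsub>N\<^esub> y"] y s by auto
        have "u \<otimes> v \<in> ?S" using u v P.I_prime by blast
        moreover have "(u \<otimes> v) \<odot>\<^bsub>N\<^esub> (t \<odot>\<^bsub>N\<^esub> x) = v \<odot>\<^bsub>N\<^esub> (u \<odot>\<^bsub>N\<^esub> (t \<odot>\<^bsub>N\<^esub> x))"
          using u v x t by (intro smult_assoc_swap) auto
        moreover have "(u \<otimes> v) \<odot>\<^bsub>N\<^esub> (s \<odot>\<^bsub>N\<^esub> y) = u \<odot>\<^bsub>N\<^esub> (v \<odot>\<^bsub>N\<^esub> (s \<odot>\<^bsub>N\<^esub> y))"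
          using u v y s by (simp add: smult_assoc1)
        ultimately show ?thesis using u v by (intro bexI[of _ "u \<otimes> v"]) auto
      qed
      then show ?thesis by (auto simp: mod_frac_def)
    qed
    then have all: "mod_frac N ?S x s = mod_frac N ?S \<zero>\<^bsub>N\<^esub> \<one>" if "x \<in> carrier N" "s \<in> ?S" for x s
      using that one by (metis M.zero_closed)
    have "fractions N ?S = {mod_frac N ?S \<zero>\<^bsub>N\<^esub> \<one>}"
    proof (intro equalityI subsetI)
      fix X assume "X \<in> fractions N ?S"
      then obtain x s where "X = mod_frac N ?S x s" "x \<in> carrier N" "s \<in> ?S"
        unfolding fractions_def mem_Collect_eq by (elim exE conjE) (rule that)
      then show "X \<in> {mod_frac N ?S \<zero>\<^bsub>N\<^esub> \<one>}" using all by simp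
    next
      fix X assume "X \<in> {mod_frac N ?S \<zero>\<^bsub>N\<^esub> \<one>}"
      then show "X \<in> fractions N ?S" unfolding fractions_def using one M.zero_closed by blast
    qed
    then show False using ne by blast
  qed
  then show "P \<in> module_support R N" using P by (simp add: module_support_def)
qed

text \<open>An ideal \<open>Q\<close> that is maximal among those avoiding \<open>S\<close> is prime: for \<open>a, b \<notin> Q\<close>, both \<open>Q + (a)\<close>
  and \<open>Q + (b)\<close> meet \<open>S\<close>, and multiplying two such elements puts an element of \<open>S\<close> into
  \<open>Q + (ab)\<close>.\<close>

lemma prime_disjoint_from_multiplicative:
  assumes R: "noetherian_ring R" "cring R" and J: "ideal J R"
    and S: "\<one>\<^bsub>R\<^esub> \<in> S" "S \<subseteq> carrier R" "\<And>s t. s \<in> S \<Longrightarrow> t \<in> S \<Longrightarrow> s \<otimes>\<^bsub>R\<^esub> t \<in> S" "J \<inter> S = {}"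
  shows "\<exists>Q. primeideal Q R \<and> J \<subseteq> Q \<and> Q \<inter> S = {}"
proof -
  interpret R: noetherian_ring R by fact
  interpret R: cring R by fact
  define F where "F = {I. ideal I R \<and> I \<inter> S = {}}"
  have "F \<subseteq> {I. ideal I R}" "J \<in> F" using J S(4) by (auto simp: F_def)
  from R.maximal_ideal_of_family[OF this]
  obtain Q where Q: "Q \<in> F" "J \<subseteq> Q" "\<forall>I\<in>F. Q \<subseteq> I \<longrightarrow> I = Q" by (elim bexE conjE) (rule that)
  have Qi: "ideal Q R" and QS: "Q \<inter> S = {}" using Q(1) by (auto simp: F_def)
  interpret Q: ideal Q R by fact
  have "primeideal Q R"
  proof (rule primeidealI[OF Qi R.is_cring])
    show "carrier R \<noteq> Q" using S(1,2) QS by blast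
    fix a b assume ab: "a \<in> carrier R" "b \<in> carrier R" "a \<otimes>\<^bsub>R\<^esub> b \<in> Q"
    have meet: "\<exists>s\<in>S. \<exists>r\<in>carrier R. \<exists>q\<in>Q. s = q \<oplus>\<^bsub>R\<^esub> r \<otimes>\<^bsub>R\<^esub> c" if c: "c \<in> carrier R" "c \<notin> Q" for c
    proof -
      let ?I = "Q <+>\<^bsub>R\<^esub> PIdl\<^bsub>R\<^esub> c"
      have I: "ideal ?I R" by (rule R.add_ideals[OF Qi R.cgenideal_ideal[OF c(1)]])
      have mem: "q \<oplus>\<^bsub>R\<^esub> r \<otimes>\<^bsub>R\<^esub> c \<in> ?I" if "q \<in> Q" "r \<in> carrier R" for q r
        using that by (auto simp: set_add_def' cgenideal_def)
      have "Q \<subseteq> ?I" using mem[of _ "\<zero>\<^bsub>R\<^esub>"] c by auto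
      moreover have "c \<in> ?I" using mem[of "\<zero>\<^bsub>R\<^esub>" "\<one>\<^bsub>R\<^esub>"] c by simp
      ultimately have "?I \<notin> F" using Q(3) c(2) by blast
      then have "?I \<inter> S \<noteq> {}" using I by (simp add: F_def)
      then show ?thesis by (auto simp: set_add_def' cgenideal_def)
    qed
    show "a \<in> Q \<or> b \<in> Q"
    proof (rule ccontr)
      assume "\<not> (a \<in> Q \<or> b \<in> Q)"
      then obtain s r q s' r' q' where
        s: "s \<in> S" "r \<in> carrier R" "q \<in> Q" "s = q \<oplus>\<^bsub>R\<^esub> r \<otimes>\<^bsub>R\<^esub> a" and
        s': "s' \<in> S" "r' \<in> carrier R" "q' \<in> Q" "s' = q' \<oplus>\<^bsub>R\<^esub> r' \<otimes>\<^bsub>R\<^esub> b"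
        using meet[OF ab(1)] meet[OF ab(2)] by auto
      have qc: "q \<in> carrier R" "q' \<in> carrier R" using s s' by auto
      have "s \<otimes>\<^bsub>R\<^esub> s' = q \<otimes>\<^bsub>R\<^esub> (q' \<oplus>\<^bsub>R\<^esub> r' \<otimes>\<^bsub>R\<^esub> b) \<oplus>\<^bsub>R\<^esub> ((r \<otimes>\<^bsub>R\<^esub> a) \<otimes>\<^bsub>R\<^esub> q' \<oplus>\<^bsub>R\<^esub> (r \<otimes>\<^bsub>R\<^esub> r') \<otimes>\<^bsub>R\<^esub> (a \<otimes>\<^bsub>R\<^esub> b))"
        unfolding s(4) s'(4) using s(2) s'(2) qc ab(1,2) by algebra
      also have "\<dots> \<in> Q"
      proof (intro Q.a_closed)
        show "q \<otimes>\<^bsub>R\<^esub> (q' \<oplus>\<^bsub>R\<^esub> r' \<otimes>\<^bsub>R\<^esub> b) \<in> Q" using s s' ab qc by (rule_tac Q.I_r_closed) auto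
        show "(r \<otimes>\<^bsub>R\<^esub> a) \<otimes>\<^bsub>R\<^esub> q' \<in> Q" using s s' ab by (rule_tac Q.I_l_closed) auto
        show "(r \<otimes>\<^bsub>R\<^esub> r') \<otimes>\<^bsub>R\<^esub> (a \<otimes>\<^bsub>R\<^esub> b) \<in> Q" using s s' ab by (rule_tac Q.I_l_closed) auto
      qed
      finally show False using S(3)[OF s(1) s'(1)] QS by blast
    qed
  qed
  then show ?thesis using Q(2) QS by blast
qed

text \<open>A nonzerodivisor on \<open>N\<close> lies in no minimal prime of the support of \<open>N\<close>: the elements
  \<open>x\<^sup>k s\<close> with \<open>s \<notin> P\<close> avoid \<open>Ann z\<close>, so that some prime between \<open>Ann z\<close> and \<open>P\<close> avoids \<open>x\<close>.\<close>

lemma nonzerodivisor_avoids_smaller_support_prime: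
  fixes R (structure)
  assumes R: "noetherian_ring R" and N: "module R N"
    and P: "P \<in> module_support R N" and x: "x \<in> carrier R" "nonzerodivisor N x"
  shows "\<exists>Q\<in>module_support R N. Q \<subseteq> P \<and> x \<notin> Q"
proof -
  interpret module R N by fact
  obtain z where z: "z \<in> carrier N" "ann R N z \<subseteq> P" and P: "primeideal P R"
    using P by (auto simp: module_support_def)
  interpret P: primeideal P R by fact
  define S where "S = {x [^] (k::nat) \<otimes> s | k s. s \<in> carrier R - P}"
  have one: "\<one> \<in> carrier R - P" using P.I_notcarr P.one_imp_carrier by blast
  have mem: "x [^] (k::nat) \<otimes> s \<in> S" if "s \<in> carrier R - P" for k s using that by (auto simp: S_def)
  have pow: "x [^] (k::nat) \<odot>\<^bsub>N\<^esub> w = \<zero>\<^bsub>N\<^esub> \<Longrightarrow> w = \<zero>\<^bsub>N\<^esub>" if "w \<in> carrier N" for k w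
  proof (induction k)
    case (Suc k)
    have "x \<odot>\<^bsub>N\<^esub> (x [^] k \<odot>\<^bsub>N\<^esub> w) = x [^] Suc k \<odot>\<^bsub>N\<^esub> w"
      using smult_assoc_swap[of "x [^] k" x w] x that by simp
    then have "x [^] k \<odot>\<^bsub>N\<^esub> w = \<zero>\<^bsub>N\<^esub>"
      using Suc.prems x that by (simp add: nonzerodivisor_def)
    then show ?case by (rule Suc.IH)
  qed (use that in simp)
  have disj: "ann R N z \<inter> S = {}"
  proof -
    have "s \<in> P" if "s \<in> carrier R" "(x [^] (k::nat) \<otimes> s) \<odot>\<^bsub>N\<^esub> z = \<zero>\<^bsub>N\<^esub>" for k s
      using that pow[of "s \<odot>\<^bsub>N\<^esub> z" k] x z by (auto simp: smult_assoc1 ann_def)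
    then show ?thesis unfolding S_def ann_def by blast
  qed
  have closed: "s \<otimes> t \<in> S" if st: "s \<in> S" "t \<in> S" for s t
  proof -
    obtain k u l v where kl: "s = x [^] (k::nat) \<otimes> u" "t = x [^] (l::nat) \<otimes> v"
      "u \<in> carrier R - P" "v \<in> carrier R - P" using st unfolding S_def by blast
    have "s \<otimes> t = (x [^] k \<otimes> x [^] l) \<otimes> (u \<otimes> v)"
      using kl x by (simp add: m_assoc m_lcomm)
    also have "\<dots> = x [^] (k + l) \<otimes> (u \<otimes> v)" using x by (simp add: nat_pow_mult)
    finally show ?thesis using kl mem[of "u \<otimes> v" "k + l"] P.I_prime by auto
  qed
  obtain Q where Q: "primeideal Q R" "ann R N z \<subseteq> Q" "Q \<inter> S = {}"
    using prime_disjoint_from_multiplicative[OF R R.is_cring ann_ideal[OF z(1)] _ _ closed disj]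
      mem[OF one, of 0] x by (auto simp: S_def)
  have "Q \<subseteq> P"
  proof
    fix s assume s: "s \<in> Q"
    then have "s \<in> carrier R" using Q(1) by (meson ideal.Icarr primeideal.axioms(1))
    then show "s \<in> P" using mem[of s 0] s Q(3) by auto
  qed
  moreover have "x \<notin> Q" using mem[OF one, of 1] x Q(3) by auto
  ultimately show ?thesis using Q z by (auto simp: module_support_def)
qed

text \<open>A chain of submodules of \<open>N\<close> is determined by its preimages in \<open>N\<^sub>1\<close> and its images in
  \<open>N\<^sub>2\<close>, once these are stationary.\<close>

lemma noetherian_module_exact:
  assumes N: "module R N" and N1: "noetherian_module R N1" and N2: "noetherian_module R N2"
    and f: "linear_map R N1 N f" and g: "linear_map R N N2 g"
    and exact: "\<And>y. y \<in> carrier N \<Longrightarrow> g y = \<zero>\<^bsub>N2\<^esub> \<Longrightarrow> y \<in> f ` carrier N1"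
  shows "noetherian_module R N"
  unfolding noetherian_module_def
proof (intro conjI allI impI)
  show "module R N" by fact
  interpret N: module R N by fact
  interpret N1: module R N1 using N1 noetherian_moduleD by blast
  interpret N2: module R N2 using N2 noetherian_moduleD by blast
  note fD = linear_mapD[OF f] and gD = linear_mapD[OF g]
  note f0 = linear_map_zero_minus[OF f N1.module_axioms N] and g0 = linear_map_zero_minus[OF g N N2.module_axioms]
  fix L :: "nat \<Rightarrow> _" assume L: "\<forall>k. submodule (L k) R N \<and> L k \<subseteq> L (Suc k)"
  have LE: "L k \<subseteq> carrier N" "\<zero>\<^bsub>N\<^esub> \<in> L k" "x \<in> L k \<Longrightarrow> y \<in> L k \<Longrightarrow> x \<oplus>\<^bsub>N\<^esub> y \<in> L k"
    "r \<in> carrier R \<Longrightarrow> x \<in> L k \<Longrightarrow> r \<odot>\<^bsub>N\<^esub> x \<in> L k" for k x y r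
    using L unfolding N.submodule_iff by blast+
  have Lm: "\<ominus>\<^bsub>N\<^esub> x \<in> L k" if "x \<in> L k" for x k using N.submoduleE(3) L that by blast
  have mono: "L k \<subseteq> L j" if "k \<le> j" for k j
    using lift_Suc_mono_le[of L, OF _ that] L by blast
  have mono1: "{w \<in> carrier N1. f w \<in> L k} \<subseteq> {w \<in> carrier N1. f w \<in> L (Suc k)}" for k using L by blast
  have "submodule {w \<in> carrier N1. f w \<in> L k} R N1" for k
    unfolding N1.submodule_iff using LE fD f0 by auto
  from noetherian_moduleD(2)[OF N1, of "\<lambda>k. {w \<in> carrier N1. f w \<in> L k}", OF this mono1]
  obtain k1 where k1: "\<And>j. j \<ge> k1 \<Longrightarrow> {w \<in> carrier N1. f w \<in> L j} = {w \<in> carrier N1. f w \<in> L k1}"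
    by blast
  have "submodule (g ` L k) R N2" for k
    unfolding N2.submodule_iff
  proof (intro conjI ballI)
    show "g ` L k \<subseteq> carrier N2" using LE(1)[of k] gD(1) by blast
    show "\<zero>\<^bsub>N2\<^esub> \<in> g ` L k" using LE(2)[of k] g0(1) by (metis imageI)
  next
    fix u v assume "u \<in> g ` L k" "v \<in> g ` L k"
    then obtain x y where xy: "x \<in> L k" "y \<in> L k" "u = g x" "v = g y" by blast
    then have "u \<oplus>\<^bsub>N2\<^esub> v = g (x \<oplus>\<^bsub>N\<^esub> y)" using gD(2) LE(1)[of k] by (metis subsetD)
    then show "u \<oplus>\<^bsub>N2\<^esub> v \<in> g ` L k" using xy LE(3) by blast
  next
    fix r u assume r: "r \<in> carrier R" and "u \<in> g ` L k"
    then obtain x where x: "x \<in> L k" "u = g x" by blast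
    then have "r \<odot>\<^bsub>N2\<^esub> u = g (r \<odot>\<^bsub>N\<^esub> x)" using gD(3) LE(1)[of k] r by (metis subsetD)
    then show "r \<odot>\<^bsub>N2\<^esub> u \<in> g ` L k" using x LE(4) r by blast
  qed
  moreover have "g ` L k \<subseteq> g ` L (Suc k)" for k using L by blast
  ultimately obtain k2 where k2: "\<And>j. j \<ge> k2 \<Longrightarrow> g ` L j = g ` L k2"
    using noetherian_moduleD(2)[OF N2, of "\<lambda>k. g ` L k"] by blast
  show "\<exists>k. \<forall>j\<ge>k. L j = L k"
  proof (intro exI allI impI equalityI)
    let ?k = "max k1 k2"
    fix j assume j: "?k \<le> j"
    show "L ?k \<subseteq> L j" by (rule mono[OF j])
    show "L j \<subseteq> L ?k"
    proof
      fix y assume y: "y \<in> L j"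
      have "g ` L j = g ` L ?k" using k2[of j] k2[of ?k] j by simp
      then obtain y' where y': "y' \<in> L ?k" "g y = g y'" using y by blast
      have c: "y \<in> carrier N" "y' \<in> carrier N" using y y' LE(1) by blast+
      let ?z = "y \<oplus>\<^bsub>N\<^esub> \<ominus>\<^bsub>N\<^esub> y'"
      have "g ?z = \<zero>\<^bsub>N2\<^esub>" using c y' gD g0 by (simp add: N2.r_neg)
      then obtain w where w: "w \<in> carrier N1" "?z = f w" using exact[of ?z] c by auto
      have "y' \<in> L j" using mono[OF j] y' by blast
      then have "?z \<in> L j" by (intro LE(3) y Lm)
      then have "f w \<in> L ?k" using w k1[of j] k1[of ?k] j by auto
      then have "?z \<oplus>\<^bsub>N\<^esub> y' \<in> L ?k" using w(2) y'(1) LE(3) by metis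
      then show "y \<in> L ?k" using c by (simp add: N.a_assoc N.l_neg)
    qed
  qed
qed

text \<open>Below \<open>R s + G\<close>, a submodule is controlled by its intersection with \<open>G\<close> and by the ideal of
  coefficients of \<open>s\<close> that occur in it. This is the induction step for finitely generated modules.\<close>

lemma (in module) submodule_add_cyclic_stabilizes:
  assumes R: "noetherian_ring R" and G: "submodule G R M" and s: "s \<in> carrier M"
    and chains: "\<And>L :: nat \<Rightarrow> _. \<forall>k. submodule (L k) R M \<and> L k \<subseteq> L (Suc k) \<and> L k \<subseteq> G \<Longrightarrow>
      \<exists>k. \<forall>j\<ge>k. L j = L k"
    and L: "\<forall>k::nat. submodule (L k) R M \<and> L k \<subseteq> L (Suc k) \<and>
      L k \<subseteq> {r \<odot>\<^bsub>M\<^esub> s \<oplus>\<^bsub>M\<^esub> y | r y. r \<in> carrier R \<and> y \<in> G}"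
  shows "\<exists>k. \<forall>j\<ge>k. L j = L k"
proof -
  have sub: "submodule (L k) R M" and inc: "L k \<subseteq> L (Suc k)"
    and gen: "L k \<subseteq> {r \<odot>\<^bsub>M\<^esub> s \<oplus>\<^bsub>M\<^esub> y | r y. r \<in> carrier R \<and> y \<in> G}" for k
    using spec[OF L, of k] by simp_all
  have LE: "L k \<subseteq> carrier M" "\<zero>\<^bsub>M\<^esub> \<in> L k" "x \<in> L k \<Longrightarrow> y \<in> L k \<Longrightarrow> x \<oplus>\<^bsub>M\<^esub> y \<in> L k"
    "r \<in> carrier R \<Longrightarrow> x \<in> L k \<Longrightarrow> r \<odot>\<^bsub>M\<^esub> x \<in> L k" for k x y r
    using sub[of k] unfolding submodule_iff by blast+
  have GE: "G \<subseteq> carrier M" "\<zero>\<^bsub>M\<^esub> \<in> G" "x \<in> G \<Longrightarrow> y \<in> G \<Longrightarrow> x \<oplus>\<^bsub>M\<^esub> y \<in> G"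
    "r \<in> carrier R \<Longrightarrow> x \<in> G \<Longrightarrow> r \<odot>\<^bsub>M\<^esub> x \<in> G" for x y r
    using G unfolding submodule_iff by blast+
  have Lm: "\<ominus>\<^bsub>M\<^esub> x \<in> L k" if "x \<in> L k" for x k by (rule submoduleE(3)[OF sub that])
  have Gm: "\<ominus>\<^bsub>M\<^esub> x \<in> G" if "x \<in> G" for x by (rule submoduleE(3)[OF G that])
  have mono: "L k \<subseteq> L j" if "k \<le> j" for k j
    by (rule lift_Suc_mono_le[of L, OF inc that])
  have "submodule (L k \<inter> G) R M" for k
    unfolding submodule_iff using LE(1,2)[of k] GE(2) by (auto intro: LE(3,4) GE(3,4))
  then have "\<exists>k. \<forall>j\<ge>k. L j \<inter> G = L k \<inter> G"
    using inc by (intro chains) auto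
  then obtain k1 where k1: "\<And>j. j \<ge> k1 \<Longrightarrow> L j \<inter> G = L k1 \<inter> G" by blast
  define J where "J k = {r \<in> carrier R. \<exists>y\<in>G. r \<odot>\<^bsub>M\<^esub> s \<oplus>\<^bsub>M\<^esub> y \<in> L k}" for k
  have JI: "r \<in> J k" if "r \<in> carrier R" "y \<in> G" "r \<odot>\<^bsub>M\<^esub> s \<oplus>\<^bsub>M\<^esub> y \<in> L k" for r y k
    using that unfolding J_def by blast
  have smultJ: "t \<otimes> r \<in> J k" if tr: "t \<in> carrier R" "r \<in> J k" for t r k
  proof -
    obtain y where y: "r \<in> carrier R" "y \<in> G" "r \<odot>\<^bsub>M\<^esub> s \<oplus>\<^bsub>M\<^esub> y \<in> L k"
      using tr unfolding J_def by blast
    have yc: "y \<in> carrier M" using y GE by blast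
    have "(t \<otimes> r) \<odot>\<^bsub>M\<^esub> s \<oplus>\<^bsub>M\<^esub> t \<odot>\<^bsub>M\<^esub> y = t \<odot>\<^bsub>M\<^esub> (r \<odot>\<^bsub>M\<^esub> s \<oplus>\<^bsub>M\<^esub> y)"
      using y yc tr s by (simp add: smult_r_distr smult_assoc1)
    then show ?thesis using y tr GE LE by (intro JI[of _ "t \<odot>\<^bsub>M\<^esub> y"]) auto
  qed
  have "ideal (J k) R" for k
  proof (rule idealI)
    show "ring R" by (rule R.ring_axioms)
    show "subgroup (J k) (add_monoid R)"
    proof (rule R.add.subgroupI)
      show "J k \<subseteq> carrier R" by (auto simp: J_def)
      have "\<zero> \<in> J k" using s GE(2) LE(2)[of k] by (intro JI[of _ "\<zero>\<^bsub>M\<^esub>"]) auto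
      then show "J k \<noteq> {}" by blast
    next
      fix a assume a: "a \<in> J k"
      then have "(\<ominus> \<one>) \<otimes> a \<in> J k" by (intro smultJ) auto
      moreover have "a \<in> carrier R" using a by (simp add: J_def)
      ultimately show "\<ominus> a \<in> J k" by (simp add: R.l_minus)
    next
      fix a b assume "a \<in> J k" "b \<in> J k"
      then obtain y z where y: "a \<in> carrier R" "y \<in> G" "a \<odot>\<^bsub>M\<^esub> s \<oplus>\<^bsub>M\<^esub> y \<in> L k"
        and z: "b \<in> carrier R" "z \<in> G" "b \<odot>\<^bsub>M\<^esub> s \<oplus>\<^bsub>M\<^esub> z \<in> L k" unfolding J_def by blast
      have yc: "y \<in> carrier M" "z \<in> carrier M" using y z GE by blast+
      have "(a \<oplus> b) \<odot>\<^bsub>M\<^esub> s \<oplus>\<^bsub>M\<^esub> (y \<oplus>\<^bsub>M\<^esub> z) = (a \<odot>\<^bsub>M\<^esub> s \<oplus>\<^bsub>M\<^esub> y) \<oplus>\<^bsub>M\<^esub> (b \<odot>\<^bsub>M\<^esub> s \<oplus>\<^bsub>M\<^esub> z)"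
        using y z yc s by (simp add: smult_l_distr M.a_ac)
      then show "a \<oplus> b \<in> J k" using y z GE LE by (intro JI[of _ "y \<oplus>\<^bsub>M\<^esub> z"]) auto
    qed
  next
    fix a x assume a: "a \<in> J k" and x: "x \<in> carrier R"
    show "x \<otimes> a \<in> J k" using a x by (intro smultJ)
    then show "a \<otimes> x \<in> J k" using a x by (simp add: J_def m_comm)
  qed
  moreover have "J k \<subseteq> J (Suc k)" for k unfolding J_def using inc by blast
  ultimately obtain k2 where k2: "\<And>j. j \<ge> k2 \<Longrightarrow> J j = J k2"
    using noetherian_ring.ideal_seq_stabilizes[OF R, of J] by blast
  show ?thesis
  proof (intro exI allI impI equalityI)
    let ?k = "max k1 k2"
    fix j assume j: "?k \<le> j"
    show "L ?k \<subseteq> L j" by (rule mono[OF j])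
    show "L j \<subseteq> L ?k"
    proof
      fix x assume x: "x \<in> L j"
      then have "x \<in> {r \<odot>\<^bsub>M\<^esub> s \<oplus>\<^bsub>M\<^esub> y | r y. r \<in> carrier R \<and> y \<in> G}" using gen by (rule rev_subsetD)
      then obtain r y where y: "r \<in> carrier R" "y \<in> G" "x = r \<odot>\<^bsub>M\<^esub> s \<oplus>\<^bsub>M\<^esub> y" by blast
      have "r \<in> J j" using x y by (intro JI) auto
      then have "r \<in> J ?k" using k2[of j] k2[of ?k] j by simp
      then obtain y' where y': "y' \<in> G" "r \<odot>\<^bsub>M\<^esub> s \<oplus>\<^bsub>M\<^esub> y' \<in> L ?k" unfolding J_def by blast
      define x' where "x' = r \<odot>\<^bsub>M\<^esub> s \<oplus>\<^bsub>M\<^esub> y'"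
      have c: "y \<in> carrier M" "y' \<in> carrier M" "x \<in> carrier M" "x' \<in> carrier M"
        using y y' s GE(1) by (auto simp: x'_def)
      have "x' \<in> L j" using y'(2) mono[OF j] by (auto simp: x'_def)
      then have "x \<oplus>\<^bsub>M\<^esub> \<ominus>\<^bsub>M\<^esub> x' \<in> L j" by (intro LE(3) x Lm)
      moreover have "x \<oplus>\<^bsub>M\<^esub> \<ominus>\<^bsub>M\<^esub> x' = y \<oplus>\<^bsub>M\<^esub> \<ominus>\<^bsub>M\<^esub> y'"
      proof -
        have "x \<oplus>\<^bsub>M\<^esub> \<ominus>\<^bsub>M\<^esub> x' = (r \<odot>\<^bsub>M\<^esub> s \<oplus>\<^bsub>M\<^esub> \<ominus>\<^bsub>M\<^esub> (r \<odot>\<^bsub>M\<^esub> s)) \<oplus>\<^bsub>M\<^esub> (y \<oplus>\<^bsub>M\<^esub> \<ominus>\<^bsub>M\<^esub> y')"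
          using c s y(1) unfolding y(3) x'_def by (simp add: M.minus_add M.a_ac)
        then show ?thesis using c s y(1) by (simp add: M.r_neg)
      qed
      moreover have "y \<oplus>\<^bsub>M\<^esub> \<ominus>\<^bsub>M\<^esub> y' \<in> G" using y(2) y'(1) by (intro GE(3) Gm)
      ultimately have "x \<oplus>\<^bsub>M\<^esub> \<ominus>\<^bsub>M\<^esub> x' \<in> L ?k" using k1[of j] k1[of ?k] j by auto
      then have "(x \<oplus>\<^bsub>M\<^esub> \<ominus>\<^bsub>M\<^esub> x') \<oplus>\<^bsub>M\<^esub> x' \<in> L ?k" using y'(2) by (rule_tac LE(3)) (auto simp: x'_def)
      then show "x \<in> L ?k" using c by (simp add: M.a_assoc M.l_neg)
    qed
  qed
qed

lemma fin_gen_noetherian_module: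
  assumes R: "noetherian_ring R" and N: "module R N" and fg: "fin_gen_module R N"
  shows "noetherian_module R N"
proof -
  interpret module R N by fact
  obtain S where S: "finite S" "S \<subseteq> carrier N"
    and gen: "\<And>y. y \<in> carrier N \<Longrightarrow> \<exists>c\<in>S \<rightarrow> carrier R. y = (\<Oplus>\<^bsub>N\<^esub>x\<in>S. c x \<odot>\<^bsub>N\<^esub> x)"
    using fg unfolding fin_gen_module_def by (elim exE conjE) (rule that, assumption+, blast)
  \<comment> \<open>The chain condition below \<open>G\<close>, for a submodule \<open>G\<close> containing the generators treated so far.\<close>
  have "\<exists>G. submodule G R N \<and> S \<subseteq> G \<and> (\<forall>L::nat \<Rightarrow> _. (\<forall>k. submodule (L k) R N \<and> L k \<subseteq> L (Suc k) \<and> L k \<subseteq> G)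
      \<longrightarrow> (\<exists>k. \<forall>j\<ge>k. L j = L k))"
    using S
  proof (induction S rule: finite_induct)
    case empty
    have "\<exists>k. \<forall>j\<ge>k. L j = L k"
      if L: "\<forall>k. submodule (L k) R N \<and> L k \<subseteq> L (Suc k) \<and> L k \<subseteq> {\<zero>\<^bsub>N\<^esub>}" for L :: "nat \<Rightarrow> _"
    proof -
      have "L j = {\<zero>\<^bsub>N\<^esub>}" for j using L unfolding submodule_iff by blast
      then show ?thesis by simp
    qed
    moreover have "submodule {\<zero>\<^bsub>N\<^esub>} R N" by (simp add: submodule_iff)
    ultimately show ?case by (intro exI[of _ "{\<zero>\<^bsub>N\<^esub>}"]) auto
  next
    case (insert s S)
    then obtain G where G: "submodule G R N" "S \<subseteq> G"
      "\<And>L::nat \<Rightarrow> _. \<forall>k. submodule (L k) R N \<and> L k \<subseteq> L (Suc k) \<and> L k \<subseteq> G \<Longrightarrow> \<exists>k. \<forall>j\<ge>k. L j = L k"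
      by auto
    have s: "s \<in> carrier N" using insert by blast
    have GE: "G \<subseteq> carrier N" "\<zero>\<^bsub>N\<^esub> \<in> G" "x \<in> G \<Longrightarrow> y \<in> G \<Longrightarrow> x \<oplus>\<^bsub>N\<^esub> y \<in> G"
      "r \<in> carrier R \<Longrightarrow> x \<in> G \<Longrightarrow> r \<odot>\<^bsub>N\<^esub> x \<in> G" for x y r
      using G(1) unfolding submodule_iff by blast+
    define G' where "G' = {r \<odot>\<^bsub>N\<^esub> s \<oplus>\<^bsub>N\<^esub> y | r y. r \<in> carrier R \<and> y \<in> G}"
    have GI: "x \<in> G'" if "r \<in> carrier R" "y \<in> G" "x = r \<odot>\<^bsub>N\<^esub> s \<oplus>\<^bsub>N\<^esub> y" for r y x
      using that unfolding G'_def by blast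
    have "submodule G' R N"
      unfolding submodule_iff
    proof (intro conjI ballI)
      show "G' \<subseteq> carrier N" using GE s by (auto simp: G'_def)
      show "\<zero>\<^bsub>N\<^esub> \<in> G'" using GE s by (intro GI[of "\<zero>\<^bsub>R\<^esub>" "\<zero>\<^bsub>N\<^esub>"]) auto
    next
      fix x y assume "x \<in> G'" "y \<in> G'"
      then obtain a u b v where c: "a \<in> carrier R" "b \<in> carrier R" "u \<in> G" "v \<in> G"
        "x = a \<odot>\<^bsub>N\<^esub> s \<oplus>\<^bsub>N\<^esub> u" "y = b \<odot>\<^bsub>N\<^esub> s \<oplus>\<^bsub>N\<^esub> v" unfolding G'_def by blast
      moreover have "u \<in> carrier N" "v \<in> carrier N" using c GE by blast+
      ultimately show "x \<oplus>\<^bsub>N\<^esub> y \<in> G'" using s GE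
        by (intro GI[of "a \<oplus>\<^bsub>R\<^esub> b" "u \<oplus>\<^bsub>N\<^esub> v"]) (auto simp: smult_l_distr M.a_ac)
    next
      fix r x assume r: "r \<in> carrier R" and "x \<in> G'"
      then obtain a u where c: "a \<in> carrier R" "u \<in> G" "x = a \<odot>\<^bsub>N\<^esub> s \<oplus>\<^bsub>N\<^esub> u" unfolding G'_def by blast
      moreover have "u \<in> carrier N" using c GE by blast
      ultimately show "r \<odot>\<^bsub>N\<^esub> x \<in> G'" using s r GE
        by (intro GI[of "r \<otimes>\<^bsub>R\<^esub> a" "r \<odot>\<^bsub>N\<^esub> u"]) (auto simp: smult_r_distr smult_assoc1)
    qed
    moreover have "s \<in> G'" using s GE by (intro GI[of "\<one>\<^bsub>R\<^esub>" "\<zero>\<^bsub>N\<^esub>"]) auto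
    moreover have "S \<subseteq> G'"
    proof
      fix x assume "x \<in> S"
      then have "x \<in> G" using G by blast
      then show "x \<in> G'" using s GE by (intro GI[of "\<zero>\<^bsub>R\<^esub>" x]) auto
    qed
    moreover have "\<forall>L::nat \<Rightarrow> _. (\<forall>k. submodule (L k) R N \<and> L k \<subseteq> L (Suc k) \<and> L k \<subseteq> G') \<longrightarrow> (\<exists>k. \<forall>j\<ge>k. L j = L k)"
      using submodule_add_cyclic_stabilizes[OF R G(1) s G(3)] unfolding G'_def by blast
    ultimately show ?case by (intro exI[of _ G']) auto
  qed
  then obtain G where G: "submodule G R N" "S \<subseteq> G"
    "\<And>L::nat \<Rightarrow> _. \<forall>k. submodule (L k) R N \<and> L k \<subseteq> L (Suc k) \<and> L k \<subseteq> G \<Longrightarrow> \<exists>k. \<forall>j\<ge>k. L j = L k"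
    by auto
  have GE: "G \<subseteq> carrier N" "\<zero>\<^bsub>N\<^esub> \<in> G" "x \<in> G \<Longrightarrow> y \<in> G \<Longrightarrow> x \<oplus>\<^bsub>N\<^esub> y \<in> G"
    "r \<in> carrier R \<Longrightarrow> x \<in> G \<Longrightarrow> r \<odot>\<^bsub>N\<^esub> x \<in> G" for x y r
    using G(1) unfolding submodule_iff by blast+
  have "(\<Oplus>\<^bsub>N\<^esub>x\<in>T. c x \<odot>\<^bsub>N\<^esub> x) \<in> G" if "finite T" "T \<subseteq> G" "c \<in> T \<rightarrow> carrier R" for T c
    using that
  proof (induction T rule: finite_induct)
    case empty then show ?case using GE by simp
  next
    case (insert x T)
    have "(\<Oplus>\<^bsub>N\<^esub>x\<in>insert x T. c x \<odot>\<^bsub>N\<^esub> x) = c x \<odot>\<^bsub>N\<^esub> x \<oplus>\<^bsub>N\<^esub> (\<Oplus>\<^bsub>N\<^esub>x\<in>T. c x \<odot>\<^bsub>N\<^esub> x)"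
      using insert GE(1) by (intro M.finsum_insert) auto
    then show ?case using insert GE by simp
  qed
  then have "carrier N \<subseteq> G" using gen S G(2) by (metis subsetI)
  then have "\<exists>k. \<forall>j\<ge>k. L j = L k" if "\<forall>k::nat. submodule (L k) R N \<and> L k \<subseteq> L (Suc k)" for L
    using that G(3)[of L] unfolding submodule_iff by blast
  then show ?thesis using N unfolding noetherian_module_def by blast
qed


section \<open>Local rings and chains of primes\<close>

lemma proper_ideal_subset_maximal:
  assumes R: "noetherian_ring R" and m: "local_ring R m" and I: "ideal I R" "I \<noteq> carrier R"
  shows "I \<subseteq> m"
proof -
  interpret R: noetherian_ring R by fact
  define F where "F = {J. ideal J R \<and> J \<noteq> carrier R}"
  have "F \<subseteq> {J. ideal J R}" "I \<in> F" using I by (auto simp: F_def)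
  from R.maximal_ideal_of_family[OF this]
  obtain Q where Q: "Q \<in> F" "I \<subseteq> Q" "\<forall>J\<in>F. Q \<subseteq> J \<longrightarrow> J = Q" by (elim bexE conjE) (rule that)
  have "maximalideal Q R" using Q by (intro maximalidealI) (auto simp: F_def)
  then have "Q = m" using m by (simp add: local_ring_def)
  then show ?thesis using Q by simp
qed

lemma local_ringD:
  assumes "local_ring R m"
  shows "cring R" "maximalideal m R" "primeideal m R" "ideal m R" "\<one>\<^bsub>R\<^esub> \<notin> m"
proof -
  show 1: "cring R" and 2: "maximalideal m R" using assms by (auto simp: local_ring_def)
  show "primeideal m R" using cring.maximalideal_prime[OF 1 2] .
  show i: "ideal m R" using 2 maximalideal.axioms(1) by blast
  show "\<one>\<^bsub>R\<^esub> \<notin> m" using ideal.one_imp_carrier[OF i] maximalideal.I_notcarr[OF 2] by blast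
qed

lemma local_ring_unit:
  assumes "noetherian_ring R" "local_ring R m" "x \<in> carrier R" "x \<notin> m"
  shows "\<exists>y\<in>carrier R. y \<otimes>\<^bsub>R\<^esub> x = \<one>\<^bsub>R\<^esub>"
proof -
  interpret cring R using assms(2) local_ringD by blast
  have "PIdl\<^bsub>R\<^esub> x = carrier R"
    using proper_ideal_subset_maximal[OF assms(1,2) cgenideal_ideal[OF assms(3)]]
      cgenideal_self[OF assms(3)] assms(4) by blast
  then have "\<one>\<^bsub>R\<^esub> \<in> PIdl\<^bsub>R\<^esub> x" by simp
  then show ?thesis by (auto simp: cgenideal_def)
qed

definition prime_chain :: "('a, 'b) ring_scheme \<Rightarrow> nat \<Rightarrow> (nat \<Rightarrow> 'a set) \<Rightarrow> bool" where
  "prime_chain R n P \<longleftrightarrow> (\<forall>i\<le>n. primeideal (P i) R) \<and> (\<forall>i<n. P i \<subset> P (Suc i))"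

lemma krull_dim_prime_chain: "krull_dim R = Sup {ereal (real n) | n. \<exists>P. prime_chain R n P}"
  by (simp add: krull_dim_def prime_chain_def Spec_def)

lemma prime_chain_vimage:
  assumes "ring_hom_ring R S h" "cring R" and surj: "h ` carrier R = carrier S" and P: "prime_chain S n P"
  shows "prime_chain R n (\<lambda>i. {r \<in> carrier R. h r \<in> P i})"
  unfolding prime_chain_def
proof (intro conjI allI impI)
  interpret ring_hom_ring R S h by fact
  fix i assume "i \<le> n"
  then interpret P: primeideal "P i" S using P by (simp add: prime_chain_def)
  show "primeideal {r \<in> carrier R. h r \<in> P i} R"
  proof (rule primeidealI)
    show "ideal {r \<in> carrier R. h r \<in> P i} R" by (rule ideal_vimage[OF P.is_ideal])
    have "\<one>\<^bsub>S\<^esub> \<notin> P i" using P.one_imp_carrier P.I_notcarr by blast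
    then show "carrier R \<noteq> {r \<in> carrier R. h r \<in> P i}"
      using hom_one R.one_closed by (metis (lifting) mem_Collect_eq)
    fix a b assume "a \<in> carrier R" "b \<in> carrier R" "a \<otimes>\<^bsub>R\<^esub> b \<in> {r \<in> carrier R. h r \<in> P i}"
    then show "a \<in> {r \<in> carrier R. h r \<in> P i} \<or> b \<in> {r \<in> carrier R. h r \<in> P i}"
      using P.I_prime[of "h a" "h b"] by simp
  qed fact
next
  fix i assume i: "i < n"
  then have "P i \<subset> P (Suc i)" "primeideal (P (Suc i)) S" using P by (auto simp: prime_chain_def)
  then obtain y where y: "y \<in> P (Suc i)" "y \<notin> P i" "y \<in> carrier S"
    by (meson ideal.Icarr primeideal.axioms(1) psubset_imp_ex_mem Diff_iff)
  then obtain r where "r \<in> carrier R" "h r = y" using surj by (metis imageE)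
  then show "{r \<in> carrier R. h r \<in> P i} \<subset> {r \<in> carrier R. h r \<in> P (Suc i)}"
    using y \<open>P i \<subset> P (Suc i)\<close> by blast
qed

lemma prime_chain_append:
  assumes P: "prime_chain R k P" and Q: "prime_chain R l Q" and eq: "P k = Q 0"
  shows "prime_chain R (k + l) (\<lambda>j. if j \<le> k then P j else Q (j - k))"
  unfolding prime_chain_def
proof (intro conjI allI impI)
  fix j assume "j \<le> k + l"
  then show "primeideal (if j \<le> k then P j else Q (j - k)) R" using P Q by (auto simp: prime_chain_def)
next
  fix j assume j: "j < k + l"
  consider "j < k" | "j = k" | "j > k" by linarith
  then show "(if j \<le> k then P j else Q (j - k)) \<subset> (if Suc j \<le> k then P (Suc j) else Q (Suc j - k))"
  proof cases
    case 1 then show ?thesis using P by (auto simp: prime_chain_def)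
  next
    case 2
    then have "0 < l" using j by simp
    then show ?thesis using 2 Q eq by (auto simp: prime_chain_def)
  next
    case 3
    then have "j - k < l" "Suc j - k = Suc (j - k)" using j by auto
    then show ?thesis using 3 Q by (auto simp: prime_chain_def)
  qed
qed

lemma prime_chain_quotient_iff:
  assumes R: "cring R" and I: "ideal I R"
  shows "(\<exists>P. prime_chain (R Quot I) n P) \<longleftrightarrow> (\<exists>P. prime_chain R n P \<and> I \<subseteq> P 0)"
proof
  interpret cring R by fact
  interpret I: ideal I R by fact
  assume "\<exists>P. prime_chain (R Quot I) n P"
  then obtain P where P: "prime_chain (R Quot I) n P" by blast
  have surj: "(+>\<^bsub>R\<^esub>) I ` carrier R = carrier (R Quot I)"
    by (auto simp: FactRing_def A_RCOSETS_def')
  let ?P = "\<lambda>i. {r \<in> carrier R. I +>\<^bsub>R\<^esub> r \<in> P i}"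
  have "prime_chain R n ?P" by (rule prime_chain_vimage[OF I.rcos_ring_hom_ring R surj P])
  moreover have "I \<subseteq> ?P 0"
  proof
    fix x assume x: "x \<in> I"
    interpret P0: primeideal "P 0" "R Quot I" using P by (simp add: prime_chain_def)
    have "I +>\<^bsub>R\<^esub> x = \<zero>\<^bsub>R Quot I\<^esub>" using I.a_rcos_const[OF x] by (simp add: FactRing_def)
    then show "x \<in> ?P 0" using x I.Icarr P0.additive_subgroup_axioms additive_subgroup.zero_closed by fastforce
  qed
  ultimately show "\<exists>P. prime_chain R n P \<and> I \<subseteq> P 0" by blast
next
  interpret cring R by fact
  interpret I: ideal I R by fact
  assume "\<exists>P. prime_chain R n P \<and> I \<subseteq> P 0"
  then obtain P where P: "prime_chain R n P" "I \<subseteq> P 0" by blast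
  have IP: "I \<subseteq> P i" if "i \<le> n" for i
    using that
  proof (induction i)
    case (Suc i)
    then have "P i \<subseteq> P (Suc i)" using P(1) by (simp add: prime_chain_def less_imp_le)
    then show ?case using Suc by simp
  qed (use P in simp)
  have mem: "I +>\<^bsub>R\<^esub> x \<in> (+>\<^bsub>R\<^esub>) I ` P i \<longleftrightarrow> x \<in> P i" if i: "i \<le> n" and x: "x \<in> carrier R" for x i
  proof
    have "ideal (P i) R" using P i by (simp add: prime_chain_def primeideal.axioms(1))
    then have eq: "P i = (\<Union>j\<in>P i. I +>\<^bsub>R\<^esub> j)" using ideal_incl_iff[OF I] IP[OF i] by blast
    assume "I +>\<^bsub>R\<^esub> x \<in> (+>\<^bsub>R\<^esub>) I ` P i"
    then obtain p where "p \<in> P i" "I +>\<^bsub>R\<^esub> x = I +>\<^bsub>R\<^esub> p" by blast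
    moreover have "x \<in> I +>\<^bsub>R\<^esub> x" by (rule I.a_rcos_self[OF x])
    ultimately show "x \<in> P i" using eq by blast
  qed blast
  have "prime_chain (R Quot I) n (\<lambda>i. (+>\<^bsub>R\<^esub>) I ` P i)"
    unfolding prime_chain_def
  proof (intro conjI allI impI)
    fix i assume i: "i \<le> n"
    then interpret Q: primeideal "P i" R using P by (simp add: prime_chain_def)
    show "primeideal ((+>\<^bsub>R\<^esub>) I ` P i) (R Quot I)"
    proof (rule primeidealI)
      show "ideal ((+>\<^bsub>R\<^esub>) I ` P i) (R Quot I)" by (rule ring_ideal_imp_quot_ideal[OF I Q.is_ideal])
      show "cring (R Quot I)" by (rule I.quotient_is_cring[OF R])
      have "\<one>\<^bsub>R\<^esub> \<notin> P i" using Q.one_imp_carrier Q.I_notcarr by blast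
      then have "I +>\<^bsub>R\<^esub> \<one>\<^bsub>R\<^esub> \<notin> (+>\<^bsub>R\<^esub>) I ` P i" using mem[OF i] by blast
      moreover have "I +>\<^bsub>R\<^esub> \<one>\<^bsub>R\<^esub> \<in> carrier (R Quot I)" by (auto simp: FactRing_def A_RCOSETS_def')
      ultimately show "carrier (R Quot I) \<noteq> (+>\<^bsub>R\<^esub>) I ` P i" by blast
      fix a b assume "a \<in> carrier (R Quot I)" "b \<in> carrier (R Quot I)"
        and ab: "a \<otimes>\<^bsub>R Quot I\<^esub> b \<in> (+>\<^bsub>R\<^esub>) I ` P i"
      then obtain x y where xy: "x \<in> carrier R" "y \<in> carrier R" "a = I +>\<^bsub>R\<^esub> x" "b = I +>\<^bsub>R\<^esub> y"
        by (auto simp: FactRing_def A_RCOSETS_def')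
      then have "I +>\<^bsub>R\<^esub> (x \<otimes>\<^bsub>R\<^esub> y) \<in> (+>\<^bsub>R\<^esub>) I ` P i"
        using ab by (simp add: FactRing_def I.rcoset_mult_add)
      then have "x \<otimes>\<^bsub>R\<^esub> y \<in> P i" using mem[OF i] xy by simp
      then show "a \<in> (+>\<^bsub>R\<^esub>) I ` P i \<or> b \<in> (+>\<^bsub>R\<^esub>) I ` P i"
        using Q.I_prime xy by blast
    qed
  next
    fix i assume i: "i < n"
    then have s: "P i \<subset> P (Suc i)" "primeideal (P (Suc i)) R" using P by (auto simp: prime_chain_def)
    then obtain y where y: "y \<in> P (Suc i)" "y \<notin> P i" by blast
    have "y \<in> carrier R" using y s by (meson ideal.Icarr primeideal.axioms(1))
    then have "I +>\<^bsub>R\<^esub> y \<notin> (+>\<^bsub>R\<^esub>) I ` P i" using mem[of i y] y i by simp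
    then show "(+>\<^bsub>R\<^esub>) I ` P i \<subset> (+>\<^bsub>R\<^esub>) I ` P (Suc i)" using y s by blast
  qed
  then show "\<exists>P. prime_chain (R Quot I) n P" by blast
qed

section \<open>The degree zero ring and its complexes\<close>

definition deg0 :: "('a, 'b) dg_ring_scheme \<Rightarrow> ('a, 'b) dg_ring_scheme" where
  "deg0 A = A\<lparr>carrier := deg A 0\<rparr>"

lemma deg0_simps [simp]:
  "carrier (deg0 A) = deg A 0" "\<zero>\<^bsub>deg0 A\<^esub> = \<zero>\<^bsub>A\<^esub>" "\<one>\<^bsub>deg0 A\<^esub> = \<one>\<^bsub>A\<^esub>"
  "x \<oplus>\<^bsub>deg0 A\<^esub> y = x \<oplus>\<^bsub>A\<^esub> y" "x \<otimes>\<^bsub>deg0 A\<^esub> y = x \<otimes>\<^bsub>A\<^esub> y"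
  by (simp_all add: deg0_def)

lemma self_module_simps [simp]:
  "carrier (self_module A) = carrier A" "\<zero>\<^bsub>self_module A\<^esub> = \<zero>\<^bsub>A\<^esub>"
  "x \<oplus>\<^bsub>self_module A\<^esub> y = x \<oplus>\<^bsub>A\<^esub> y" "x \<odot>\<^bsub>self_module A\<^esub> y = x \<otimes>\<^bsub>A\<^esub> y"
  "mdeg (self_module A) = deg A" "mdiff (self_module A) = diff A"
  by (simp_all add: self_module_def)

abbreviation boundaries0 :: "('a, 'b) dg_ring_scheme \<Rightarrow> 'a set" where
  "boundaries0 A \<equiv> coboundaries (self_module A) 0"

context comm_dg_ring
begin

lemma deg_subgroup: "additive_subgroup (deg A n) A"
  using grading by (simp add: direct_sum_grading_def)

lemma deg_carrier: "x \<in> deg A n \<Longrightarrow> x \<in> carrier A"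
  using additive_subgroup.a_Hcarr[OF deg_subgroup] .

lemma deg_closed:
  "\<zero> \<in> deg A n" "x \<in> deg A n \<Longrightarrow> y \<in> deg A n \<Longrightarrow> x \<oplus> y \<in> deg A n"
  "x \<in> deg A n \<Longrightarrow> \<ominus> x \<in> deg A n"
  using additive_subgroup.zero_closed[OF deg_subgroup] additive_subgroup.a_closed[OF deg_subgroup]
    additive_subgroup.a_inv_closed[OF deg_subgroup] by auto

lemma deg0_mult:
  "a \<in> deg A 0 \<Longrightarrow> x \<in> deg A n \<Longrightarrow> a \<otimes> x \<in> deg A n"
  "a \<in> deg A 0 \<Longrightarrow> x \<in> deg A n \<Longrightarrow> x \<otimes> a = a \<otimes> x"
  using mult_deg[of a 0 x n] graded_comm[of a 0 x n] by (auto simp: sgn_pow_def)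

lemma diff_zero: "diff A \<zero> = \<zero>"
proof -
  have "diff A \<zero> \<in> carrier A" using diff_deg[OF deg_closed(1)] deg_carrier by blast
  moreover have "diff A \<zero> \<oplus> diff A \<zero> = diff A \<zero>" using diff_add[of \<zero> \<zero>] by simp
  ultimately show ?thesis by (metis add.r_cancel_one')
qed

lemma diff_deg0: "a \<in> deg A 0 \<Longrightarrow> diff A a = \<zero>"
  using diff_deg[of a 0] non_positive[of 1] by simp

lemma diff_mult_deg0: "a \<in> deg A 0 \<Longrightarrow> x \<in> deg A n \<Longrightarrow> diff A (a \<otimes> x) = a \<otimes> diff A x"
  using leibniz[of a 0 x n] diff_deg0[of a] diff_deg[of x n] deg_carrier
  by (simp add: sgn_pow_def)

lemma deg0_cring: "cring (deg0 A)"
proof (rule cringI)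
  show "abelian_group (deg0 A)"
  proof (rule abelian_groupI)
    fix x assume "x \<in> carrier (deg0 A)"
    then show "\<exists>y\<in>carrier (deg0 A). y \<oplus>\<^bsub>deg0 A\<^esub> x = \<zero>\<^bsub>deg0 A\<^esub>"
      using deg_closed deg_carrier by (intro bexI[of _ "\<ominus> x"]) (auto simp: l_neg)
  qed (use deg_closed deg_carrier in \<open>auto simp: a_ac\<close>)
  show "comm_monoid (deg0 A)"
    by (rule comm_monoidI) (use one_deg deg0_mult deg_carrier in \<open>auto simp: m_assoc\<close>)
qed (use deg_carrier in \<open>auto simp: l_distr\<close>)

lemma cocycles_self_0: "cocycles (self_module A) 0 = deg A 0"
  using diff_deg0 by (auto simp: cocycles_def)

lemma H0_eq: "H0 A = deg0 A Quot boundaries0 A"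
  by (simp add: H0_def cocycles_self_0 deg0_def)

lemma deg0_a_inv: "a \<in> deg A 0 \<Longrightarrow> \<ominus>\<^bsub>deg0 A\<^esub> a = \<ominus> a"
proof -
  assume a: "a \<in> deg A 0"
  interpret D: cring "deg0 A" by (rule deg0_cring)
  show ?thesis using a deg_closed(3)[OF a] deg_carrier[OF a]
    by (intro D.minus_equality) (auto simp: l_neg)
qed

lemma boundaries0_iff: "e \<in> boundaries0 A \<longleftrightarrow> (\<exists>c\<in>deg A (-1). e = diff A c)"
  by (auto simp: coboundaries_def)

lemma boundaries0_ideal: "ideal (boundaries0 A) (deg0 A)"
proof (rule idealI)
  interpret D: cring "deg0 A" by (rule deg0_cring)
  show "ring (deg0 A)" by (rule D.ring_axioms)
  have sub: "boundaries0 A \<subseteq> deg A 0" using diff_deg[of _ "-1"] by (auto simp: boundaries0_iff)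
  have l: "x \<otimes> a \<in> boundaries0 A" if a: "a \<in> boundaries0 A" and x: "x \<in> deg A 0" for x a
  proof -
    obtain c where c: "c \<in> deg A (-1)" "a = diff A c" using a by (auto simp: boundaries0_iff)
    then have "x \<otimes> a = diff A (x \<otimes> c)" using diff_mult_deg0[OF x c(1)] by simp
    then show ?thesis using deg0_mult(1)[OF x c(1)] by (auto simp: boundaries0_iff)
  qed
  show "subgroup (boundaries0 A) (add_monoid (deg0 A))"
  proof (rule D.add.subgroupI)
    show "boundaries0 A \<noteq> {}" using deg_closed(1) by (auto simp: coboundaries_def)
  next
    fix a assume a: "a \<in> boundaries0 A"
    have "(\<ominus> \<one>) \<otimes> a \<in> boundaries0 A" using a one_deg deg_closed by (intro l) auto
    then show "\<ominus>\<^bsub>deg0 A\<^esub> a \<in> boundaries0 A" using a sub deg0_a_inv[of a] deg_carrier[of a 0]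
      by (auto simp: l_minus)
  next
    fix a b assume "a \<in> boundaries0 A" "b \<in> boundaries0 A"
    then show "a \<oplus>\<^bsub>deg0 A\<^esub> b \<in> boundaries0 A"
      using deg_closed(2) deg_carrier diff_add unfolding boundaries0_iff by (metis deg0_simps(4))
  qed (use sub in simp)
  fix a x assume ax: "a \<in> boundaries0 A" "x \<in> carrier (deg0 A)"
  show "x \<otimes>\<^bsub>deg0 A\<^esub> a \<in> boundaries0 A" using l ax by simp
  then show "a \<otimes>\<^bsub>deg0 A\<^esub> x \<in> boundaries0 A" using ax sub D.m_comm[of a x] by auto
qed

lemma H0_cring: "cring (H0 A)"
  unfolding H0_eq using ideal.quotient_is_cring[OF boundaries0_ideal deg0_cring] .

lemma proj0_eq: "proj0 A a = boundaries0 A +>\<^bsub>deg0 A\<^esub> a"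
  by (simp add: proj0_def a_r_coset_def')

lemma proj0_hom: "ring_hom_ring (deg0 A) (H0 A) (proj0 A)"
  using ideal.rcos_ring_hom_ring[OF boundaries0_ideal] by (simp add: H0_eq proj0_eq[abs_def])

lemma H0_carrier: "carrier (H0 A) = proj0 A ` deg A 0"
  by (auto simp: H0_eq FactRing_def A_RCOSETS_def' proj0_eq)

lemma proj0_closed: "a \<in> deg A 0 \<Longrightarrow> proj0 A a \<in> carrier (H0 A)"
  by (simp add: H0_carrier)

lemma H0_ops:
  "a \<in> deg A 0 \<Longrightarrow> b \<in> deg A 0 \<Longrightarrow> proj0 A a \<oplus>\<^bsub>H0 A\<^esub> proj0 A b = proj0 A (a \<oplus> b)"
  "a \<in> deg A 0 \<Longrightarrow> b \<in> deg A 0 \<Longrightarrow> proj0 A a \<otimes>\<^bsub>H0 A\<^esub> proj0 A b = proj0 A (a \<otimes> b)"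
  "\<one>\<^bsub>H0 A\<^esub> = proj0 A \<one>"
proof -
  interpret h: ring_hom_ring "deg0 A" "H0 A" "proj0 A" by (rule proj0_hom)
  show "\<one>\<^bsub>H0 A\<^esub> = proj0 A \<one>" using h.hom_one by simp
  assume ab: "a \<in> deg A 0" "b \<in> deg A 0"
  show "proj0 A a \<oplus>\<^bsub>H0 A\<^esub> proj0 A b = proj0 A (a \<oplus> b)"
    using h.hom_add[of a b] ab by (simp only: deg0_simps)
  show "proj0 A a \<otimes>\<^bsub>H0 A\<^esub> proj0 A b = proj0 A (a \<otimes> b)"
    using h.hom_mult[of a b] ab by (simp only: deg0_simps)
qed

lemma proj0_self: "a \<in> deg A 0 \<Longrightarrow> a \<in> proj0 A a"
proof -
  interpret I: ideal "boundaries0 A" "deg0 A" by (rule boundaries0_ideal)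
  assume "a \<in> deg A 0"
  then show ?thesis unfolding proj0_eq by (intro I.a_rcos_self) simp
qed

lemma proj0_memD: "a \<in> deg A 0 \<Longrightarrow> b \<in> proj0 A a \<Longrightarrow> b \<in> deg A 0 \<and> proj0 A b = proj0 A a"
proof -
  assume a: "a \<in> deg A 0" "b \<in> proj0 A a"
  interpret I: ideal "boundaries0 A" "deg0 A" by (rule boundaries0_ideal)
  show ?thesis using a I.a_elemrcos_carrier[of a b] I.a_repr_independence'[of b a] unfolding proj0_eq by simp
qed

lemma proj0_eq_iff:
  "a \<in> deg A 0 \<Longrightarrow> b \<in> deg A 0 \<Longrightarrow> proj0 A a = proj0 A b \<longleftrightarrow> a \<oplus> \<ominus> b \<in> boundaries0 A"
proof -
  assume a: "a \<in> deg A 0" "b \<in> deg A 0"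
  interpret I: ideal "boundaries0 A" "deg0 A" by (rule boundaries0_ideal)
  have "a \<in> boundaries0 A +>\<^bsub>deg0 A\<^esub> b \<longleftrightarrow> a \<oplus> \<ominus> b \<in> boundaries0 A"
    using I.a_rcos_module[of b a] a deg0_a_inv by simp
  then show ?thesis using a I.a_repr_independence'[of a b] I.a_rcos_self[of a] unfolding proj0_eq by auto
qed

text \<open>The element of \<open>A\<^sup>0\<close> by which \<open>koszul\<close> represents an element of \<open>H\<^sup>0(A)\<close>.\<close>

definition rep :: "'a set \<Rightarrow> 'a" where "rep x = (SOME a. a \<in> x)"

lemma rep:
  assumes "x \<in> carrier (H0 A)"
  shows "rep x \<in> deg A 0" "proj0 A (rep x) = x"
proof -
  obtain a where a: "a \<in> deg A 0" "x = proj0 A a" using assms by (auto simp: H0_carrier)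
  then have "rep x \<in> x" unfolding rep_def using proj0_self by (metis someI)
  then show "rep x \<in> deg A 0" "proj0 A (rep x) = x" using proj0_memD a by blast+
qed

end

text \<open>A null-homotopy of the multiplication by \<open>a\<close>. Its \<open>A\<^sup>0\<close>-linearity is what lets it pass to cones
  of multiplications by other elements.\<close>

definition null_homotopy :: "('a, 'b) dg_ring_scheme \<Rightarrow> ('a, 'm, 'c) dg_module_scheme \<Rightarrow> 'a \<Rightarrow>
    ('m \<Rightarrow> 'm) \<Rightarrow> bool" where
  "null_homotopy A M a h \<longleftrightarrow> (\<forall>n. \<forall>x\<in>mdeg M n. h x \<in> mdeg M (n - 1) \<and>
     (\<forall>y\<in>mdeg M n. h (x \<oplus>\<^bsub>M\<^esub> y) = h x \<oplus>\<^bsub>M\<^esub> h y) \<and>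
     (\<forall>b\<in>deg A 0. h (b \<odot>\<^bsub>M\<^esub> x) = b \<odot>\<^bsub>M\<^esub> h x) \<and>
     a \<odot>\<^bsub>M\<^esub> x = mdiff M (h x) \<oplus>\<^bsub>M\<^esub> h (mdiff M x))"

lemma null_homotopyD:
  assumes "null_homotopy A M a h" "x \<in> mdeg M n"
  shows "h x \<in> mdeg M (n - 1)" "y \<in> mdeg M n \<Longrightarrow> h (x \<oplus>\<^bsub>M\<^esub> y) = h x \<oplus>\<^bsub>M\<^esub> h y"
    "b \<in> deg A 0 \<Longrightarrow> h (b \<odot>\<^bsub>M\<^esub> x) = b \<odot>\<^bsub>M\<^esub> h x"
    "a \<odot>\<^bsub>M\<^esub> x = mdiff M (h x) \<oplus>\<^bsub>M\<^esub> h (mdiff M x)"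
  using assms unfolding null_homotopy_def by blast+

text \<open>Since \<open>A\<^sup>1 = 0\<close>, the differential of a DG-module is \<open>A\<^sup>0\<close>-linear. For regular sequences it is
  enough to remember the complex of \<open>A\<^sup>0\<close>-modules, provided that the coboundaries of \<open>A\<close> in degree
  zero act by null-homotopic maps: this makes the cohomology a module over \<open>H\<^sup>0(A)\<close>, and unlike the
  mere triviality of the action on cohomology it is inherited by cones.\<close>

locale dg_complex = A?: comm_dg_ring A + M?: module "deg0 A" M
  for A :: "('a, 'b) dg_ring_scheme" and M :: "('a, 'm, 'c) dg_module_scheme" (structure) +
  assumes mdeg_submodule: "submodule (mdeg M n) (deg0 A) M"
    and d_deg: "x \<in> mdeg M n \<Longrightarrow> mdiff M x \<in> mdeg M (n + 1)"
    and d_add: "\<lbrakk>x \<in> mdeg M n; y \<in> mdeg M n\<rbrakk> \<Longrightarrow> mdiff M (x \<oplus> y) = mdiff M x \<oplus> mdiff M y"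
    and d_smult: "\<lbrakk>a \<in> deg A 0; x \<in> mdeg M n\<rbrakk> \<Longrightarrow> mdiff M (a \<odot> x) = a \<odot> mdiff M x"
    and d_d: "x \<in> mdeg M n \<Longrightarrow> mdiff M (mdiff M x) = \<zero>"
    and boundary_null_homotopic: "e \<in> boundaries0 A \<Longrightarrow> \<exists>h. null_homotopy A M e h"

definition coh_class :: "('a, 'm, 'c) dg_module_scheme \<Rightarrow> int \<Rightarrow> 'm \<Rightarrow> 'm set" where
  "coh_class M n z = coboundaries M n +>\<^bsub>M\<^esub> z"

context dg_complex
begin

lemma mdeg_carrier: "x \<in> mdeg M n \<Longrightarrow> x \<in> carrier M"
  using mdeg_submodule[of n] unfolding M.submodule_iff by blast

lemma mdeg_closed:
  "\<zero> \<in> mdeg M n" "x \<in> mdeg M n \<Longrightarrow> y \<in> mdeg M n \<Longrightarrow> x \<oplus> y \<in> mdeg M n"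
  "x \<in> mdeg M n \<Longrightarrow> \<ominus> x \<in> mdeg M n" "a \<in> deg A 0 \<Longrightarrow> x \<in> mdeg M n \<Longrightarrow> a \<odot> x \<in> mdeg M n"
  using mdeg_submodule[of n] M.submoduleE(3)[OF mdeg_submodule[of n]] unfolding M.submodule_iff by auto

lemma neg_one: "\<ominus>\<^bsub>A\<^esub> \<one>\<^bsub>A\<^esub> \<in> deg A 0" "x \<in> carrier M \<Longrightarrow> (\<ominus>\<^bsub>A\<^esub> \<one>\<^bsub>A\<^esub>) \<odot> x = \<ominus> x"
  using M.smult_l_minus[of "\<one>\<^bsub>A\<^esub>" x] A.one_deg A.deg_closed(3) A.deg0_a_inv[OF A.one_deg] M.smult_one[of x] by auto

lemma d_minus: "x \<in> mdeg M n \<Longrightarrow> mdiff M (\<ominus> x) = \<ominus> mdiff M x"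
  using d_smult[OF neg_one(1), of x n] neg_one(2) mdeg_carrier d_deg by metis

lemma d_zero: "mdiff M \<zero> = \<zero>"
proof -
  have "mdiff M (\<zero>\<^bsub>A\<^esub> \<odot> \<zero>) = \<zero>\<^bsub>A\<^esub> \<odot> mdiff M \<zero>"
    by (rule d_smult[OF A.deg_closed(1) mdeg_closed(1)])
  then show ?thesis using M.smult_l_null[of "\<zero>"] M.smult_l_null[of "mdiff M \<zero>"]
      mdeg_carrier[OF d_deg[OF mdeg_closed(1)]] by simp
qed

lemma cocycles_mdeg: "z \<in> cocycles M n \<Longrightarrow> z \<in> mdeg M n" "z \<in> cocycles M n \<Longrightarrow> mdiff M z = \<zero>"
  "z \<in> cocycles M n \<Longrightarrow> z \<in> carrier M"
  using mdeg_carrier by (auto simp: cocycles_def)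

lemma cocyclesI: "z \<in> mdeg M n \<Longrightarrow> mdiff M z = \<zero> \<Longrightarrow> z \<in> cocycles M n"
  by (simp add: cocycles_def)

lemma cocycles_closed:
  "\<zero> \<in> cocycles M n" "x \<in> cocycles M n \<Longrightarrow> y \<in> cocycles M n \<Longrightarrow> x \<oplus> y \<in> cocycles M n"
  "x \<in> cocycles M n \<Longrightarrow> \<ominus> x \<in> cocycles M n" "a \<in> deg A 0 \<Longrightarrow> x \<in> cocycles M n \<Longrightarrow> a \<odot> x \<in> cocycles M n"
  using mdeg_closed[where n=n] d_zero d_minus[of _ n] d_add[of _ n] d_smult[of _ _ n] by (auto simp: cocycles_def)

lemma coboundaries_iff: "x \<in> coboundaries M n \<longleftrightarrow> (\<exists>w\<in>mdeg M (n - 1). x = mdiff M w)"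
  by (auto simp: coboundaries_def)

lemma coboundariesI: "w \<in> mdeg M (n - 1) \<Longrightarrow> mdiff M w \<in> coboundaries M n"
  by (auto simp: coboundaries_def)

lemma coboundaries_cocycles: "coboundaries M n \<subseteq> cocycles M n"
  using d_deg[of _ "n - 1"] d_d by (auto simp: coboundaries_def cocycles_def)

lemma coboundaries_closed:
  "\<zero> \<in> coboundaries M n"
  "x \<in> coboundaries M n \<Longrightarrow> y \<in> coboundaries M n \<Longrightarrow> x \<oplus> y \<in> coboundaries M n"
  "x \<in> coboundaries M n \<Longrightarrow> \<ominus> x \<in> coboundaries M n"
  "a \<in> deg A 0 \<Longrightarrow> x \<in> coboundaries M n \<Longrightarrow> a \<odot> x \<in> coboundaries M n"
proof -
  show "\<zero> \<in> coboundaries M n" using coboundariesI[OF mdeg_closed(1), of n] d_zero by simp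
  show "x \<in> coboundaries M n \<Longrightarrow> y \<in> coboundaries M n \<Longrightarrow> x \<oplus> y \<in> coboundaries M n"
    unfolding coboundaries_iff using d_add mdeg_closed(2) by metis
  show "x \<in> coboundaries M n \<Longrightarrow> \<ominus> x \<in> coboundaries M n"
    unfolding coboundaries_iff using d_minus mdeg_closed(3) by metis
  show "a \<in> deg A 0 \<Longrightarrow> x \<in> coboundaries M n \<Longrightarrow> a \<odot> x \<in> coboundaries M n"
    unfolding coboundaries_iff using d_smult mdeg_closed(4) by metis
qed

lemma coboundaries_subgroup: "abelian_subgroup (coboundaries M n) M"
proof (rule abelian_subgroupI3)
  show "additive_subgroup (coboundaries M n) M"
  proof (rule additive_subgroupI, rule M.add.subgroupI)
    show "coboundaries M n \<subseteq> carrier M" using coboundaries_cocycles cocycles_mdeg(3) by blast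
    show "coboundaries M n \<noteq> {}" using coboundaries_closed(1) by blast
  qed (use coboundaries_closed in auto)
qed (rule M.abelian_group_axioms)

lemma coh_class_eq_iff:
  assumes "z \<in> cocycles M n" "w \<in> cocycles M n"
  shows "coh_class M n z = coh_class M n w \<longleftrightarrow> z \<oplus> \<ominus> w \<in> coboundaries M n"
proof -
  interpret B: abelian_subgroup "coboundaries M n" M by (rule coboundaries_subgroup)
  have c: "z \<in> carrier M" "w \<in> carrier M" using assms cocycles_mdeg(3) by auto
  show ?thesis unfolding coh_class_def
    using B.a_rcos_module[OF c(2,1)] B.a_repr_independence'[OF _ c(2), of z] B.a_rcos_self[OF c(1)] by auto
qed

lemma coh_zero: "\<zero>\<^bsub>cohomology M n\<^esub> = coh_class M n \<zero>"
proof -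
  interpret B: abelian_subgroup "coboundaries M n" M by (rule coboundaries_subgroup)
  show ?thesis using B.a_rcos_const[OF coboundaries_closed(1)] by (simp add: cohomology_def coh_class_def)
qed

lemma coh_class_zero_iff:
  assumes "z \<in> cocycles M n"
  shows "coh_class M n z = \<zero>\<^bsub>cohomology M n\<^esub> \<longleftrightarrow> z \<in> coboundaries M n"
proof -
  have "\<ominus> \<zero> = \<zero>" by (rule M.minus_equality) auto
  then show ?thesis
    using coh_class_eq_iff[OF assms cocycles_closed(1)] cocycles_mdeg(3)[OF assms]
    unfolding coh_zero by (simp only: M.r_zero)
qed

lemma coh_carrier: "carrier (cohomology M n) = coh_class M n ` cocycles M n"
  by (auto simp: cohomology_def A_RCOSETS_def' coh_class_def a_r_coset_def')

lemma coh_class_closed: "z \<in> cocycles M n \<Longrightarrow> coh_class M n z \<in> carrier (cohomology M n)"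
  by (simp add: coh_carrier)

lemma coh_add:
  assumes "z \<in> cocycles M n" "w \<in> cocycles M n"
  shows "coh_class M n z \<oplus>\<^bsub>cohomology M n\<^esub> coh_class M n w = coh_class M n (z \<oplus> w)"
proof -
  interpret B: abelian_subgroup "coboundaries M n" M by (rule coboundaries_subgroup)
  show ?thesis using B.a_rcos_sum[of z w] assms cocycles_mdeg(3)
    by (simp add: cohomology_def coh_class_def)
qed

text \<open>On cocycles a null-homotopic multiplication takes values in coboundaries.\<close>

lemma boundary_smult:
  assumes "e \<in> boundaries0 A" "z \<in> cocycles M n"
  shows "e \<odot> z \<in> coboundaries M n"
proof -
  obtain h where h: "null_homotopy A M e h" using boundary_null_homotopic[OF assms(1)] by blast
  have z: "z \<in> mdeg M n" "mdiff M z = \<zero>" using assms cocycles_mdeg by auto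
  have hz: "h \<zero> \<in> carrier M" using null_homotopyD(1)[OF h mdeg_closed(1)] mdeg_carrier by blast
  have "h (\<zero> \<oplus> \<zero>) = h \<zero> \<oplus> h \<zero>"
    using null_homotopyD(2)[OF h mdeg_closed(1) mdeg_closed(1)] .
  then have "h \<zero> = \<zero>" using hz by (metis M.add.r_cancel_one' M.r_zero M.zero_closed)
  moreover have "mdiff M (h z) \<in> mdeg M n" using d_deg[OF null_homotopyD(1)[OF h z(1)]] by simp
  ultimately have "e \<odot> z = mdiff M (h z)"
    using null_homotopyD(4)[OF h z(1)] z(2) mdeg_carrier by simp
  then show ?thesis using coboundariesI null_homotopyD(1)[OF h z(1)] by simp
qed

lemma coh_smult:
  assumes a: "a \<in> deg A 0" and z: "z \<in> cocycles M n"
  shows "proj0 A a \<odot>\<^bsub>cohomology M n\<^esub> coh_class M n z = coh_class M n (a \<odot> z)"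
proof -
  interpret B: abelian_subgroup "coboundaries M n" M by (rule coboundaries_subgroup)
  have *: "coh_class M n (b \<odot> y) = coh_class M n (a \<odot> z)"
    if b: "b \<in> proj0 A a" and y: "y \<in> coh_class M n z" for b y
  proof -
    obtain e where e: "e \<in> boundaries0 A" "b = e \<oplus>\<^bsub>A\<^esub> a"
      using b by (auto simp: proj0_eq a_r_coset_def')
    obtain w where w: "w \<in> coboundaries M n" "y = w \<oplus> z"
      using y by (auto simp: coh_class_def a_r_coset_def')
    have ec: "e \<in> deg A 0" using e(1) A.diff_deg[of _ "-1"] by (auto simp: A.boundaries0_iff)
    have wz: "w \<in> cocycles M n" using w coboundaries_cocycles by blast
    have yz: "y \<in> cocycles M n" using w wz z cocycles_closed(2) by simp
    have c: "w \<in> carrier M" "z \<in> carrier M" "y \<in> carrier M" using wz z yz cocycles_mdeg(3) by auto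
    have cl: "e \<odot> y \<in> carrier M" "a \<odot> w \<in> carrier M" "a \<odot> z \<in> carrier M"
      using M.smult_closed ec a c by auto
    have "b \<odot> y = e \<odot> y \<oplus> a \<odot> y"
      using M.smult_l_distr[of e a y] ec a c e by simp
    also have "a \<odot> y = a \<odot> w \<oplus> a \<odot> z"
      using M.smult_r_distr[of a w z] a c w by simp
    finally have "b \<odot> y \<oplus> \<ominus> (a \<odot> z) = e \<odot> y \<oplus> a \<odot> w"
      using cl by (simp add: M.a_assoc M.r_neg)
    also have "\<dots> \<in> coboundaries M n"
      using boundary_smult[OF e(1) yz] coboundaries_closed(4)[OF a w(1)] by (rule coboundaries_closed(2))
    finally have "b \<odot> y \<oplus> \<ominus> (a \<odot> z) \<in> coboundaries M n" .
    moreover have "b \<odot> y \<in> cocycles M n" "a \<odot> z \<in> cocycles M n"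
      using cocycles_closed(4) yz z a e ec A.deg_closed(2) by auto
    ultimately show ?thesis using coh_class_eq_iff by blast
  qed
  have "a \<in> proj0 A a" using A.proj0_self[OF a] .
  moreover have "z \<in> coh_class M n z" using B.a_rcos_self[OF cocycles_mdeg(3)[OF z]] by (simp add: coh_class_def)
  ultimately have "(\<Union>b\<in>proj0 A a. \<Union>y\<in>coh_class M n z. coh_class M n (b \<odot> y)) = coh_class M n (a \<odot> z)"
    using * by blast
  then show ?thesis by (simp add: cohomology_def coh_class_def)
qed

lemma cohomology_module: "module (H0 A) (cohomology M n)"
proof (rule moduleI)
  show "cring (H0 A)" by (rule A.H0_cring)
  show "abelian_group (cohomology M n)"
  proof (rule abelian_groupI)
    fix x assume "x \<in> carrier (cohomology M n)"
    then obtain z where z: "z \<in> cocycles M n" "x = coh_class M n z" by (auto simp: coh_carrier)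
    then show "\<exists>y\<in>carrier (cohomology M n). y \<oplus>\<^bsub>cohomology M n\<^esub> x = \<zero>\<^bsub>cohomology M n\<^esub>"
      using coh_add[OF cocycles_closed(3) z(1), of z] cocycles_closed(3)[OF z(1)] cocycles_mdeg(3)[OF z(1)]
      by (intro bexI[of _ "coh_class M n (\<ominus> z)"]) (auto simp: coh_zero M.l_neg coh_class_closed)
  qed (auto simp: coh_carrier coh_zero coh_add cocycles_closed cocycles_mdeg(3) M.a_ac)
next
  let ?H = "cohomology M n"
  fix x u assume xu: "x \<in> carrier (H0 A)" "u \<in> carrier ?H"
  then obtain a z where a: "a \<in> deg A 0" "x = proj0 A a" and z: "z \<in> cocycles M n" "u = coh_class M n z"
    by (auto simp: coh_carrier A.H0_carrier)
  note c = cocycles_mdeg(3)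
  note simps = coh_smult coh_add A.H0_ops cocycles_closed A.deg_closed A.deg0_mult(1)
  show "x \<odot>\<^bsub>?H\<^esub> u \<in> carrier ?H"
    using a z by (simp add: simps coh_class_closed)
  fix v assume "v \<in> carrier ?H"
  then obtain w where w: "w \<in> cocycles M n" "v = coh_class M n w" by (auto simp: coh_carrier)
  show "x \<odot>\<^bsub>?H\<^esub> (u \<oplus>\<^bsub>?H\<^esub> v) = x \<odot>\<^bsub>?H\<^esub> u \<oplus>\<^bsub>?H\<^esub> x \<odot>\<^bsub>?H\<^esub> v"
    using M.smult_r_distr[of a z w] a z w c[OF z(1)] c[OF w(1)] by (simp add: simps)
next
  let ?H = "cohomology M n"
  fix x y u assume "x \<in> carrier (H0 A)" "y \<in> carrier (H0 A)" "u \<in> carrier ?H"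
  then obtain a b z where a: "a \<in> deg A 0" "x = proj0 A a" and b: "b \<in> deg A 0" "y = proj0 A b"
    and z: "z \<in> cocycles M n" "u = coh_class M n z"
    by (auto simp: coh_carrier A.H0_carrier)
  note c = cocycles_mdeg(3)[OF z(1)]
  note simps = coh_smult coh_add A.H0_ops cocycles_closed A.deg_closed A.deg0_mult(1)
  show "(x \<oplus>\<^bsub>H0 A\<^esub> y) \<odot>\<^bsub>?H\<^esub> u = x \<odot>\<^bsub>?H\<^esub> u \<oplus>\<^bsub>?H\<^esub> y \<odot>\<^bsub>?H\<^esub> u"
    using M.smult_l_distr[of a b z] a b z c by (simp add: simps)
  show "(x \<otimes>\<^bsub>H0 A\<^esub> y) \<odot>\<^bsub>?H\<^esub> u = x \<odot>\<^bsub>?H\<^esub> (y \<odot>\<^bsub>?H\<^esub> u)"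
    using M.smult_assoc1[of a b z] a b z c by (simp add: simps)
next
  fix u assume "u \<in> carrier (cohomology M n)"
  then obtain z where z: "z \<in> cocycles M n" "u = coh_class M n z" by (auto simp: coh_carrier)
  then show "\<one>\<^bsub>H0 A\<^esub> \<odot>\<^bsub>cohomology M n\<^esub> u = u"
    using M.smult_one[of z] cocycles_mdeg(3)[of z n] A.one_deg coh_smult[of "\<one>\<^bsub>A\<^esub>" z n]
    by (simp add: A.H0_ops)
qed

lemma cohomology_nonzero_iff: "cohomology_nonzero M n \<longleftrightarrow> (\<exists>z\<in>cocycles M n. z \<notin> coboundaries M n)"
proof -
  interpret H: module "H0 A" "cohomology M n" by (rule cohomology_module)
  have "cohomology_nonzero M n \<longleftrightarrow> (\<exists>u\<in>carrier (cohomology M n). u \<noteq> \<zero>\<^bsub>cohomology M n\<^esub>)"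
    unfolding cohomology_nonzero_def using H.M.zero_closed by blast
  then show ?thesis by (auto simp: coh_carrier coh_class_zero_iff)
qed

lemma nonzerodivisor_iff:
  assumes "a \<in> deg A 0"
  shows "nonzerodivisor (cohomology M n) (proj0 A a) \<longleftrightarrow>
    (\<forall>z\<in>cocycles M n. a \<odot> z \<in> coboundaries M n \<longrightarrow> z \<in> coboundaries M n)"
  using assms by (auto simp: nonzerodivisor_def coh_carrier coh_smult coh_class_zero_iff cocycles_closed)

lemma regular_elt_iff:
  assumes "m \<subseteq> carrier (H0 A)"
  shows "regular_elt m M x \<longleftrightarrow> x \<in> m \<and> nonzerodivisor (cohomology M (inf_dg M)) x"
proof (cases "x \<in> m")
  case True
  interpret H: module "H0 A" "cohomology M (inf_dg M)" by (rule cohomology_module)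
  let ?H = "cohomology M (inf_dg M)"
  have x: "x \<in> carrier (H0 A)" using True assms by blast
  have "inj_on (\<lambda>y. x \<odot>\<^bsub>?H\<^esub> y) (carrier ?H) \<longleftrightarrow> nonzerodivisor ?H x"
  proof
    assume "inj_on (\<lambda>y. x \<odot>\<^bsub>?H\<^esub> y) (carrier ?H)"
    then show "nonzerodivisor ?H x" unfolding nonzerodivisor_def
      using x H.smult_r_null[OF x] by (metis H.M.zero_closed inj_onD)
  next
    assume n: "nonzerodivisor ?H x"
    show "inj_on (\<lambda>y. x \<odot>\<^bsub>?H\<^esub> y) (carrier ?H)"
    proof (rule inj_onI)
      fix u v assume uv: "u \<in> carrier ?H" "v \<in> carrier ?H" "x \<odot>\<^bsub>?H\<^esub> u = x \<odot>\<^bsub>?H\<^esub> v"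
      have "x \<odot>\<^bsub>?H\<^esub> (u \<oplus>\<^bsub>?H\<^esub> \<ominus>\<^bsub>?H\<^esub> v) = \<zero>\<^bsub>?H\<^esub>"
        using uv x by (simp add: H.smult_r_distr H.smult_r_minus H.M.r_neg)
      then have "u \<oplus>\<^bsub>?H\<^esub> \<ominus>\<^bsub>?H\<^esub> v = \<zero>\<^bsub>?H\<^esub>" using n uv by (simp add: nonzerodivisor_def)
      then show "u = v" using uv by (metis H.M.add.inv_closed H.M.minus_equality H.M.minus_minus)
    qed
  qed
  then show ?thesis using True by (simp add: regular_elt_def Let_def)
qed (simp add: regular_elt_def)

end

text \<open>A complete rewriting system for sums in abelian groups, for the proof method \<open>algebra\<close>.\<close>

context abelian_group
begin

lemma a_neg_cancel: "x \<in> carrier G \<Longrightarrow> y \<in> carrier G \<Longrightarrow> x \<oplus> (\<ominus> x \<oplus> y) = y"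
  by (simp add: r_neg flip: a_assoc)

lemma a_neg_cancel': "x \<in> carrier G \<Longrightarrow> y \<in> carrier G \<Longrightarrow> \<ominus> x \<oplus> (x \<oplus> y) = y"
  by (simp add: l_neg flip: a_assoc)

lemma a_neg_zero: "\<ominus> \<zero> = \<zero>"
  by (rule minus_equality) auto

lemmas group_normalization [algebra group "zero G" "add G" "a_inv G" "a_minus G"] =
  a_closed zero_closed a_inv_closed minus_closed a_assoc l_zero l_neg a_comm minus_eq
  r_zero r_neg a_neg_cancel a_neg_cancel' minus_add minus_minus a_neg_zero a_lcomm

lemma eq_minus_iff: "x \<in> carrier G \<Longrightarrow> y \<in> carrier G \<Longrightarrow> x \<oplus> y = \<zero> \<longleftrightarrow> x = \<ominus> y"
  by (metis l_neg minus_equality)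

end

section \<open>Induced maps in cohomology\<close>

text \<open>The map is specified on cocycles only, since the connecting maps of cones are not chain maps of
  degree zero.\<close>

lemma induced_map:
  assumes M: "dg_complex A M" and N: "dg_complex A N"
    and cl: "\<And>z. z \<in> cocycles M n \<Longrightarrow> f z \<in> cocycles N k"
    and add: "\<And>z w. z \<in> cocycles M n \<Longrightarrow> w \<in> cocycles M n \<Longrightarrow> f (z \<oplus>\<^bsub>M\<^esub> w) = f z \<oplus>\<^bsub>N\<^esub> f w"
    and smult: "\<And>b z. b \<in> deg A 0 \<Longrightarrow> z \<in> cocycles M n \<Longrightarrow> f (b \<odot>\<^bsub>M\<^esub> z) = b \<odot>\<^bsub>N\<^esub> f z"
    and bd: "\<And>z. z \<in> coboundaries M n \<Longrightarrow> f z \<in> coboundaries N k"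
  obtains g where "linear_map (H0 A) (cohomology M n) (cohomology N k) g"
    "\<forall>z\<in>cocycles M n. g (coh_class M n z) = coh_class N k (f z)"
proof -
  interpret M: dg_complex A M by fact
  interpret N: dg_complex A N by fact
  define g where "g X = coh_class N k (f (SOME z. z \<in> cocycles M n \<and> coh_class M n z = X))" for X
  have g: "g (coh_class M n z) = coh_class N k (f z)" if z: "z \<in> cocycles M n" for z
  proof -
    let ?P = "\<lambda>w. w \<in> cocycles M n \<and> coh_class M n w = coh_class M n z"
    define w where "w = (SOME w. ?P w)"
    have "?P w" unfolding w_def by (rule someI[of ?P z]) (simp add: z)
    then have w: "w \<in> cocycles M n" "coh_class M n w = coh_class M n z" by auto
    then have "w \<oplus>\<^bsub>M\<^esub> \<ominus>\<^bsub>M\<^esub> z \<in> coboundaries M n" using M.coh_class_eq_iff z by blast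
    then have "f (w \<oplus>\<^bsub>M\<^esub> \<ominus>\<^bsub>M\<^esub> z) \<in> coboundaries N k" by (rule bd)
    moreover have "f (\<ominus>\<^bsub>M\<^esub> z) = \<ominus>\<^bsub>N\<^esub> f z"
      using smult[OF M.neg_one(1) z] M.neg_one(2)[OF M.cocycles_mdeg(3)[OF z]]
        N.neg_one(2)[OF N.cocycles_mdeg(3)[OF cl[OF z]]] by simp
    ultimately have "f w \<oplus>\<^bsub>N\<^esub> \<ominus>\<^bsub>N\<^esub> f z \<in> coboundaries N k"
      using add[OF w(1) M.cocycles_closed(3)[OF z]] by simp
    then have "coh_class N k (f w) = coh_class N k (f z)"
      using N.coh_class_eq_iff[OF cl[OF w(1)] cl[OF z]] by simp
    then show ?thesis by (simp add: g_def w_def)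
  qed
  have "linear_map (H0 A) (cohomology M n) (cohomology N k) g"
    unfolding linear_map_def
    by (auto simp: M.coh_carrier N.coh_carrier g cl M.coh_add N.coh_add add M.cocycles_closed
        M.A.H0_carrier M.coh_smult N.coh_smult smult)
  then show ?thesis using that g by blast
qed


section \<open>The cone of a multiplication\<close>

abbreviation mult_cone :: "('a, 'b) dg_ring_scheme \<Rightarrow> ('a, 'm cone_elt) dg_module \<Rightarrow> 'a \<Rightarrow>
    ('a, 'm cone_elt) dg_module" where
  "mult_cone A M a \<equiv> cone A M M (\<lambda>y. a \<odot>\<^bsub>M\<^esub> y)"

lemma koszul_eq: "koszul A M x = mult_cone A M (SOME a. a \<in> x)"
  by (simp add: koszul_def)

text \<open>On degree zero scalars the sign in the module structure of a cone disappears, so that only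
  \<open>A\<^sup>0\<close>-linear structure has to be tracked.\<close>

lemma (in comm_dg_ring) sgn_twist_deg0:
  assumes a: "a \<in> deg A 0"
  shows "sgn_twist A (deg A) a = a"
proof -
  let ?c = "\<lambda>n::int. if n = 0 then a else \<zero>"
  have c: "{n. ?c n \<noteq> \<zero>} = (if a = \<zero> then {} else {0})" by auto
  have ac: "a \<in> carrier A" using deg_carrier[OF a] .
  have sum: "(\<Oplus>n\<in>{n. ?c n \<noteq> \<zero>}. g n) = (if a = \<zero> then \<zero> else g 0)" if "g 0 \<in> carrier A" for g
    using that finsum_insert[of "{}" "0::int" g] unfolding c by auto
  have "decomposition A (deg A) a ?c"
    unfolding decomposition_def using a deg_closed(1) sum[of ?c] ac by (auto simp: c)
  moreover have "\<exists>!c. decomposition A (deg A) a c"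
    using grading ac by (simp add: direct_sum_grading_def)
  ultimately have "(THE c. decomposition A (deg A) a c) = ?c" by (simp add: the1_equality)
  then show ?thesis
    unfolding sgn_twist_def Let_def using sum[of "\<lambda>n. sgn_pow A n (?c n)"] ac
    by (auto simp: sgn_pow_def)
qed

locale koszul_cone = dg_complex A M
  for A :: "('a, 'b) dg_ring_scheme" and M :: "('a, 'm cone_elt) dg_module" (structure) +
  fixes a :: 'a and K :: "('a, 'm cone_elt) dg_module"
  assumes a0: "a \<in> deg A 0"
  defines "K \<equiv> mult_cone A M a"
begin

lemma cone_simps:
  "Cone_Pair x y \<in> carrier K \<longleftrightarrow> x \<in> carrier M \<and> y \<in> carrier M"
  "Cone_Pair x y \<oplus>\<^bsub>K\<^esub> Cone_Pair x' y' = Cone_Pair (x \<oplus> x') (y \<oplus> y')"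
  "\<zero>\<^bsub>K\<^esub> = Cone_Pair \<zero> \<zero>"
  "b \<in> deg A 0 \<Longrightarrow> b \<odot>\<^bsub>K\<^esub> Cone_Pair x y = Cone_Pair (b \<odot> x) (b \<odot> y)"
  "Cone_Pair x y \<in> mdeg K n \<longleftrightarrow> x \<in> mdeg M (n + 1) \<and> y \<in> mdeg M n"
  "mdiff K (Cone_Pair x y) = Cone_Pair (\<ominus> mdiff M x) (a \<odot> x \<oplus> mdiff M y)"
  by (auto simp: K_def cone_def A.sgn_twist_deg0)

lemma cone_cases:
  "p \<in> carrier K \<Longrightarrow> \<exists>x y. p = Cone_Pair x y \<and> x \<in> carrier M \<and> y \<in> carrier M"
  "p \<in> mdeg K n \<Longrightarrow> \<exists>x y. p = Cone_Pair x y \<and> x \<in> mdeg M (n + 1) \<and> y \<in> mdeg M n"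
  by (auto simp: K_def cone_def)

lemma smult_carrier: "b \<in> deg A 0 \<Longrightarrow> x \<in> carrier M \<Longrightarrow> b \<odot> x \<in> carrier M"
  using M.smult_closed[of b x] by simp

lemma cone_module: "module (deg0 A) K"
proof (rule moduleI)
  show "cring (deg0 A)" by (rule A.deg0_cring)
  show "abelian_group K"
  proof (rule abelian_groupI)
    fix p assume "p \<in> carrier K"
    then obtain x y where p: "p = Cone_Pair x y" "x \<in> carrier M" "y \<in> carrier M" using cone_cases by blast
    then show "\<exists>q\<in>carrier K. q \<oplus>\<^bsub>K\<^esub> p = \<zero>\<^bsub>K\<^esub>"
      by (intro bexI[of _ "Cone_Pair (\<ominus> x) (\<ominus> y)"]) (auto simp: cone_simps M.l_neg)
  qed (auto simp: cone_simps M.a_ac dest!: cone_cases(1))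
qed (use M.smult_l_distr M.smult_r_distr M.smult_assoc1 M.smult_one A.deg0_mult A.deg_closed A.one_deg
  in \<open>auto simp: cone_simps smult_carrier dest!: cone_cases(1)\<close>)

lemma cone_minus: "x \<in> carrier M \<Longrightarrow> y \<in> carrier M \<Longrightarrow> \<ominus>\<^bsub>K\<^esub> Cone_Pair x y = Cone_Pair (\<ominus> x) (\<ominus> y)"
proof -
  interpret K: module "deg0 A" K by (rule cone_module)
  assume "x \<in> carrier M" "y \<in> carrier M"
  then show ?thesis by (intro K.M.minus_equality) (auto simp: cone_simps M.l_neg)
qed

text \<open>The homotopy \<open>(-h, h)\<close> works on the cone because \<open>h\<close> commutes with the multiplication by \<open>a\<close>.\<close>

lemma null_homotopy_cone:
  assumes "null_homotopy A M e h" and e: "e \<in> deg A 0"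
  shows "null_homotopy A K e (\<lambda>p. Cone_Pair (\<ominus> h (pfst p)) (h (psnd p)))"
  unfolding null_homotopy_def
proof (intro allI ballI)
  note h = null_homotopyD[OF assms(1)]
  have hm: "h (\<ominus> x) = \<ominus> h x" if "x \<in> mdeg M n" for x n
    using h(3)[OF that neg_one(1)] neg_one(2) mdeg_carrier h(1)[OF that] mdeg_carrier[OF that] by metis
  fix n p assume "p \<in> mdeg K n"
  then obtain x y where p: "p = Cone_Pair x y" "x \<in> mdeg M (n + 1)" "y \<in> mdeg M n" using cone_cases by blast
  have hx: "h x \<in> mdeg M n" and hy: "h y \<in> mdeg M (n - 1)" using h(1)[OF p(2)] h(1)[OF p(3)] by auto
  have dx: "mdiff M x \<in> mdeg M (n + 2)" and dy: "mdiff M y \<in> mdeg M (n + 1)"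
    using d_deg[OF p(2)] d_deg[OF p(3)] by (auto simp: add.assoc)
  have ax: "a \<odot> x \<in> mdeg M (n + 1)" and ahx: "a \<odot> h x \<in> mdeg M n"
    using mdeg_closed(4) a0 p hx by auto
  have c: "h x \<in> carrier M" "h y \<in> carrier M" "mdiff M (h x) \<in> carrier M" "mdiff M (h y) \<in> carrier M"
    "h (mdiff M x) \<in> carrier M" "h (mdiff M y) \<in> carrier M" "a \<odot> h x \<in> carrier M"
    using hx hy d_deg[OF hx] d_deg[OF hy] h(1)[OF dx] h(1)[OF dy] ahx mdeg_carrier by blast+
  show "Cone_Pair (\<ominus> h (pfst p)) (h (psnd p)) \<in> mdeg K (n - 1) \<and>
    (\<forall>q\<in>mdeg K n. Cone_Pair (\<ominus> h (pfst (p \<oplus>\<^bsub>K\<^esub> q))) (h (psnd (p \<oplus>\<^bsub>K\<^esub> q))) =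
       Cone_Pair (\<ominus> h (pfst p)) (h (psnd p)) \<oplus>\<^bsub>K\<^esub> Cone_Pair (\<ominus> h (pfst q)) (h (psnd q))) \<and>
    (\<forall>b\<in>deg A 0. Cone_Pair (\<ominus> h (pfst (b \<odot>\<^bsub>K\<^esub> p))) (h (psnd (b \<odot>\<^bsub>K\<^esub> p))) =
       b \<odot>\<^bsub>K\<^esub> Cone_Pair (\<ominus> h (pfst p)) (h (psnd p))) \<and>
    e \<odot>\<^bsub>K\<^esub> p = mdiff K (Cone_Pair (\<ominus> h (pfst p)) (h (psnd p))) \<oplus>\<^bsub>K\<^esub>
      Cone_Pair (\<ominus> h (pfst (mdiff K p))) (h (psnd (mdiff K p)))" (is "?A \<and> ?B \<and> ?C \<and> ?D")
  proof (intro conjI ballI)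
    show ?A using hx hy mdeg_closed(3) by (simp add: p cone_simps)
  next
    fix q assume "q \<in> mdeg K n"
    then obtain u v where q: "q = Cone_Pair u v" "u \<in> mdeg M (n + 1)" "v \<in> mdeg M n" using cone_cases by blast
    have "h u \<in> carrier M" using h(1)[OF q(2)] mdeg_carrier by blast
    then show "Cone_Pair (\<ominus> h (pfst (p \<oplus>\<^bsub>K\<^esub> q))) (h (psnd (p \<oplus>\<^bsub>K\<^esub> q))) =
       Cone_Pair (\<ominus> h (pfst p)) (h (psnd p)) \<oplus>\<^bsub>K\<^esub> Cone_Pair (\<ominus> h (pfst q)) (h (psnd q))"
      using h(2)[OF p(2) q(2)] h(2)[OF p(3) q(3)] c by (simp add: p q cone_simps M.minus_add)
  next
    fix b assume b: "b \<in> deg A 0"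
    have "b \<odot> (\<ominus> h x) = \<ominus> (b \<odot> h x)" using M.smult_r_minus b c by simp
    then show "Cone_Pair (\<ominus> h (pfst (b \<odot>\<^bsub>K\<^esub> p))) (h (psnd (b \<odot>\<^bsub>K\<^esub> p))) =
       b \<odot>\<^bsub>K\<^esub> Cone_Pair (\<ominus> h (pfst p)) (h (psnd p))"
      using h(3)[OF p(2) b] h(3)[OF p(3) b] b by (simp add: p cone_simps)
  next
    have 1: "e \<odot> x = mdiff M (h x) \<oplus> h (mdiff M x)" "e \<odot> y = mdiff M (h y) \<oplus> h (mdiff M y)"
      using h(4) p by blast+
    have 2: "mdiff M (\<ominus> h x) = \<ominus> mdiff M (h x)" "h (\<ominus> mdiff M x) = \<ominus> h (mdiff M x)"
      "a \<odot> (\<ominus> h x) = \<ominus> (a \<odot> h x)"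
      using d_minus[OF hx] hm[OF dx] M.smult_r_minus a0 c by auto
    have 3: "h (a \<odot> x \<oplus> mdiff M y) = a \<odot> h x \<oplus> h (mdiff M y)"
      using h(2)[OF ax dy] h(3)[OF p(2) a0] by simp
    have "(\<ominus> (a \<odot> h x) \<oplus> mdiff M (h y)) \<oplus> (a \<odot> h x \<oplus> h (mdiff M y))
      = mdiff M (h y) \<oplus> h (mdiff M y)"
      using c by algebra
    then show ?D using c by (simp add: p cone_simps e 1 2 3 M.minus_minus)
  qed
qed

lemma cone_dg_complex: "dg_complex A K"
proof -
  interpret K: module "deg0 A" K by (rule cone_module)
  show ?thesis
  proof (intro dg_complex.intro dg_complex_axioms.intro)
    show "comm_dg_ring A" by (rule A.comm_dg_ring_axioms)
    show "module (deg0 A) K" by (rule cone_module)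
    fix n
    show "submodule (mdeg K n) (deg0 A) K"
      unfolding K.submodule_iff using mdeg_closed mdeg_carrier
      by (auto simp: cone_simps dest!: cone_cases(2))
    fix p assume "p \<in> mdeg K n"
    then obtain x y where p: "p = Cone_Pair x y" "x \<in> mdeg M (n + 1)" "y \<in> mdeg M n" using cone_cases by blast
    have dx: "mdiff M x \<in> mdeg M (n + 1 + 1)" and dy: "mdiff M y \<in> mdeg M (n + 1)"
      using d_deg[OF p(2)] d_deg[OF p(3)] by auto
    have ax: "a \<odot> x \<in> mdeg M (n + 1)" using mdeg_closed(4) a0 p by auto
    have c: "x \<in> carrier M" "y \<in> carrier M" "mdiff M x \<in> carrier M" "mdiff M y \<in> carrier M" "a \<odot> x \<in> carrier M"
      "a \<odot> mdiff M x \<in> carrier M"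
      using p dx dy ax mdeg_carrier smult_carrier[OF a0] by blast+
    show "mdiff K p \<in> mdeg K (n + 1)" using dx dy ax mdeg_closed(2,3) by (simp add: p cone_simps)
    show "mdiff K (mdiff K p) = \<zero>\<^bsub>K\<^esub>"
    proof -
      have "mdiff M (\<ominus> mdiff M x) = \<zero>" using d_minus[OF dx] d_d[OF p(2)] M.a_neg_zero by simp
      moreover have "a \<odot> (\<ominus> mdiff M x) = \<ominus> (a \<odot> mdiff M x)"
        using M.smult_r_minus a0 c by simp
      moreover have "mdiff M (a \<odot> x \<oplus> mdiff M y) = a \<odot> mdiff M x"
        using d_add[OF ax dy] d_smult[OF a0 p(2)] d_d[OF p(3)] c by simp
      ultimately show ?thesis using c M.a_neg_zero by (simp add: p cone_simps M.l_neg)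
    qed
    fix q assume "q \<in> mdeg K n"
    then obtain u v where q: "q = Cone_Pair u v" "u \<in> mdeg M (n + 1)" "v \<in> mdeg M n" using cone_cases by blast
    have c': "u \<in> carrier M" "v \<in> carrier M" "mdiff M u \<in> carrier M" "mdiff M v \<in> carrier M" "a \<odot> u \<in> carrier M"
      using q d_deg[OF q(2)] d_deg[OF q(3)] mdeg_carrier smult_carrier[OF a0] by blast+
    have "a \<odot> (x \<oplus> u) = a \<odot> x \<oplus> a \<odot> u" using M.smult_r_distr a0 c c' by simp
    then show "mdiff K (p \<oplus>\<^bsub>K\<^esub> q) = mdiff K p \<oplus>\<^bsub>K\<^esub> mdiff K q"
      using c c' d_add[OF p(2) q(2)] d_add[OF p(3) q(3)]
      by (simp add: p q cone_simps M.minus_add M.a_ac)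
  next
    fix n p b assume b: "b \<in> deg A 0" and "p \<in> mdeg K n"
    then obtain x y where p: "p = Cone_Pair x y" "x \<in> mdeg M (n + 1)" "y \<in> mdeg M n" using cone_cases by blast
    have c: "x \<in> carrier M" "y \<in> carrier M" "mdiff M x \<in> carrier M" "mdiff M y \<in> carrier M" "a \<odot> x \<in> carrier M"
      using p d_deg[OF p(2)] d_deg[OF p(3)] mdeg_carrier smult_carrier[OF a0] by blast+
    have "a \<odot> (b \<odot> x) = b \<odot> (a \<odot> x)" using M.smult_commute a0 b c by simp
    moreover have "b \<odot> (\<ominus> mdiff M x) = \<ominus> (b \<odot> mdiff M x)" using M.smult_r_minus b c by simp
    ultimately show "mdiff K (b \<odot>\<^bsub>K\<^esub> p) = b \<odot>\<^bsub>K\<^esub> mdiff K p"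
      using d_smult[OF b p(2)] d_smult[OF b p(3)] M.smult_r_distr[of b "a \<odot> x" "mdiff M y"] b c
      by (simp add: p cone_simps)
  next
    fix e assume e: "e \<in> boundaries0 A"
    then have "e \<in> deg A 0" using A.diff_deg[of _ "-1"] by (auto simp: A.boundaries0_iff)
    then show "\<exists>h. null_homotopy A K e h"
      using boundary_null_homotopic[OF e] null_homotopy_cone by blast
  qed
qed

text \<open>The long exact sequence of the triangle \<open>M \<rightarrow> M \<rightarrow> K\<close> around \<open>H\<^sup>n(K)\<close>: \<open>\<iota>\<close> is induced by the
  inclusion of the summand \<open>M\<close>, and \<open>\<delta>\<close> by the projection to \<open>M[1]\<close>.\<close>

lemma cone_exact_sequence:
  obtains \<iota> \<delta> where
    "linear_map (H0 A) (cohomology M n) (cohomology K n) \<iota>"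
    "linear_map (H0 A) (cohomology K n) (cohomology M (n + 1)) \<delta>"
    "\<forall>y\<in>carrier (cohomology M n). \<iota> y = \<zero>\<^bsub>cohomology K n\<^esub> \<longleftrightarrow>
       (\<exists>w\<in>carrier (cohomology M n). y = proj0 A a \<odot>\<^bsub>cohomology M n\<^esub> w)"
    "\<forall>y\<in>carrier (cohomology K n). \<delta> y = \<zero>\<^bsub>cohomology M (n + 1)\<^esub> \<longleftrightarrow> y \<in> \<iota> ` carrier (cohomology M n)"
    "\<delta> ` carrier (cohomology K n) =
       {y \<in> carrier (cohomology M (n + 1)). proj0 A a \<odot>\<^bsub>cohomology M (n + 1)\<^esub> y = \<zero>\<^bsub>cohomology M (n + 1)\<^esub>}"
proof -
  interpret K: dg_complex A K by (rule cone_dg_complex)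
  have cK: "Cone_Pair u v \<in> cocycles K n \<longleftrightarrow>
    u \<in> cocycles M (n + 1) \<and> v \<in> mdeg M n \<and> a \<odot> u \<oplus> mdiff M v = \<zero>" for u v
  proof -
    have "\<ominus> mdiff M u = \<zero> \<longleftrightarrow> mdiff M u = \<zero>" if "u \<in> mdeg M (n + 1)"
      using d_deg[OF that] mdeg_carrier M.a_neg_zero M.minus_minus by metis
    then show ?thesis by (auto simp: cocycles_def cone_simps)
  qed
  have bK: "p \<in> coboundaries K n \<longleftrightarrow>
    (\<exists>x\<in>mdeg M n. \<exists>y\<in>mdeg M (n - 1). p = Cone_Pair (\<ominus> mdiff M x) (a \<odot> x \<oplus> mdiff M y))" for p
  proof
    assume "p \<in> coboundaries K n"
    then obtain q where q: "q \<in> mdeg K (n - 1)" "p = mdiff K q" unfolding K.coboundaries_iff by blast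
    then obtain x y where "q = Cone_Pair x y" "x \<in> mdeg M n" "y \<in> mdeg M (n - 1)"
      using cone_cases(2)[OF q(1)] by auto
    then show "\<exists>x\<in>mdeg M n. \<exists>y\<in>mdeg M (n - 1). p = Cone_Pair (\<ominus> mdiff M x) (a \<odot> x \<oplus> mdiff M y)"
      using q by (auto simp: cone_simps)
  next
    assume "\<exists>x\<in>mdeg M n. \<exists>y\<in>mdeg M (n - 1). p = Cone_Pair (\<ominus> mdiff M x) (a \<odot> x \<oplus> mdiff M y)"
    then obtain x y where "x \<in> mdeg M n" "y \<in> mdeg M (n - 1)" "p = mdiff K (Cone_Pair x y)"
      by (auto simp: cone_simps)
    then show "p \<in> coboundaries K n" using K.coboundariesI[of "Cone_Pair x y" n] by (simp add: cone_simps)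
  qed
  have Kcases: "\<exists>u v. p = Cone_Pair u v \<and> u \<in> cocycles M (n + 1) \<and> v \<in> mdeg M n \<and> a \<odot> u \<oplus> mdiff M v = \<zero>"
    if "p \<in> cocycles K n" for p
    using cone_cases(2)[OF K.cocycles_mdeg(1)[OF that]] that cK by blast
  note car = mdeg_carrier cocycles_mdeg(3)
  have sc: "b \<in> deg A 0 \<Longrightarrow> b \<odot> \<zero> = \<zero>" for b using M.smult_r_null[of b] by simp
  have ic: "Cone_Pair \<zero> v \<in> cocycles K n" if "v \<in> cocycles M n" for v
    using that cocycles_mdeg[OF that] cocycles_closed(1) sc[OF a0] by (simp add: cK)
  obtain \<iota> where \<iota>: "linear_map (H0 A) (cohomology M n) (cohomology K n) \<iota>"
    "\<forall>v\<in>cocycles M n. \<iota> (coh_class M n v) = coh_class K n (Cone_Pair \<zero> v)"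
  proof (rule induced_map[OF dg_complex_axioms cone_dg_complex, of n "Cone_Pair \<zero>" n])
    fix z assume "z \<in> coboundaries M n"
    then obtain w where w: "w \<in> mdeg M (n - 1)" "z = mdiff M w" unfolding coboundaries_iff by blast
    have "mdiff M w \<in> carrier M" using d_deg[OF w(1)] mdeg_carrier by blast
    then show "Cone_Pair \<zero> z \<in> coboundaries K n" unfolding bK
      using w mdeg_closed(1) sc[OF a0]
      by (intro bexI[of _ "\<zero>"] bexI[of _ w]) (auto simp: d_zero M.a_neg_zero)
  qed (use ic sc in \<open>auto simp: cone_simps\<close>)
  obtain \<delta> where \<delta>: "linear_map (H0 A) (cohomology K n) (cohomology M (n + 1)) \<delta>"
    "\<forall>p\<in>cocycles K n. \<delta> (coh_class K n p) = coh_class M (n + 1) (pfst p)"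
  proof (rule induced_map[OF cone_dg_complex dg_complex_axioms, of n pfst "n + 1"])
    fix p assume "p \<in> coboundaries K n"
    then obtain x where "x \<in> mdeg M n" "pfst p = \<ominus> mdiff M x" unfolding bK by auto
    then show "pfst p \<in> coboundaries M (n + 1)"
      using coboundaries_closed(3)[OF coboundariesI[of x "n + 1"]] by simp
  qed (auto simp: cone_simps dest!: Kcases)
  have classes: "\<exists>z\<in>cocycles M k. y = coh_class M k z" if "y \<in> carrier (cohomology M k)" for y k
    using that by (auto simp: coh_carrier)
  show ?thesis
  proof (rule that[OF \<iota>(1) \<delta>(1)])
    show "\<forall>y\<in>carrier (cohomology M n). \<iota> y = \<zero>\<^bsub>cohomology K n\<^esub> \<longleftrightarrow>
       (\<exists>w\<in>carrier (cohomology M n). y = proj0 A a \<odot>\<^bsub>cohomology M n\<^esub> w)"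
    proof
      fix y assume "y \<in> carrier (cohomology M n)"
      then obtain v where v: "v \<in> cocycles M n" "y = coh_class M n v" using classes by blast
      have "\<iota> y = \<zero>\<^bsub>cohomology K n\<^esub> \<longleftrightarrow> Cone_Pair \<zero> v \<in> coboundaries K n"
        using \<iota>(2) v K.coh_class_zero_iff ic by simp
      also have "\<dots> \<longleftrightarrow> (\<exists>x\<in>cocycles M n. v \<oplus> \<ominus> (a \<odot> x) \<in> coboundaries M n)"
      proof
        assume "Cone_Pair \<zero> v \<in> coboundaries K n"
        then obtain x y where xy: "x \<in> mdeg M n" "y \<in> mdeg M (n - 1)" "\<zero> = \<ominus> mdiff M x"
          "v = a \<odot> x \<oplus> mdiff M y" unfolding bK by auto
        have c: "mdiff M x \<in> carrier M" "a \<odot> x \<in> carrier M" "mdiff M y \<in> carrier M"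
          using xy d_deg[OF xy(1)] d_deg[OF xy(2)] mdeg_carrier smult_carrier[OF a0] by blast+
        have "mdiff M x = \<zero>" using xy(3) c M.a_neg_zero M.minus_minus by metis
        then have "x \<in> cocycles M n" using xy cocyclesI by blast
        moreover have "v \<oplus> \<ominus> (a \<odot> x) = mdiff M y" unfolding xy(4) using c by algebra
        ultimately show "\<exists>x\<in>cocycles M n. v \<oplus> \<ominus> (a \<odot> x) \<in> coboundaries M n"
          using coboundariesI[OF xy(2)] by metis
      next
        assume "\<exists>x\<in>cocycles M n. v \<oplus> \<ominus> (a \<odot> x) \<in> coboundaries M n"
        then obtain x y where xy: "x \<in> cocycles M n" "y \<in> mdeg M (n - 1)" "v \<oplus> \<ominus> (a \<odot> x) = mdiff M y"
          unfolding coboundaries_iff by blast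
        have c: "v \<in> carrier M" "a \<odot> x \<in> carrier M" using v xy car smult_carrier[OF a0] by blast+
        have "v = a \<odot> x \<oplus> (v \<oplus> \<ominus> (a \<odot> x))" using c by algebra
        then show "Cone_Pair \<zero> v \<in> coboundaries K n" unfolding bK xy(3)
          using xy(1,2) cocycles_mdeg[OF xy(1)]
          by (rule_tac bexI[of _ x], rule_tac bexI[of _ y]) (simp_all add: M.a_neg_zero)
      qed
      also have "\<dots> \<longleftrightarrow> (\<exists>x\<in>cocycles M n. y = proj0 A a \<odot>\<^bsub>cohomology M n\<^esub> coh_class M n x)"
        using v coh_class_eq_iff[OF v(1)] coh_smult[OF a0] cocycles_closed(4)[OF a0] by simp
      finally show "\<iota> y = \<zero>\<^bsub>cohomology K n\<^esub> \<longleftrightarrow>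
         (\<exists>w\<in>carrier (cohomology M n). y = proj0 A a \<odot>\<^bsub>cohomology M n\<^esub> w)"
        by (simp add: coh_carrier)
    qed
    show "\<forall>y\<in>carrier (cohomology K n). \<delta> y = \<zero>\<^bsub>cohomology M (n + 1)\<^esub> \<longleftrightarrow> y \<in> \<iota> ` carrier (cohomology M n)"
    proof
      fix y assume "y \<in> carrier (cohomology K n)"
      then obtain p where p: "p \<in> cocycles K n" "y = coh_class K n p" by (auto simp: K.coh_carrier)
      obtain u v where uv: "p = Cone_Pair u v" "u \<in> cocycles M (n + 1)" "v \<in> mdeg M n"
        "a \<odot> u \<oplus> mdiff M v = \<zero>" using Kcases[OF p(1)] by blast
      have "\<delta> y = \<zero>\<^bsub>cohomology M (n + 1)\<^esub> \<longleftrightarrow> u \<in> coboundaries M (n + 1)"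
        using \<delta>(2) p uv coh_class_zero_iff[OF uv(2)] by simp
      also have "\<dots> \<longleftrightarrow> (\<exists>w\<in>cocycles M n. p \<oplus>\<^bsub>K\<^esub> \<ominus>\<^bsub>K\<^esub> Cone_Pair \<zero> w \<in> coboundaries K n)"
      proof
        assume "u \<in> coboundaries M (n + 1)"
        then obtain x where x: "x \<in> mdeg M n" "u = mdiff M x" unfolding coboundaries_iff by auto
        have c: "x \<in> carrier M" "mdiff M x \<in> carrier M" "v \<in> carrier M" "a \<odot> x \<in> carrier M"
          using x uv d_deg[OF x(1)] car smult_carrier[OF a0] by blast+
        let ?w = "v \<oplus> a \<odot> x"
        have ax: "a \<odot> x \<in> mdeg M n" using mdeg_closed(4) a0 x by blast
        have dv: "mdiff M v \<in> carrier M" "a \<odot> mdiff M x \<in> carrier M"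
          using d_deg[OF uv(3)] mdeg_carrier smult_carrier[OF a0 c(2)] by blast+
        have "?w \<in> cocycles M n"
          using d_add[OF uv(3) ax] d_smult[OF a0 x(1)] uv(3,4) x(2) mdeg_closed(2)[OF uv(3) ax] dv
          by (intro cocyclesI) (simp_all add: M.a_comm)
        moreover have "p \<oplus>\<^bsub>K\<^esub> \<ominus>\<^bsub>K\<^esub> Cone_Pair \<zero> ?w \<in> coboundaries K n"
          unfolding bK
        proof (intro bexI)
          have "v \<oplus> \<ominus> ?w = \<ominus> (a \<odot> x)" using c by algebra
          moreover have "a \<odot> (\<ominus> x) = \<ominus> (a \<odot> x)" using M.smult_r_minus a0 c by simp
          ultimately show "p \<oplus>\<^bsub>K\<^esub> \<ominus>\<^bsub>K\<^esub> Cone_Pair \<zero> ?w =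
            Cone_Pair (\<ominus> mdiff M (\<ominus> x)) (a \<odot> (\<ominus> x) \<oplus> mdiff M \<zero>)"
            using c x uv d_minus[OF x(1)] by (simp add: cone_simps cone_minus M.a_neg_zero d_zero M.minus_minus)
        qed (use x mdeg_closed in auto)
        ultimately show "\<exists>w\<in>cocycles M n. p \<oplus>\<^bsub>K\<^esub> \<ominus>\<^bsub>K\<^esub> Cone_Pair \<zero> w \<in> coboundaries K n" by blast
      next
        assume "\<exists>w\<in>cocycles M n. p \<oplus>\<^bsub>K\<^esub> \<ominus>\<^bsub>K\<^esub> Cone_Pair \<zero> w \<in> coboundaries K n"
        then obtain w where w: "w \<in> cocycles M n" "p \<oplus>\<^bsub>K\<^esub> \<ominus>\<^bsub>K\<^esub> Cone_Pair \<zero> w \<in> coboundaries K n" by blast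
        then obtain x where "x \<in> mdeg M n" "u = \<ominus> mdiff M x"
          using car[of w] car[of u] uv unfolding bK by (auto simp: cone_simps cone_minus M.a_neg_zero)
        then show "u \<in> coboundaries M (n + 1)"
          using coboundaries_closed(3)[OF coboundariesI[of x "n + 1"]] by simp
      qed
      also have "\<dots> \<longleftrightarrow> (\<exists>w\<in>cocycles M n. y = \<iota> (coh_class M n w))"
        using p K.coh_class_eq_iff[OF p(1) ic] \<iota>(2) by simp
      finally show "\<delta> y = \<zero>\<^bsub>cohomology M (n + 1)\<^esub> \<longleftrightarrow> y \<in> \<iota> ` carrier (cohomology M n)"
        by (auto simp: coh_carrier)
    qed
    show "\<delta> ` carrier (cohomology K n) =
       {y \<in> carrier (cohomology M (n + 1)). proj0 A a \<odot>\<^bsub>cohomology M (n + 1)\<^esub> y = \<zero>\<^bsub>cohomology M (n + 1)\<^esub>}"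
    proof (intro equalityI subsetI)
      fix y assume "y \<in> \<delta> ` carrier (cohomology K n)"
      then obtain p where p: "p \<in> cocycles K n" "y = \<delta> (coh_class K n p)" by (auto simp: K.coh_carrier)
      obtain u v where uv: "p = Cone_Pair u v" "u \<in> cocycles M (n + 1)" "v \<in> mdeg M n"
        "a \<odot> u \<oplus> mdiff M v = \<zero>" using Kcases[OF p(1)] by blast
      have "a \<odot> u = \<ominus> mdiff M v"
        using uv(4) M.eq_minus_iff[of "a \<odot> u" "mdiff M v"] d_deg[OF uv(3)] car smult_carrier[OF a0 car(2)[OF uv(2)]] by blast
      then have "a \<odot> u \<in> coboundaries M (n + 1)"
        using coboundaries_closed(3)[OF coboundariesI[of v "n + 1"]] uv(3) by simp
      then show "y \<in> {y \<in> carrier (cohomology M (n + 1)). proj0 A a \<odot>\<^bsub>cohomology M (n + 1)\<^esub> y = \<zero>\<^bsub>cohomology M (n + 1)\<^esub>}"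
        using p uv \<delta>(2) coh_smult[OF a0 uv(2)] coh_class_zero_iff[OF cocycles_closed(4)[OF a0 uv(2)]]
        by (simp add: coh_class_closed)
    next
      fix y assume y: "y \<in> {y \<in> carrier (cohomology M (n + 1)). proj0 A a \<odot>\<^bsub>cohomology M (n + 1)\<^esub> y = \<zero>\<^bsub>cohomology M (n + 1)\<^esub>}"
      then obtain u where u: "u \<in> cocycles M (n + 1)" "y = coh_class M (n + 1) u" using classes by blast
      then have "a \<odot> u \<in> coboundaries M (n + 1)"
        using y coh_smult[OF a0 u(1)] coh_class_zero_iff[OF cocycles_closed(4)[OF a0 u(1)]] by simp
      then obtain v where v: "v \<in> mdeg M n" "a \<odot> u = mdiff M v" unfolding coboundaries_iff by auto
      have "mdiff M v \<in> carrier M" using d_deg[OF v(1)] mdeg_carrier by blast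
      then have "Cone_Pair u (\<ominus> v) \<in> cocycles K n"
        using u v mdeg_closed(3) d_minus[OF v(1)] by (simp add: cK M.r_neg)
      then show "y \<in> \<delta> ` carrier (cohomology K n)"
        using \<delta>(2) u(2) K.coh_class_closed by (intro image_eqI[of _ _ "coh_class K n (Cone_Pair u (\<ominus> v))"]) auto
    qed
  qed
qed

end

section \<open>Quasi-isomorphisms\<close>

text \<open>The two complexes may live over different DG-rings, with scalars compared along \<open>\<phi>\<close>: this serves
  to compare \<open>A\<close> with its localizations. The last two conditions say that \<open>f\<close> is injective and
  surjective on cohomology.\<close>

definition quasi_iso :: "('a, 'b) dg_ring_scheme \<Rightarrow> ('a \<Rightarrow> 'c) \<Rightarrow>
    ('a, 'm, 'd) dg_module_scheme \<Rightarrow> ('c, 'n, 'e) dg_module_scheme \<Rightarrow> ('m \<Rightarrow> 'n) \<Rightarrow> bool" where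
  "quasi_iso A \<phi> M N f \<longleftrightarrow>
     (\<forall>n. \<forall>x\<in>mdeg M n. f x \<in> mdeg N n \<and> (\<forall>y\<in>mdeg M n. f (x \<oplus>\<^bsub>M\<^esub> y) = f x \<oplus>\<^bsub>N\<^esub> f y) \<and>
        (\<forall>b\<in>deg A 0. f (b \<odot>\<^bsub>M\<^esub> x) = \<phi> b \<odot>\<^bsub>N\<^esub> f x) \<and> f (mdiff M x) = mdiff N (f x)) \<and>
     (\<forall>n. \<forall>z\<in>cocycles M n. f z \<in> coboundaries N n \<longrightarrow> z \<in> coboundaries M n) \<and>
     (\<forall>n. \<forall>w\<in>cocycles N n. \<exists>z\<in>cocycles M n. \<exists>b\<in>coboundaries N n. w = f z \<oplus>\<^bsub>N\<^esub> b)"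

lemma quasi_isoD:
  assumes "quasi_iso A \<phi> M N f"
  shows "x \<in> mdeg M n \<Longrightarrow> f x \<in> mdeg N n"
    "x \<in> mdeg M n \<Longrightarrow> y \<in> mdeg M n \<Longrightarrow> f (x \<oplus>\<^bsub>M\<^esub> y) = f x \<oplus>\<^bsub>N\<^esub> f y"
    "x \<in> mdeg M n \<Longrightarrow> b \<in> deg A 0 \<Longrightarrow> f (b \<odot>\<^bsub>M\<^esub> x) = \<phi> b \<odot>\<^bsub>N\<^esub> f x"
    "x \<in> mdeg M n \<Longrightarrow> f (mdiff M x) = mdiff N (f x)"
    "z \<in> cocycles M n \<Longrightarrow> f z \<in> coboundaries N n \<Longrightarrow> z \<in> coboundaries M n"
    "w \<in> cocycles N n \<Longrightarrow> \<exists>z\<in>cocycles M n. \<exists>b\<in>coboundaries N n. w = f z \<oplus>\<^bsub>N\<^esub> b"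
  using assms unfolding quasi_iso_def by blast+

lemma quasi_iso_basic:
  assumes M: "dg_complex A M" and N: "dg_complex A' N" and f: "quasi_iso A \<phi> M N f"
  shows "f \<zero>\<^bsub>M\<^esub> = \<zero>\<^bsub>N\<^esub>" "x \<in> mdeg M n \<Longrightarrow> f (\<ominus>\<^bsub>M\<^esub> x) = \<ominus>\<^bsub>N\<^esub> f x"
    "z \<in> cocycles M n \<Longrightarrow> f z \<in> cocycles N n"
    "z \<in> coboundaries M n \<Longrightarrow> f z \<in> coboundaries N n"
    "z \<in> cocycles M n \<Longrightarrow> f z \<in> coboundaries N n \<longleftrightarrow> z \<in> coboundaries M n"
proof -
  interpret M: dg_complex A M by fact
  interpret N: dg_complex A' N by fact
  note fD = quasi_isoD[OF f]
  have "f \<zero>\<^bsub>M\<^esub> \<oplus>\<^bsub>N\<^esub> f \<zero>\<^bsub>M\<^esub> = f \<zero>\<^bsub>M\<^esub>" using fD(2)[OF M.mdeg_closed(1) M.mdeg_closed(1)] by simp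
  then show f0: "f \<zero>\<^bsub>M\<^esub> = \<zero>\<^bsub>N\<^esub>"
    using N.mdeg_carrier[OF fD(1)[OF M.mdeg_closed(1)]] by (metis N.M.add.r_cancel_one')
  show "f (\<ominus>\<^bsub>M\<^esub> x) = \<ominus>\<^bsub>N\<^esub> f x" if x: "x \<in> mdeg M n" for x n
  proof -
    have "f (\<ominus>\<^bsub>M\<^esub> x) \<oplus>\<^bsub>N\<^esub> f x = \<zero>\<^bsub>N\<^esub>"
      using fD(2)[OF M.mdeg_closed(3)[OF x] x] f0 M.mdeg_carrier[OF x] by (simp add: M.M.l_neg)
    then show ?thesis
      using N.mdeg_carrier[OF fD(1)[OF x]] N.mdeg_carrier[OF fD(1)[OF M.mdeg_closed(3)[OF x]]]
      by (metis N.M.minus_equality)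
  qed
  show cc: "f z \<in> cocycles N n" if "z \<in> cocycles M n" for z n
    using M.cocycles_mdeg[OF that] fD(1,4) f0 by (metis N.cocyclesI)
  show bb: "f z \<in> coboundaries N n" if "z \<in> coboundaries M n" for z n
    using that fD(1,4) unfolding M.coboundaries_iff by (metis N.coboundariesI)
  show "f z \<in> coboundaries N n \<longleftrightarrow> z \<in> coboundaries M n" if "z \<in> cocycles M n" for z n
    using bb fD(5)[OF that] by blast
qed

lemma quasi_iso_isomorphism:
  assumes M: "dg_complex A M" and N: "dg_complex A' N"
    and f: "\<And>n x. x \<in> mdeg M n \<Longrightarrow> f x \<in> mdeg N n"
    and add: "\<And>n x y. x \<in> mdeg M n \<Longrightarrow> y \<in> mdeg M n \<Longrightarrow> f (x \<oplus>\<^bsub>M\<^esub> y) = f x \<oplus>\<^bsub>N\<^esub> f y"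
    and smult: "\<And>n x b. x \<in> mdeg M n \<Longrightarrow> b \<in> deg A 0 \<Longrightarrow> f (b \<odot>\<^bsub>M\<^esub> x) = \<phi> b \<odot>\<^bsub>N\<^esub> f x"
    and d: "\<And>n x. x \<in> mdeg M n \<Longrightarrow> f (mdiff M x) = mdiff N (f x)"
    and g: "\<And>n y. y \<in> mdeg N n \<Longrightarrow> g y \<in> mdeg M n \<and> f (g y) = y"
    and gf: "\<And>n x. x \<in> mdeg M n \<Longrightarrow> g (f x) = x"
  shows "quasi_iso A \<phi> M N f"
proof -
  interpret M: dg_complex A M by fact
  interpret N: dg_complex A' N by fact
  have dg: "mdiff M (g y) = g (mdiff N y)" if "y \<in> mdeg N n" for y n
    using d[of "g y" n] g[OF that] gf[OF M.d_deg[of "g y" n]] by metis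
  have g0: "g \<zero>\<^bsub>N\<^esub> = \<zero>\<^bsub>M\<^esub>"
  proof -
    have "f \<zero>\<^bsub>M\<^esub> \<oplus>\<^bsub>N\<^esub> f \<zero>\<^bsub>M\<^esub> = f \<zero>\<^bsub>M\<^esub>" using add[OF M.mdeg_closed(1) M.mdeg_closed(1)] by simp
    then have "f \<zero>\<^bsub>M\<^esub> = \<zero>\<^bsub>N\<^esub>"
      using N.mdeg_carrier[OF f[OF M.mdeg_closed(1)]] by (metis N.M.add.r_cancel_one')
    then show ?thesis using gf[OF M.mdeg_closed(1)] by simp
  qed
  have "z \<in> coboundaries M n" if z: "z \<in> cocycles M n" "f z \<in> coboundaries N n" for z n
  proof -
    obtain w where w: "w \<in> mdeg N (n - 1)" "f z = mdiff N w" using z(2) unfolding N.coboundaries_iff by blast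
    have "z = mdiff M (g w)" using dg[OF w(1)] w(2) gf[OF M.cocycles_mdeg(1)[OF z(1)]] by simp
    then show ?thesis using M.coboundariesI g[OF w(1)] by simp
  qed
  moreover have "\<exists>z\<in>cocycles M n. \<exists>b\<in>coboundaries N n. w = f z \<oplus>\<^bsub>N\<^esub> b" if w: "w \<in> cocycles N n" for w n
  proof (intro bexI)
    note wd = N.cocycles_mdeg[OF w]
    show "w = f (g w) \<oplus>\<^bsub>N\<^esub> \<zero>\<^bsub>N\<^esub>" using g[OF wd(1)] wd by simp
    show "\<zero>\<^bsub>N\<^esub> \<in> coboundaries N n" by (rule N.coboundaries_closed(1))
    show "g w \<in> cocycles M n" using g[OF wd(1)] dg[OF wd(1)] wd(2) g0 by (intro M.cocyclesI) auto
  qed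
  ultimately show ?thesis unfolding quasi_iso_def using f add smult d by blast
qed

lemma quasi_iso_comp:
  assumes M: "dg_complex A M" and N: "dg_complex A' N" and L: "dg_complex A'' L"
    and f: "quasi_iso A \<phi> M N f" and g: "quasi_iso A' \<psi> N L g"
    and \<phi>: "\<And>b. b \<in> deg A 0 \<Longrightarrow> \<phi> b \<in> deg A' 0"
  shows "quasi_iso A (\<psi> \<circ> \<phi>) M L (g \<circ> f)"
proof -
  interpret M: dg_complex A M by fact
  interpret N: dg_complex A' N by fact
  interpret L: dg_complex A'' L by fact
  note fD = quasi_isoD[OF f] and gD = quasi_isoD[OF g]
  note fb = quasi_iso_basic[OF M N f] and gb = quasi_iso_basic[OF N L g]
  have 1: "\<exists>z\<in>cocycles M n. \<exists>b\<in>coboundaries L n. w = g (f z) \<oplus>\<^bsub>L\<^esub> b" if w: "w \<in> cocycles L n" for w n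
  proof -
    obtain y b where y: "y \<in> cocycles N n" "b \<in> coboundaries L n" "w = g y \<oplus>\<^bsub>L\<^esub> b" using gD(6)[OF w] by blast
    obtain z c where z: "z \<in> cocycles M n" "c \<in> coboundaries N n" "y = f z \<oplus>\<^bsub>N\<^esub> c" using fD(6)[OF y(1)] by blast
    have c: "c \<in> cocycles N n" using z(2) N.coboundaries_cocycles by blast
    have "g y = g (f z) \<oplus>\<^bsub>L\<^esub> g c"
      using gD(2)[OF N.cocycles_mdeg(1)[OF fb(3)[OF z(1)]] N.cocycles_mdeg(1)[OF c]] z(3) by simp
    moreover have "g (f z) \<in> carrier L" "g c \<in> carrier L" "b \<in> carrier L"
      using gb(3) fb(3) z(1) c y(2) L.coboundaries_cocycles L.cocycles_mdeg(3) by blast+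
    ultimately have "w = g (f z) \<oplus>\<^bsub>L\<^esub> (g c \<oplus>\<^bsub>L\<^esub> b)" using y(3) by (simp add: L.M.a_assoc)
    moreover have "g c \<oplus>\<^bsub>L\<^esub> b \<in> coboundaries L n" using L.coboundaries_closed(2) gb(4)[OF z(2)] y(2) by blast
    ultimately show ?thesis using z(1) by blast
  qed
  have 2: "z \<in> coboundaries M n" if "z \<in> cocycles M n" "g (f z) \<in> coboundaries L n" for z n
    using that fD(5) gD(5) fb(3) by blast
  have 3: "g (f x) \<in> mdeg L n" "g (f (mdiff M x)) = mdiff L (g (f x))"
    "y \<in> mdeg M n \<Longrightarrow> g (f (x \<oplus>\<^bsub>M\<^esub> y)) = g (f x) \<oplus>\<^bsub>L\<^esub> g (f y)"
    "b \<in> deg A 0 \<Longrightarrow> g (f (b \<odot>\<^bsub>M\<^esub> x)) = \<psi> (\<phi> b) \<odot>\<^bsub>L\<^esub> g (f x)" if x: "x \<in> mdeg M n" for x y b n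
    using fD(4)[OF x] gD(4)[OF fD(1)[OF x]] gD(1)[OF fD(1)[OF x]] fD(2)[OF x] gD(2)[OF fD(1)[OF x] fD(1)]
      fD(3)[OF x] gD(3)[OF fD(1)[OF x] \<phi>] by auto
  show ?thesis unfolding quasi_iso_def o_def using 1 2 3 by blast
qed

text \<open>The five lemma for the long exact sequences of the two cones, carried out on cocycles.\<close>

lemma quasi_iso_cone:
  assumes M: "dg_complex A M" and N: "dg_complex A' N" and f: "quasi_iso A \<phi> M N f"
    and \<phi>: "\<And>b. b \<in> deg A 0 \<Longrightarrow> \<phi> b \<in> deg A' 0" and a: "a \<in> deg A 0"
  shows "quasi_iso A \<phi> (mult_cone A M a) (mult_cone A' N (\<phi> a)) (\<lambda>p. Cone_Pair (f (pfst p)) (f (psnd p)))"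
proof -
  interpret M: dg_complex A M by fact
  interpret N: dg_complex A' N by fact
  define K where "K = mult_cone A M a"
  define L where "L = mult_cone A' N (\<phi> a)"
  have KL: "koszul_cone A M a" "koszul_cone A' N (\<phi> a)"
    using M N a \<phi>[OF a] by (simp_all add: koszul_cone_def koszul_cone_axioms_def)
  interpret K: koszul_cone A M a K unfolding K_def using KL(1) by simp
  interpret L: koszul_cone A' N "\<phi> a" L unfolding L_def using KL(2) by simp
  interpret KK: dg_complex A K by (rule K.cone_dg_complex)
  interpret LL: dg_complex A' L by (rule L.cone_dg_complex)
  note fD = quasi_isoD[OF f]
  note fb = quasi_iso_basic[OF M N f]
  let ?a' = "\<phi> a"
  have a': "?a' \<in> deg A' 0" by (rule \<phi>[OF a])
  let ?F = "\<lambda>p. Cone_Pair (f (pfst p)) (f (psnd p))"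
  have chain: "?F p \<in> mdeg L n \<and> (\<forall>q\<in>mdeg K n. ?F (p \<oplus>\<^bsub>K\<^esub> q) = ?F p \<oplus>\<^bsub>L\<^esub> ?F q) \<and>
    (\<forall>b\<in>deg A 0. ?F (b \<odot>\<^bsub>K\<^esub> p) = \<phi> b \<odot>\<^bsub>L\<^esub> ?F p) \<and> ?F (mdiff K p) = mdiff L (?F p)"
    if pK: "p \<in> mdeg K n" for n p
  proof -
    obtain x y where p: "p = Cone_Pair x y" "x \<in> mdeg M (n + 1)" "y \<in> mdeg M n" using K.cone_cases(2)[OF pK] by blast
    have "f (a \<odot>\<^bsub>M\<^esub> x \<oplus>\<^bsub>M\<^esub> mdiff M y) = ?a' \<odot>\<^bsub>N\<^esub> f x \<oplus>\<^bsub>N\<^esub> mdiff N (f y)"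
      using fD(2)[OF M.mdeg_closed(4)[OF a p(2)] M.d_deg[OF p(3)]] fD(3)[OF p(2) a] fD(4)[OF p(3)] by simp
    moreover have "f (\<ominus>\<^bsub>M\<^esub> mdiff M x) = \<ominus>\<^bsub>N\<^esub> mdiff N (f x)" using fb(2)[OF M.d_deg[OF p(2)]] fD(4)[OF p(2)] by simp
    moreover have "?F (p \<oplus>\<^bsub>K\<^esub> q) = ?F p \<oplus>\<^bsub>L\<^esub> ?F q" if q: "q \<in> mdeg K n" for q
      using K.cone_cases(2)[OF q] p fD(2) by (auto simp: K.cone_simps L.cone_simps)
    ultimately show ?thesis using p fD(1,3) \<phi> by (auto simp: K.cone_simps L.cone_simps)
  qed
  have inj: "z \<in> coboundaries K n" if z: "z \<in> cocycles K n" "?F z \<in> coboundaries L n" for z n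
  proof -
    obtain u v where uv: "z = Cone_Pair u v" "u \<in> mdeg M (n + 1)" "v \<in> mdeg M n"
      using K.cone_cases(2)[OF KK.cocycles_mdeg(1)[OF z(1)]] by blast
    obtain p' q' where pq: "p' \<in> mdeg N n" "q' \<in> mdeg N (n - 1)"
      "Cone_Pair (f u) (f v) = mdiff L (Cone_Pair p' q')"
    proof -
      obtain w where w: "w \<in> mdeg L (n - 1)" "?F z = mdiff L w" using z(2) unfolding LL.coboundaries_iff by blast
      obtain p' q' where "w = Cone_Pair p' q'" "p' \<in> mdeg N n" "q' \<in> mdeg N (n - 1)"
        using L.cone_cases(2)[OF w(1)] by auto
      then show ?thesis using w(2) uv(1) by (intro that[of p' q']) simp_all
    qed
    have fu: "f u = \<ominus>\<^bsub>N\<^esub> mdiff N p'" and fv: "f v = ?a' \<odot>\<^bsub>N\<^esub> p' \<oplus>\<^bsub>N\<^esub> mdiff N q'"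
      using pq(3) by (simp_all add: L.cone_simps)
    have du: "mdiff M u = \<zero>\<^bsub>M\<^esub>" and auv: "a \<odot>\<^bsub>M\<^esub> u \<oplus>\<^bsub>M\<^esub> mdiff M v = \<zero>\<^bsub>M\<^esub>"
    proof -
      have 0: "\<ominus>\<^bsub>M\<^esub> mdiff M u = \<zero>\<^bsub>M\<^esub>" "a \<odot>\<^bsub>M\<^esub> u \<oplus>\<^bsub>M\<^esub> mdiff M v = \<zero>\<^bsub>M\<^esub>"
        using KK.cocycles_mdeg(2)[OF z(1)] uv(1) by (auto simp: K.cone_simps)
      then show "a \<odot>\<^bsub>M\<^esub> u \<oplus>\<^bsub>M\<^esub> mdiff M v = \<zero>\<^bsub>M\<^esub>" by simp
      show "mdiff M u = \<zero>\<^bsub>M\<^esub>"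
        using 0(1) M.M.a_neg_zero M.M.minus_minus[OF M.mdeg_carrier[OF M.d_deg[OF uv(2)]]] by metis
    qed
    have uc: "u \<in> cocycles M (n + 1)" using uv du M.cocyclesI by blast
    have "f u \<in> coboundaries N (n + 1)"
      unfolding fu using N.coboundaries_closed(3)[OF N.coboundariesI[of p' "n + 1"]] pq(1) by simp
    then have "u \<in> coboundaries M (n + 1)" by (rule fD(5)[OF uc])
    then obtain p where p: "p \<in> mdeg M n" "u = mdiff M p" unfolding M.coboundaries_iff by auto
    have dp: "mdiff M p \<in> mdeg M (n + 1)" and ap: "a \<odot>\<^bsub>M\<^esub> p \<in> mdeg M n"
      using M.d_deg[OF p(1)] M.mdeg_closed(4)[OF a p(1)] .
    have fp: "f p \<in> mdeg N n" by (rule fD(1)[OF p(1)])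
    have Nc: "mdiff N p' \<in> carrier N" "p' \<in> carrier N" "f p \<in> carrier N" "mdiff N q' \<in> carrier N"
      using N.d_deg[OF pq(1)] N.d_deg[OF pq(2)] pq fp N.mdeg_carrier by blast+
    have "mdiff N (p' \<oplus>\<^bsub>N\<^esub> f p) = mdiff N p' \<oplus>\<^bsub>N\<^esub> f u" using N.d_add[OF pq(1) fp] fD(4)[OF p(1)] p(2) by simp
    also have "\<dots> = \<zero>\<^bsub>N\<^esub>" unfolding fu using Nc by (simp add: N.M.r_neg)
    finally have "p' \<oplus>\<^bsub>N\<^esub> f p \<in> cocycles N n" using N.mdeg_closed(2)[OF pq(1) fp] N.cocyclesI by blast
    then obtain s b where s: "s \<in> cocycles M n" "b \<in> coboundaries N n" "p' \<oplus>\<^bsub>N\<^esub> f p = f s \<oplus>\<^bsub>N\<^esub> b"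
      using fD(6) by blast
    obtain r where r: "r \<in> mdeg N (n - 1)" "b = mdiff N r" using s(2) unfolding N.coboundaries_iff by blast
    have sm: "s \<in> mdeg M n" "mdiff M s = \<zero>\<^bsub>M\<^esub>" using M.cocycles_mdeg[OF s(1)] by auto
    have as: "a \<odot>\<^bsub>M\<^esub> s \<in> mdeg M n" by (rule M.mdeg_closed(4)[OF a sm(1)])
    \<comment> \<open>Subtracting the boundary of \<open>(s - p, 0)\<close> moves \<open>z\<close> into the summand \<open>M\<close>.\<close>
    let ?t = "v \<oplus>\<^bsub>M\<^esub> (a \<odot>\<^bsub>M\<^esub> p \<oplus>\<^bsub>M\<^esub> \<ominus>\<^bsub>M\<^esub> (a \<odot>\<^bsub>M\<^esub> s))"
    have td: "a \<odot>\<^bsub>M\<^esub> p \<oplus>\<^bsub>M\<^esub> \<ominus>\<^bsub>M\<^esub> (a \<odot>\<^bsub>M\<^esub> s) \<in> mdeg M n"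
      using M.mdeg_closed(2)[OF ap M.mdeg_closed(3)[OF as]] .
    have Mc: "u \<in> carrier M" "v \<in> carrier M" "p \<in> carrier M" "s \<in> carrier M" "a \<odot>\<^bsub>M\<^esub> p \<in> carrier M"
      "a \<odot>\<^bsub>M\<^esub> s \<in> carrier M" "mdiff M v \<in> carrier M" "a \<odot>\<^bsub>M\<^esub> u \<in> carrier M" "mdiff M p \<in> carrier M"
      using uv p sm ap as M.d_deg[OF uv(3)] M.mdeg_closed(4)[OF a uv(2)] dp M.mdeg_carrier by blast+
    have tm: "?t \<in> mdeg M n" by (rule M.mdeg_closed(2)[OF uv(3) td])
    have "mdiff M (a \<odot>\<^bsub>M\<^esub> p \<oplus>\<^bsub>M\<^esub> \<ominus>\<^bsub>M\<^esub> (a \<odot>\<^bsub>M\<^esub> s)) = a \<odot>\<^bsub>M\<^esub> u"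
      using M.d_add[OF ap M.mdeg_closed(3)[OF as]] M.d_minus[OF as] M.d_smult[OF a p(1)] M.d_smult[OF a sm(1)]
        sm(2) M.M.smult_r_null[of a] a M.M.a_neg_zero Mc p(2) by simp
    then have "mdiff M ?t = \<zero>\<^bsub>M\<^esub>"
      using M.d_add[OF uv(3) td] auv Mc by (simp add: M.M.a_comm)
    then have tc: "?t \<in> cocycles M n" using tm M.cocyclesI by blast
    have ar: "?a' \<odot>\<^bsub>N\<^esub> r \<in> mdeg N (n - 1)" using N.mdeg_closed(4)[OF a' r(1)] .
    have fs: "f s \<in> carrier N" using fD(1)[OF sm(1)] N.mdeg_carrier by blast
    have rc: "mdiff N r \<in> carrier N" "?a' \<odot>\<^bsub>N\<^esub> f s \<in> carrier N" "?a' \<odot>\<^bsub>N\<^esub> mdiff N r \<in> carrier N"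
      "?a' \<odot>\<^bsub>N\<^esub> f p \<in> carrier N" "?a' \<odot>\<^bsub>N\<^esub> p' \<in> carrier N"
      using N.mdeg_carrier[OF N.d_deg[OF r(1)]] L.smult_carrier[OF a'] fs Nc by blast+
    have "f ?t = f v \<oplus>\<^bsub>N\<^esub> (?a' \<odot>\<^bsub>N\<^esub> f p \<oplus>\<^bsub>N\<^esub> \<ominus>\<^bsub>N\<^esub> (?a' \<odot>\<^bsub>N\<^esub> f s))"
      using fD(2)[OF uv(3) td] fD(2)[OF ap M.mdeg_closed(3)[OF as]] fb(2)[OF as] fD(3)[OF p(1) a] fD(3)[OF sm(1) a] by simp
    also have "\<dots> = (?a' \<odot>\<^bsub>N\<^esub> p' \<oplus>\<^bsub>N\<^esub> ?a' \<odot>\<^bsub>N\<^esub> f p) \<oplus>\<^bsub>N\<^esub> \<ominus>\<^bsub>N\<^esub> (?a' \<odot>\<^bsub>N\<^esub> f s) \<oplus>\<^bsub>N\<^esub> mdiff N q'"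
      unfolding fv using rc Nc by algebra
    also have "?a' \<odot>\<^bsub>N\<^esub> p' \<oplus>\<^bsub>N\<^esub> ?a' \<odot>\<^bsub>N\<^esub> f p = ?a' \<odot>\<^bsub>N\<^esub> f s \<oplus>\<^bsub>N\<^esub> ?a' \<odot>\<^bsub>N\<^esub> mdiff N r"
      using N.M.smult_r_distr[of ?a' p' "f p"] N.M.smult_r_distr[of ?a' "f s" "mdiff N r"] s(3) r(2) a' Nc fs rc by simp
    also have "(?a' \<odot>\<^bsub>N\<^esub> f s \<oplus>\<^bsub>N\<^esub> ?a' \<odot>\<^bsub>N\<^esub> mdiff N r) \<oplus>\<^bsub>N\<^esub> \<ominus>\<^bsub>N\<^esub> (?a' \<odot>\<^bsub>N\<^esub> f s) \<oplus>\<^bsub>N\<^esub> mdiff N q'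
      = ?a' \<odot>\<^bsub>N\<^esub> mdiff N r \<oplus>\<^bsub>N\<^esub> mdiff N q'" using rc Nc by algebra
    also have "\<dots> = mdiff N (?a' \<odot>\<^bsub>N\<^esub> r \<oplus>\<^bsub>N\<^esub> q')"
      using N.d_add[OF ar pq(2)] N.d_smult[OF a' r(1)] by simp
    finally have "f ?t \<in> coboundaries N n"
      using N.coboundariesI[OF N.mdeg_closed(2)[OF ar pq(2)]] by simp
    then have "?t \<in> coboundaries M n" by (rule fD(5)[OF tc])
    then obtain w where w: "w \<in> mdeg M (n - 1)" "?t = mdiff M w" unfolding M.coboundaries_iff by blast
    have ps: "s \<oplus>\<^bsub>M\<^esub> \<ominus>\<^bsub>M\<^esub> p \<in> mdeg M n" by (rule M.mdeg_closed(2)[OF sm(1) M.mdeg_closed(3)[OF p(1)]])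
    have "mdiff M (s \<oplus>\<^bsub>M\<^esub> \<ominus>\<^bsub>M\<^esub> p) = \<ominus>\<^bsub>M\<^esub> u"
      using M.d_add[OF sm(1) M.mdeg_closed(3)[OF p(1)]] M.d_minus[OF p(1)] sm(2) p(2) Mc by simp
    moreover have "a \<odot>\<^bsub>M\<^esub> (s \<oplus>\<^bsub>M\<^esub> \<ominus>\<^bsub>M\<^esub> p) = a \<odot>\<^bsub>M\<^esub> s \<oplus>\<^bsub>M\<^esub> \<ominus>\<^bsub>M\<^esub> (a \<odot>\<^bsub>M\<^esub> p)"
      using M.M.smult_r_distr[of a s "\<ominus>\<^bsub>M\<^esub> p"] M.M.smult_r_minus[of a p] a Mc by simp
    moreover have "(a \<odot>\<^bsub>M\<^esub> s \<oplus>\<^bsub>M\<^esub> \<ominus>\<^bsub>M\<^esub> (a \<odot>\<^bsub>M\<^esub> p)) \<oplus>\<^bsub>M\<^esub> ?t = v" using Mc by algebra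
    ultimately have "z = mdiff K (Cone_Pair (s \<oplus>\<^bsub>M\<^esub> \<ominus>\<^bsub>M\<^esub> p) w)"
      using w Mc uv(1) by (simp add: K.cone_simps M.M.minus_minus)
    then show ?thesis using ps w(1) KK.coboundariesI[of "Cone_Pair (s \<oplus>\<^bsub>M\<^esub> \<ominus>\<^bsub>M\<^esub> p) w" n] by (simp add: K.cone_simps)
  qed
  have surj: "\<exists>z\<in>cocycles K n. \<exists>b\<in>coboundaries L n. w = ?F z \<oplus>\<^bsub>L\<^esub> b" if w: "w \<in> cocycles L n" for w n
  proof -
    obtain u' v' where uv: "w = Cone_Pair u' v'" "u' \<in> mdeg N (n + 1)" "v' \<in> mdeg N n"
      using L.cone_cases(2)[OF LL.cocycles_mdeg(1)[OF w]] by blast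
    have 0: "\<ominus>\<^bsub>N\<^esub> mdiff N u' = \<zero>\<^bsub>N\<^esub>" "?a' \<odot>\<^bsub>N\<^esub> u' \<oplus>\<^bsub>N\<^esub> mdiff N v' = \<zero>\<^bsub>N\<^esub>"
      using LL.cocycles_mdeg(2)[OF w] uv(1) by (auto simp: L.cone_simps)
    have "mdiff N u' = \<zero>\<^bsub>N\<^esub>"
      using 0(1) N.M.a_neg_zero N.M.minus_minus[OF N.mdeg_carrier[OF N.d_deg[OF uv(2)]]] by metis
    then have "u' \<in> cocycles N (n + 1)" using uv N.cocyclesI by blast
    then obtain u b where u: "u \<in> cocycles M (n + 1)" "b \<in> coboundaries N (n + 1)" "u' = f u \<oplus>\<^bsub>N\<^esub> b"
      using fD(6) by blast
    obtain r where r: "r \<in> mdeg N n" "b = mdiff N r" using u(2) unfolding N.coboundaries_iff by auto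
    note um = M.cocycles_mdeg[OF u(1)]
    have ar: "?a' \<odot>\<^bsub>N\<^esub> r \<in> mdeg N n" by (rule N.mdeg_closed(4)[OF a' r(1)])
    have fu: "f u \<in> mdeg N (n + 1)" by (rule fD(1)[OF um(1)])
    have Nc: "f u \<in> carrier N" "mdiff N r \<in> carrier N" "v' \<in> carrier N" "mdiff N v' \<in> carrier N" "?a' \<odot>\<^bsub>N\<^esub> r \<in> carrier N"
      "r \<in> carrier N"
      using fu N.d_deg[OF r(1)] N.d_deg[OF uv(3)] uv r ar N.mdeg_carrier by blast+
    have Nc': "?a' \<odot>\<^bsub>N\<^esub> f u \<in> carrier N" "?a' \<odot>\<^bsub>N\<^esub> mdiff N r \<in> carrier N"
      using L.smult_carrier[OF a'] Nc by blast+
    have eq0: "(?a' \<odot>\<^bsub>N\<^esub> f u \<oplus>\<^bsub>N\<^esub> ?a' \<odot>\<^bsub>N\<^esub> mdiff N r) \<oplus>\<^bsub>N\<^esub> mdiff N v' = \<zero>\<^bsub>N\<^esub>"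
      using 0(2) N.M.smult_r_distr[of ?a' "f u" "mdiff N r"] u(3) r(2) a' Nc by simp
    have vr: "v' \<oplus>\<^bsub>N\<^esub> ?a' \<odot>\<^bsub>N\<^esub> r \<in> mdeg N n" by (rule N.mdeg_closed(2)[OF uv(3) ar])
    have dvr: "mdiff N (v' \<oplus>\<^bsub>N\<^esub> ?a' \<odot>\<^bsub>N\<^esub> r) = mdiff N v' \<oplus>\<^bsub>N\<^esub> ?a' \<odot>\<^bsub>N\<^esub> mdiff N r"
      using N.d_add[OF uv(3) ar] N.d_smult[OF a' r(1)] by simp
    have au: "f (a \<odot>\<^bsub>M\<^esub> u) = \<ominus>\<^bsub>N\<^esub> mdiff N (v' \<oplus>\<^bsub>N\<^esub> ?a' \<odot>\<^bsub>N\<^esub> r)"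
    proof -
      have "?a' \<odot>\<^bsub>N\<^esub> f u \<oplus>\<^bsub>N\<^esub> (mdiff N v' \<oplus>\<^bsub>N\<^esub> ?a' \<odot>\<^bsub>N\<^esub> mdiff N r) = \<zero>\<^bsub>N\<^esub>"
        using eq0 Nc Nc' by (simp add: N.M.a_ac)
      then show ?thesis
        using fD(3)[OF um(1) a] dvr N.M.eq_minus_iff[of "?a' \<odot>\<^bsub>N\<^esub> f u"] Nc Nc' by simp
    qed
    have "f (a \<odot>\<^bsub>M\<^esub> u) \<in> coboundaries N (n + 1)"
      unfolding au using N.coboundaries_closed(3)[OF N.coboundariesI[of _ "n + 1"]] vr by simp
    then have "a \<odot>\<^bsub>M\<^esub> u \<in> coboundaries M (n + 1)" by (rule fD(5)[OF M.cocycles_closed(4)[OF a u(1)]])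
    then obtain x where x: "x \<in> mdeg M n" "a \<odot>\<^bsub>M\<^esub> u = mdiff M x" unfolding M.coboundaries_iff by auto
    have fx: "f x \<in> mdeg N n" by (rule fD(1)[OF x(1)])
    \<comment> \<open>Subtracting \<open>F (u, -x)\<close> and the boundary of \<open>(-r, 0)\<close> from \<open>w\<close> leaves \<open>(0, t)\<close>.\<close>
    let ?t = "(v' \<oplus>\<^bsub>N\<^esub> ?a' \<odot>\<^bsub>N\<^esub> r) \<oplus>\<^bsub>N\<^esub> f x"
    have "mdiff N ?t = mdiff N (v' \<oplus>\<^bsub>N\<^esub> ?a' \<odot>\<^bsub>N\<^esub> r) \<oplus>\<^bsub>N\<^esub> f (a \<odot>\<^bsub>M\<^esub> u)"
      using N.d_add[OF vr fx] fD(4)[OF x(1)] x(2) by simp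
    also have "\<dots> = \<zero>\<^bsub>N\<^esub>" unfolding au using N.mdeg_carrier[OF N.d_deg[OF vr]] by (simp add: N.M.r_neg)
    finally have "?t \<in> cocycles N n" using N.mdeg_closed(2)[OF vr fx] N.cocyclesI by blast
    then obtain s c where s: "s \<in> cocycles M n" "c \<in> coboundaries N n" "?t = f s \<oplus>\<^bsub>N\<^esub> c" using fD(6) by blast
    obtain q where q: "q \<in> mdeg N (n - 1)" "c = mdiff N q" using s(2) unfolding N.coboundaries_iff by blast
    note sm = M.cocycles_mdeg[OF s(1)]
    have xs: "s \<oplus>\<^bsub>M\<^esub> \<ominus>\<^bsub>M\<^esub> x \<in> mdeg M n" by (rule M.mdeg_closed(2)[OF sm(1) M.mdeg_closed(3)[OF x(1)]])
    have Mc: "mdiff M x \<in> carrier M" "x \<in> carrier M" "s \<in> carrier M"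
      using M.mdeg_carrier[OF M.d_deg[OF x(1)]] M.mdeg_carrier[OF x(1)] sm(3) by auto
    have Nd: "f x \<in> carrier N" "f s \<in> carrier N" "mdiff N q \<in> carrier N"
      using fx fD(1)[OF sm(1)] N.d_deg[OF q(1)] N.mdeg_carrier by blast+
    let ?z = "Cone_Pair u (s \<oplus>\<^bsub>M\<^esub> \<ominus>\<^bsub>M\<^esub> x)"
    have "mdiff M (s \<oplus>\<^bsub>M\<^esub> \<ominus>\<^bsub>M\<^esub> x) = \<ominus>\<^bsub>M\<^esub> (a \<odot>\<^bsub>M\<^esub> u)"
      using M.d_add[OF sm(1) M.mdeg_closed(3)[OF x(1)]] M.d_minus[OF x(1)] sm(2) x(2) Mc by simp
    then have zc: "?z \<in> cocycles K n"
      using um xs x(2) Mc M.M.a_neg_zero by (intro KK.cocyclesI) (auto simp: K.cone_simps M.M.r_neg)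
    have nr: "mdiff N (\<ominus>\<^bsub>N\<^esub> r) = \<ominus>\<^bsub>N\<^esub> mdiff N r" "?a' \<odot>\<^bsub>N\<^esub> (\<ominus>\<^bsub>N\<^esub> r) = \<ominus>\<^bsub>N\<^esub> (?a' \<odot>\<^bsub>N\<^esub> r)"
      using N.d_minus[OF r(1)] N.M.smult_r_minus[of ?a' r] a' Nc by auto
    have "v' = (f s \<oplus>\<^bsub>N\<^esub> \<ominus>\<^bsub>N\<^esub> f x) \<oplus>\<^bsub>N\<^esub> (\<ominus>\<^bsub>N\<^esub> (?a' \<odot>\<^bsub>N\<^esub> r) \<oplus>\<^bsub>N\<^esub> mdiff N q)"
    proof -
      have "v' = ?t \<oplus>\<^bsub>N\<^esub> (\<ominus>\<^bsub>N\<^esub> f x \<oplus>\<^bsub>N\<^esub> \<ominus>\<^bsub>N\<^esub> (?a' \<odot>\<^bsub>N\<^esub> r))" using Nc Nd by algebra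
      also have "\<dots> = (f s \<oplus>\<^bsub>N\<^esub> \<ominus>\<^bsub>N\<^esub> f x) \<oplus>\<^bsub>N\<^esub> (\<ominus>\<^bsub>N\<^esub> (?a' \<odot>\<^bsub>N\<^esub> r) \<oplus>\<^bsub>N\<^esub> mdiff N q)"
        unfolding s(3) q(2) using Nc Nd by algebra
      finally show ?thesis .
    qed
    moreover have "f (s \<oplus>\<^bsub>M\<^esub> \<ominus>\<^bsub>M\<^esub> x) = f s \<oplus>\<^bsub>N\<^esub> \<ominus>\<^bsub>N\<^esub> f x"
      using fD(2)[OF sm(1) M.mdeg_closed(3)[OF x(1)]] fb(2)[OF x(1)] by simp
    ultimately have "w = ?F ?z \<oplus>\<^bsub>L\<^esub> mdiff L (Cone_Pair (\<ominus>\<^bsub>N\<^esub> r) q)"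
      using uv(1) u(3) r(2) nr Nc by (simp add: L.cone_simps N.M.minus_minus)
    moreover have "mdiff L (Cone_Pair (\<ominus>\<^bsub>N\<^esub> r) q) \<in> coboundaries L n"
      using LL.coboundariesI[of "Cone_Pair (\<ominus>\<^bsub>N\<^esub> r) q" n] N.mdeg_closed(3)[OF r(1)] q(1) by (simp add: L.cone_simps)
    ultimately show ?thesis using zc by blast
  qed
  show ?thesis unfolding quasi_iso_def K_def[symmetric] L_def[symmetric]
    using chain inj surj by blast
qed

text \<open>Two representatives \<open>a, b\<close> of the same element of \<open>H\<^sup>0(A)\<close> have isomorphic cones: if \<open>h\<close> is a
  null-homotopy of \<open>a - b\<close>, then \<open>(u, v) \<mapsto> (u, v + h u)\<close> is an isomorphism.\<close>

lemma quasi_iso_change_scalar: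
  assumes M: "dg_complex A M" and ab: "a \<in> deg A 0" "b \<in> deg A 0" "proj0 A a = proj0 A b"
  shows "\<exists>F. quasi_iso A (\<lambda>c. c) (mult_cone A M a) (mult_cone A M b) F"
proof -
  interpret M: dg_complex A M by fact
  define K where "K = mult_cone A M a"
  define L where "L = mult_cone A M b"
  have KL: "koszul_cone A M a" "koszul_cone A M b"
    using M ab by (simp_all add: koszul_cone_def koszul_cone_axioms_def)
  interpret K: koszul_cone A M a K unfolding K_def using KL(1) by simp
  interpret L: koszul_cone A M b L unfolding L_def using KL(2) by simp
  define e where "e = a \<oplus>\<^bsub>A\<^esub> \<ominus>\<^bsub>A\<^esub> b"
  have e: "e \<in> boundaries0 A" using M.A.proj0_eq_iff[OF ab(1,2)] ab(3) by (simp add: e_def)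
  have e0: "e \<in> deg A 0" using M.A.deg_closed ab by (simp add: e_def)
  obtain h where h: "null_homotopy A M e h" using M.boundary_null_homotopic[OF e] by blast
  note hD = null_homotopyD[OF h]
  have ac: "a \<in> carrier A" "b \<in> carrier A" using ab M.A.deg_carrier by auto
  have "a = e \<oplus>\<^bsub>A\<^esub> b" using ac by (simp add: e_def M.A.a_assoc M.A.l_neg)
  then have au: "a \<odot>\<^bsub>M\<^esub> u = e \<odot>\<^bsub>M\<^esub> u \<oplus>\<^bsub>M\<^esub> b \<odot>\<^bsub>M\<^esub> u" if "u \<in> carrier M" for u
    using M.M.smult_l_distr[of e b u] e0 ab that by simp
  have hm: "h (\<ominus>\<^bsub>M\<^esub> x) = \<ominus>\<^bsub>M\<^esub> h x" if "x \<in> mdeg M n" for x n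
    using hD(3)[OF that M.neg_one(1)] M.neg_one(2) M.mdeg_carrier hD(1)[OF that] M.mdeg_carrier[OF that] by metis
  let ?F = "\<lambda>p. Cone_Pair (pfst p) (psnd p \<oplus>\<^bsub>M\<^esub> h (pfst p))"
  let ?G = "\<lambda>p. Cone_Pair (pfst p) (psnd p \<oplus>\<^bsub>M\<^esub> \<ominus>\<^bsub>M\<^esub> h (pfst p))"
  have hu: "h u \<in> mdeg M n" if "u \<in> mdeg M (n + 1)" for u n using hD(1)[OF that] by simp
  have "quasi_iso A (\<lambda>c. c) K L ?F"
  proof (rule quasi_iso_isomorphism[OF K.cone_dg_complex L.cone_dg_complex, where g = ?G])
    fix n p assume "p \<in> mdeg K n"
    then obtain u v where p: "p = Cone_Pair u v" "u \<in> mdeg M (n + 1)" "v \<in> mdeg M n" using K.cone_cases(2) by blast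
    note hu = hu[OF p(2)]
    have c: "u \<in> carrier M" "v \<in> carrier M" "h u \<in> carrier M" using p hu M.mdeg_carrier by blast+
    show "?F p \<in> mdeg L n" using p hu M.mdeg_closed(2) by (simp add: L.cone_simps)
    show "?G (?F p) = p" using p(1) c by (simp add: M.M.a_assoc M.M.r_neg)
    show "?F (t \<odot>\<^bsub>K\<^esub> p) = t \<odot>\<^bsub>L\<^esub> ?F p" if t: "t \<in> deg A 0" for t
      using p c t hD(3)[OF p(2) t] M.M.smult_r_distr[of t v "h u"] by (simp add: K.cone_simps L.cone_simps)
    show "?F (p \<oplus>\<^bsub>K\<^esub> q) = ?F p \<oplus>\<^bsub>L\<^esub> ?F q" if qK: "q \<in> mdeg K n" for q
    proof -
      obtain s t where q: "q = Cone_Pair s t" "s \<in> mdeg M (n + 1)" "t \<in> mdeg M n" using K.cone_cases(2)[OF qK] by blast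
      have "s \<in> carrier M" "t \<in> carrier M" "h s \<in> carrier M"
        using q hD(1)[OF q(2)] M.mdeg_carrier by blast+
      then show ?thesis using p(1) q(1) c hD(2)[OF p(2) q(2)] by (simp add: K.cone_simps L.cone_simps M.M.a_ac)
    qed
    show "?F (mdiff K p) = mdiff L (?F p)"
    proof -
      note du = M.d_deg[OF p(2)]
      have c': "mdiff M u \<in> carrier M" "mdiff M v \<in> carrier M" "mdiff M (h u) \<in> carrier M" "h (mdiff M u) \<in> carrier M"
        "b \<odot>\<^bsub>M\<^esub> u \<in> carrier M"
        using du M.d_deg[OF p(3)] M.d_deg[OF hu] hD(1)[OF du] K.smult_carrier[OF ab(2) c(1)] M.mdeg_carrier by blast+
      have "(a \<odot>\<^bsub>M\<^esub> u \<oplus>\<^bsub>M\<^esub> mdiff M v) \<oplus>\<^bsub>M\<^esub> h (\<ominus>\<^bsub>M\<^esub> mdiff M u) = b \<odot>\<^bsub>M\<^esub> u \<oplus>\<^bsub>M\<^esub> mdiff M (v \<oplus>\<^bsub>M\<^esub> h u)"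
        unfolding au[OF c(1)] hD(4)[OF p(2)] hm[OF du] M.d_add[OF p(3) hu] using c c' by algebra
      then show ?thesis using p(1) by (simp add: K.cone_simps L.cone_simps)
    qed
  next
    fix n p assume "p \<in> mdeg L n"
    then obtain u v where p: "p = Cone_Pair u v" "u \<in> mdeg M (n + 1)" "v \<in> mdeg M n" using L.cone_cases(2) by blast
    note hu = hu[OF p(2)]
    have c: "u \<in> carrier M" "v \<in> carrier M" "h u \<in> carrier M" using p hu M.mdeg_carrier by blast+
    show "?G p \<in> mdeg K n \<and> ?F (?G p) = p"
      using p c hu M.mdeg_closed(2,3) by (simp add: K.cone_simps M.M.a_assoc M.M.l_neg)
  qed
  then show ?thesis unfolding K_def L_def by blast
qed

text \<open>The Koszul complexes on \<open>a, b\<close> and on \<open>b, a\<close> are isomorphic by exchanging the two middle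
  summands of \<open>M[2] \<oplus> M[1] \<oplus> M[1] \<oplus> M\<close>; the sign on \<open>M[2]\<close> is that of exchanging two shifts.\<close>

definition swap_middle :: "('m cone_elt \<Rightarrow> 'm cone_elt) \<Rightarrow> 'm cone_elt \<Rightarrow> 'm cone_elt" where
  "swap_middle neg p = Cone_Pair (Cone_Pair (neg (pfst (pfst p))) (pfst (psnd p)))
     (Cone_Pair (psnd (pfst p)) (psnd (psnd p)))"

lemma quasi_iso_swap:
  assumes M: "dg_complex A M" and ab: "a \<in> deg A 0" "b \<in> deg A 0"
  shows "quasi_iso A (\<lambda>c. c) (mult_cone A (mult_cone A M a) b) (mult_cone A (mult_cone A M b) a)
    (swap_middle (\<lambda>x. \<ominus>\<^bsub>M\<^esub> x))"
proof -
  interpret M: dg_complex A M by fact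
  define K where "K = mult_cone A M a"
  define L where "L = mult_cone A M b"
  define Kb where "Kb = mult_cone A K b"
  define La where "La = mult_cone A L a"
  interpret K: koszul_cone A M a K unfolding K_def using M ab by (simp add: koszul_cone_def koszul_cone_axioms_def)
  interpret L: koszul_cone A M b L unfolding L_def using M ab by (simp add: koszul_cone_def koszul_cone_axioms_def)
  interpret Kb: koszul_cone A K b Kb unfolding Kb_def
    using K.cone_dg_complex ab by (simp add: koszul_cone_def koszul_cone_axioms_def)
  interpret La: koszul_cone A L a La unfolding La_def
    using L.cone_dg_complex ab by (simp add: koszul_cone_def koszul_cone_axioms_def)
  let ?F = "swap_middle (\<lambda>x. \<ominus>\<^bsub>M\<^esub> x)"
  have cases: "\<exists>x y z w. p = Cone_Pair (Cone_Pair x y) (Cone_Pair z w) \<and> x \<in> mdeg M (n + 1 + 1) \<and>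
    y \<in> mdeg M (n + 1) \<and> z \<in> mdeg M (n + 1) \<and> w \<in> mdeg M n" if "p \<in> mdeg Kb n" for p n
    using Kb.cone_cases(2)[OF that] K.cone_cases(2) by metis
  have cases': "\<exists>x y z w. p = Cone_Pair (Cone_Pair x y) (Cone_Pair z w) \<and> x \<in> mdeg M (n + 1 + 1) \<and>
    y \<in> mdeg M (n + 1) \<and> z \<in> mdeg M (n + 1) \<and> w \<in> mdeg M n" if "p \<in> mdeg La n" for p n
    using La.cone_cases(2)[OF that] L.cone_cases(2) by metis
  note simps = K.cone_simps L.cone_simps Kb.cone_simps La.cone_simps
  have "quasi_iso A (\<lambda>c. c) Kb La ?F"
  proof (rule quasi_iso_isomorphism[OF Kb.cone_dg_complex La.cone_dg_complex, where g = ?F])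
    fix n p assume "p \<in> mdeg Kb n"
    then obtain x y z w where p: "p = Cone_Pair (Cone_Pair x y) (Cone_Pair z w)" "x \<in> mdeg M (n + 1 + 1)"
      "y \<in> mdeg M (n + 1)" "z \<in> mdeg M (n + 1)" "w \<in> mdeg M n" using cases by blast
    have c: "x \<in> carrier M" "y \<in> carrier M" "z \<in> carrier M" "w \<in> carrier M" using p M.mdeg_carrier by blast+
    show "?F p \<in> mdeg La n" using p M.mdeg_closed(3) by (simp add: simps swap_middle_def)
    show "?F (?F p) = p" using p c by (simp add: swap_middle_def M.M.minus_minus)
    show "?F (t \<odot>\<^bsub>Kb\<^esub> p) = t \<odot>\<^bsub>La\<^esub> ?F p" if t: "t \<in> deg A 0" for t
      using p c t M.M.smult_r_minus[of t x] by (simp add: simps swap_middle_def)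
    show "?F (p \<oplus>\<^bsub>Kb\<^esub> q) = ?F p \<oplus>\<^bsub>La\<^esub> ?F q" if "q \<in> mdeg Kb n" for q
    proof -
      obtain x' y' z' w' where q: "q = Cone_Pair (Cone_Pair x' y') (Cone_Pair z' w')" "x' \<in> mdeg M (n + 1 + 1)"
        using cases \<open>q \<in> mdeg Kb n\<close> by blast
      then show ?thesis using p(1) c M.mdeg_carrier[OF q(2)] by (simp add: simps swap_middle_def M.M.minus_add)
    qed
    show "?F (mdiff Kb p) = mdiff La (?F p)"
    proof -
      have c': "mdiff M x \<in> carrier M" "mdiff M y \<in> carrier M" "mdiff M z \<in> carrier M" "mdiff M w \<in> carrier M"
        using M.d_deg[OF p(2)] M.d_deg[OF p(3)] M.d_deg[OF p(4)] M.d_deg[OF p(5)] M.mdeg_carrier by blast+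
      have sc: "a \<odot>\<^bsub>M\<^esub> x \<in> carrier M" "b \<odot>\<^bsub>M\<^esub> x \<in> carrier M" "b \<odot>\<^bsub>M\<^esub> y \<in> carrier M" "a \<odot>\<^bsub>M\<^esub> z \<in> carrier M"
        using K.smult_carrier ab c by blast+
      have neg: "mdiff M (\<ominus>\<^bsub>M\<^esub> x) = \<ominus>\<^bsub>M\<^esub> mdiff M x" "a \<odot>\<^bsub>M\<^esub> (\<ominus>\<^bsub>M\<^esub> x) = \<ominus>\<^bsub>M\<^esub> (a \<odot>\<^bsub>M\<^esub> x)"
        "b \<odot>\<^bsub>M\<^esub> (\<ominus>\<^bsub>M\<^esub> x) = \<ominus>\<^bsub>M\<^esub> (b \<odot>\<^bsub>M\<^esub> x)"
        using M.d_minus[OF p(2)] M.M.smult_r_minus[of a x] M.M.smult_r_minus[of b x] ab c by auto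
      have 1: "\<ominus>\<^bsub>K\<^esub> Cone_Pair (\<ominus>\<^bsub>M\<^esub> mdiff M x) (a \<odot>\<^bsub>M\<^esub> x \<oplus>\<^bsub>M\<^esub> mdiff M y) =
          Cone_Pair (mdiff M x) (\<ominus>\<^bsub>M\<^esub> (a \<odot>\<^bsub>M\<^esub> x) \<oplus>\<^bsub>M\<^esub> \<ominus>\<^bsub>M\<^esub> mdiff M y)"
        using K.cone_minus c' sc by (simp add: M.M.minus_minus M.M.minus_add)
      have 2: "\<ominus>\<^bsub>L\<^esub> Cone_Pair (mdiff M x) (\<ominus>\<^bsub>M\<^esub> (b \<odot>\<^bsub>M\<^esub> x) \<oplus>\<^bsub>M\<^esub> mdiff M z) =
          Cone_Pair (\<ominus>\<^bsub>M\<^esub> mdiff M x) (b \<odot>\<^bsub>M\<^esub> x \<oplus>\<^bsub>M\<^esub> \<ominus>\<^bsub>M\<^esub> mdiff M z)"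
        using L.cone_minus c' sc by (simp add: M.M.minus_minus M.M.minus_add)
      show ?thesis using p(1) c' sc ab 1 2
        by (simp add: simps swap_middle_def neg M.M.minus_minus M.M.a_ac)
    qed
  next
    fix n p assume "p \<in> mdeg La n"
    then obtain x y z w where p: "p = Cone_Pair (Cone_Pair x y) (Cone_Pair z w)" "x \<in> mdeg M (n + 1 + 1)"
      "y \<in> mdeg M (n + 1)" "z \<in> mdeg M (n + 1)" "w \<in> mdeg M n" using cases' by blast
    then show "?F p \<in> mdeg Kb n \<and> ?F (?F p) = p"
      using M.mdeg_closed(3) M.mdeg_carrier[OF p(2)] by (simp add: simps swap_middle_def M.M.minus_minus)
  qed
  then show ?thesis unfolding Kb_def La_def K_def L_def .
qed

lemma quasi_iso_cohomology:
  assumes M: "dg_complex A M" and N: "dg_complex A N" and f: "quasi_iso A (\<lambda>c. c) M N f"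
  obtains g where "linear_map (H0 A) (cohomology M n) (cohomology N n) g"
    "\<forall>y\<in>carrier (cohomology M n). g y = \<zero>\<^bsub>cohomology N n\<^esub> \<longrightarrow> y = \<zero>\<^bsub>cohomology M n\<^esub>"
    "g ` carrier (cohomology M n) = carrier (cohomology N n)"
proof -
  interpret M: dg_complex A M by fact
  interpret N: dg_complex A N by fact
  note fD = quasi_isoD[OF f] and fb = quasi_iso_basic[OF M N f]
  obtain g where g: "linear_map (H0 A) (cohomology M n) (cohomology N n) g"
    "\<forall>z\<in>cocycles M n. g (coh_class M n z) = coh_class N n (f z)"
    by (rule induced_map[OF M N, of n f n])
      (auto intro: fb(3,4) fD(2)[OF M.cocycles_mdeg(1) M.cocycles_mdeg(1)] fD(3)[OF M.cocycles_mdeg(1)])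
  show ?thesis
  proof (rule that[OF g(1)])
    show "\<forall>y\<in>carrier (cohomology M n). g y = \<zero>\<^bsub>cohomology N n\<^esub> \<longrightarrow> y = \<zero>\<^bsub>cohomology M n\<^esub>"
      using g(2) fb(3,5) M.coh_class_zero_iff N.coh_class_zero_iff by (auto simp: M.coh_carrier)
    have "y \<in> g ` carrier (cohomology M n)" if y: "y \<in> carrier (cohomology N n)" for y
    proof -
      obtain w where w: "w \<in> cocycles N n" "y = coh_class N n w" using y by (auto simp: N.coh_carrier)
      obtain z b where z: "z \<in> cocycles M n" "b \<in> coboundaries N n" "w = f z \<oplus>\<^bsub>N\<^esub> b" using fD(6)[OF w(1)] by blast
      have bc: "b \<in> cocycles N n" using z(2) N.coboundaries_cocycles by blast
      have "w \<oplus>\<^bsub>N\<^esub> \<ominus>\<^bsub>N\<^esub> f z = b" using z(3) N.cocycles_mdeg(3)[OF fb(3)[OF z(1)]] N.cocycles_mdeg(3)[OF bc] by algebra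
      then have "coh_class N n w = coh_class N n (f z)" using N.coh_class_eq_iff[OF w(1) fb(3)[OF z(1)]] z(2) by simp
      then have "y = g (coh_class M n z)" using g(2) z(1) w(2) by simp
      then show ?thesis using z(1) by (simp add: M.coh_carrier)
    qed
    then show "g ` carrier (cohomology M n) = carrier (cohomology N n)"
      using linear_mapD(1)[OF g(1)] by blast
  qed
qed

lemma quasi_iso_nonzero_iff:
  assumes M: "dg_complex A M" and N: "dg_complex A' N" and f: "quasi_iso A \<phi> M N f"
  shows "cohomology_nonzero M n \<longleftrightarrow> cohomology_nonzero N n"
proof -
  interpret M: dg_complex A M by fact
  interpret N: dg_complex A' N by fact
  note fD = quasi_isoD[OF f] and fb = quasi_iso_basic[OF M N f]
  show ?thesis unfolding M.cohomology_nonzero_iff N.cohomology_nonzero_iff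
  proof
    assume "\<exists>z\<in>cocycles M n. z \<notin> coboundaries M n"
    then show "\<exists>z\<in>cocycles N n. z \<notin> coboundaries N n" using fb(3,5) by blast
  next
    assume "\<exists>z\<in>cocycles N n. z \<notin> coboundaries N n"
    then obtain w where w: "w \<in> cocycles N n" "w \<notin> coboundaries N n" by blast
    obtain z b where z: "z \<in> cocycles M n" "b \<in> coboundaries N n" "w = f z \<oplus>\<^bsub>N\<^esub> b" using fD(6)[OF w(1)] by blast
    then show "\<exists>z\<in>cocycles M n. z \<notin> coboundaries M n"
      using w(2) fb(5)[OF z(1)] N.coboundaries_closed(2)[of "f z" n b] by blast
  qed
qed

lemma quasi_iso_nonzerodivisor_iff:
  assumes M: "dg_complex A M" and N: "dg_complex A' N" and f: "quasi_iso A \<phi> M N f"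
    and a: "a \<in> deg A 0" "\<phi> a \<in> deg A' 0"
  shows "nonzerodivisor (cohomology M n) (proj0 A a) \<longleftrightarrow> nonzerodivisor (cohomology N n) (proj0 A' (\<phi> a))"
proof -
  interpret M: dg_complex A M by fact
  interpret N: dg_complex A' N by fact
  note fD = quasi_isoD[OF f] and fb = quasi_iso_basic[OF M N f]
  have fa: "f (a \<odot>\<^bsub>M\<^esub> z) = \<phi> a \<odot>\<^bsub>N\<^esub> f z" if "z \<in> cocycles M n" for z
    using fD(3)[OF M.cocycles_mdeg(1)[OF that] a(1)] .
  show ?thesis unfolding M.nonzerodivisor_iff[OF a(1)] N.nonzerodivisor_iff[OF a(2)]
  proof
    assume L: "\<forall>z\<in>cocycles M n. a \<odot>\<^bsub>M\<^esub> z \<in> coboundaries M n \<longrightarrow> z \<in> coboundaries M n"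
    show "\<forall>w\<in>cocycles N n. \<phi> a \<odot>\<^bsub>N\<^esub> w \<in> coboundaries N n \<longrightarrow> w \<in> coboundaries N n"
    proof (intro ballI impI)
      fix w assume w: "w \<in> cocycles N n" "\<phi> a \<odot>\<^bsub>N\<^esub> w \<in> coboundaries N n"
      obtain z b where z: "z \<in> cocycles M n" "b \<in> coboundaries N n" "w = f z \<oplus>\<^bsub>N\<^esub> b" using fD(6)[OF w(1)] by blast
      have bc: "b \<in> cocycles N n" using z(2) N.coboundaries_cocycles by blast
      have c: "f z \<in> carrier N" "b \<in> carrier N" using N.cocycles_mdeg(3) fb(3)[OF z(1)] bc by blast+
      have sc: "\<phi> a \<odot>\<^bsub>N\<^esub> f z \<in> carrier N" "\<phi> a \<odot>\<^bsub>N\<^esub> b \<in> carrier N"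
        using N.M.smult_closed a(2) c by auto
      have "\<phi> a \<odot>\<^bsub>N\<^esub> w = \<phi> a \<odot>\<^bsub>N\<^esub> f z \<oplus>\<^bsub>N\<^esub> \<phi> a \<odot>\<^bsub>N\<^esub> b"
        using N.M.smult_r_distr[of "\<phi> a" "f z" b] a(2) c z(3) by simp
      then have "f (a \<odot>\<^bsub>M\<^esub> z) = \<phi> a \<odot>\<^bsub>N\<^esub> w \<oplus>\<^bsub>N\<^esub> \<ominus>\<^bsub>N\<^esub> (\<phi> a \<odot>\<^bsub>N\<^esub> b)"
        using fa[OF z(1)] sc by (simp add: N.M.a_assoc N.M.r_neg)
      then have "f (a \<odot>\<^bsub>M\<^esub> z) \<in> coboundaries N n"
        using w(2) N.coboundaries_closed(2,3) N.coboundaries_closed(4)[OF a(2) z(2)] by simp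
      then have "z \<in> coboundaries M n" using L z(1) fb(5)[OF M.cocycles_closed(4)[OF a(1) z(1)]] by blast
      then show "w \<in> coboundaries N n" using fb(4) z(2,3) N.coboundaries_closed(2) by blast
    qed
  next
    assume R: "\<forall>w\<in>cocycles N n. \<phi> a \<odot>\<^bsub>N\<^esub> w \<in> coboundaries N n \<longrightarrow> w \<in> coboundaries N n"
    show "\<forall>z\<in>cocycles M n. a \<odot>\<^bsub>M\<^esub> z \<in> coboundaries M n \<longrightarrow> z \<in> coboundaries M n"
      using R fb(3,4,5) fa by metis
  qed
qed

text \<open>Invariance of regular sequences. The hypothesis relates the sequences through the chosen
  representatives: \<open>x'\<close> is the image of \<open>x\<close>.\<close>

lemma quasi_iso_regular_seq_iff:
  assumes "dg_complex A M" "dg_complex A' N" "quasi_iso A \<phi> M N f"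
    and \<phi>: "\<And>b. b \<in> deg A 0 \<Longrightarrow> \<phi> b \<in> deg A' 0"
    and m: "m \<subseteq> carrier (H0 A)" "m' \<subseteq> carrier (H0 A')"
    and xs: "list_all2 (\<lambda>x x'. x \<in> carrier (H0 A) \<and> x' \<in> carrier (H0 A') \<and>
      proj0 A' (\<phi> (SOME a. a \<in> x)) = x' \<and> (x \<in> m \<longleftrightarrow> x' \<in> m')) xs xs'"
  shows "regular_seq A m M xs \<longleftrightarrow> regular_seq A' m' N xs'"
  using xs assms(1-3)
proof (induction arbitrary: M N f rule: list_all2_induct)
  case (Cons x xs x' xs')
  note M = Cons.prems(1) and N = Cons.prems(2) and f = Cons.prems(3)
  interpret M: dg_complex A M by fact
  interpret N: dg_complex A' N by fact
  define a where "a = (SOME a. a \<in> x)"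
  define b where "b = (SOME a. a \<in> x')"
  have x: "x \<in> carrier (H0 A)" "x' \<in> carrier (H0 A')" "proj0 A' (\<phi> a) = x'" "x \<in> m \<longleftrightarrow> x' \<in> m'"
    using Cons.hyps by (auto simp: a_def)
  have a: "a \<in> deg A 0" "proj0 A a = x" using M.A.rep[OF x(1)] by (auto simp: a_def M.A.rep_def)
  have b: "b \<in> deg A' 0" "proj0 A' b = x'" using N.A.rep[OF x(2)] by (auto simp: b_def N.A.rep_def)
  have K: "dg_complex A (mult_cone A M a)" "dg_complex A' (mult_cone A' N (\<phi> a))" "dg_complex A' (mult_cone A' N b)"
    using koszul_cone.cone_dg_complex[of A M a] koszul_cone.cone_dg_complex[of A' N]
      M N a(1) b(1) \<phi>[OF a(1)] by (simp_all add: koszul_cone_def koszul_cone_axioms_def)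
  obtain F where F: "quasi_iso A' (\<lambda>c. c) (mult_cone A' N (\<phi> a)) (mult_cone A' N b) F"
    using quasi_iso_change_scalar[OF N \<phi>[OF a(1)] b(1)] x(3) b(2) by auto
  have "quasi_iso A ((\<lambda>c. c) \<circ> \<phi>) (mult_cone A M a) (mult_cone A' N b) (F \<circ> (\<lambda>p. Cone_Pair (f (pfst p)) (f (psnd p))))"
    by (rule quasi_iso_comp[OF K quasi_iso_cone[OF M N f \<phi> a(1)] F \<phi>])
  moreover have "(\<lambda>c. c) \<circ> \<phi> = \<phi>" by auto
  ultimately have seq: "regular_seq A m (koszul A M x) xs \<longleftrightarrow> regular_seq A' m' (koszul A' N x') xs'"
    using Cons.IH[OF K(1,3)] by (simp add: koszul_eq a_def b_def)
  have "inf_dg M = inf_dg N"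
    using quasi_iso_nonzero_iff[OF M N f] by (simp add: inf_dg_def)
  then have "regular_elt m M x \<longleftrightarrow> regular_elt m' N x'"
    using quasi_iso_nonzerodivisor_iff[OF M N f a(1) \<phi>[OF a(1)], of "inf_dg M"] x a(2)
    unfolding M.regular_elt_iff[OF m(1)] N.regular_elt_iff[OF m(2)] by simp
  then show ?case using seq by simp
qed simp


section \<open>A DG-ring as a complex over its degree zero part\<close>

lemma self_module_dg_complex:
  assumes "comm_dg_ring A"
  shows "dg_complex A (self_module A)"
proof -
  interpret A: comm_dg_ring A by fact
  let ?M = "self_module A"
  have mod: "module (deg0 A) ?M"
  proof (rule moduleI)
    show "cring (deg0 A)" by (rule A.deg0_cring)
    show "abelian_group ?M"
    proof (rule abelian_groupI)
      fix x assume "x \<in> carrier ?M"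
      then show "\<exists>y\<in>carrier ?M. y \<oplus>\<^bsub>?M\<^esub> x = \<zero>\<^bsub>?M\<^esub>"
        by (intro bexI[of _ "\<ominus>\<^bsub>A\<^esub> x"]) (auto simp: A.l_neg)
    qed (auto simp: A.a_ac)
  qed (auto simp: A.deg_carrier A.l_distr A.r_distr A.m_assoc)
  then interpret M: module "deg0 A" ?M .
  show ?thesis
  proof (intro dg_complex.intro dg_complex_axioms.intro mod)
    show "comm_dg_ring A" by fact
    show "submodule (mdeg ?M n) (deg0 A) ?M" for n
      unfolding M.submodule_iff using A.deg_closed A.deg_carrier A.deg0_mult(1) by auto
    show "\<exists>h. null_homotopy A ?M e h" if e: "e \<in> boundaries0 A" for e
    proof -
      obtain c where c: "c \<in> deg A (-1)" "e = diff A c" using e by (auto simp: A.boundaries0_iff)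
      have cc: "c \<in> carrier A" "diff A c \<in> carrier A" using c(1) A.deg_carrier A.diff_deg by blast+
      have "null_homotopy A ?M e (\<lambda>x. c \<otimes>\<^bsub>A\<^esub> x)"
        unfolding null_homotopy_def
      proof (intro allI ballI conjI)
        fix n x assume "x \<in> mdeg ?M n"
        then have x: "x \<in> deg A n" by simp
        have xc: "x \<in> carrier A" "diff A x \<in> carrier A" using x A.deg_carrier A.diff_deg by blast+
        show "c \<otimes>\<^bsub>A\<^esub> x \<in> mdeg ?M (n - 1)" using A.mult_deg[OF c(1) x] by simp
        show "c \<otimes>\<^bsub>A\<^esub> (x \<oplus>\<^bsub>?M\<^esub> y) = c \<otimes>\<^bsub>A\<^esub> x \<oplus>\<^bsub>?M\<^esub> c \<otimes>\<^bsub>A\<^esub> y" if "y \<in> mdeg ?M n" for y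
          using that A.deg_carrier cc xc by (simp add: A.r_distr)
        show "c \<otimes>\<^bsub>A\<^esub> (b \<odot>\<^bsub>?M\<^esub> x) = b \<odot>\<^bsub>?M\<^esub> (c \<otimes>\<^bsub>A\<^esub> x)" if "b \<in> deg A 0" for b
          using A.deg0_mult(2)[OF that c(1)] A.deg_carrier[OF that] cc xc by (simp flip: A.m_assoc)
        have "diff A (c \<otimes>\<^bsub>A\<^esub> x) = diff A c \<otimes>\<^bsub>A\<^esub> x \<oplus>\<^bsub>A\<^esub> \<ominus>\<^bsub>A\<^esub> (c \<otimes>\<^bsub>A\<^esub> diff A x)"
          using A.leibniz[OF c(1) x] by (simp add: sgn_pow_def)
        then show "e \<odot>\<^bsub>?M\<^esub> x = mdiff ?M (c \<otimes>\<^bsub>A\<^esub> x) \<oplus>\<^bsub>?M\<^esub> c \<otimes>\<^bsub>A\<^esub> mdiff ?M x"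
          using cc xc c(2) by (simp add: A.a_assoc A.l_neg)
      qed
      then show ?thesis by blast
    qed
  qed (use A.diff_deg A.diff_add A.diff_mult_deg0 A.diff_diff A.deg_carrier in auto)
qed

lemma embed_simps:
  "Elt x \<in> carrier (embed M) \<longleftrightarrow> x \<in> carrier M" "\<zero>\<^bsub>embed M\<^esub> = Elt \<zero>\<^bsub>M\<^esub>"
  "Elt x \<oplus>\<^bsub>embed M\<^esub> Elt y = Elt (x \<oplus>\<^bsub>M\<^esub> y)" "a \<odot>\<^bsub>embed M\<^esub> Elt x = Elt (a \<odot>\<^bsub>M\<^esub> x)"
  "Elt x \<in> mdeg (embed M) n \<longleftrightarrow> x \<in> mdeg M n" "mdiff (embed M) (Elt x) = Elt (mdiff M x)"
  "p \<in> carrier (embed M) \<Longrightarrow> \<exists>x\<in>carrier M. p = Elt x"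
  "p \<in> mdeg (embed M) n \<Longrightarrow> \<exists>x\<in>mdeg M n. p = Elt x"
  by (auto simp: embed_def)

lemma embed_dg_complex:
  assumes "dg_complex A M"
  shows "dg_complex A (embed M)"
proof -
  interpret M: dg_complex A M by fact
  note simps = embed_simps(1-6)
  have mod: "module (deg0 A) (embed M)"
  proof (rule moduleI)
    show "cring (deg0 A)" by (rule M.A.deg0_cring)
    show "abelian_group (embed M)"
    proof (rule abelian_groupI)
      fix p assume "p \<in> carrier (embed M)"
      then obtain x where "x \<in> carrier M" "p = Elt x" using embed_simps(7) by blast
      then show "\<exists>y\<in>carrier (embed M). y \<oplus>\<^bsub>embed M\<^esub> p = \<zero>\<^bsub>embed M\<^esub>"
        by (intro bexI[of _ "Elt (\<ominus>\<^bsub>M\<^esub> x)"]) (auto simp: simps M.M.l_neg)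
    qed (auto simp: simps M.M.a_ac dest!: embed_simps(7))
  qed (use M.M.smult_closed M.M.smult_l_distr M.M.smult_r_distr M.M.smult_assoc1 M.M.smult_one in
    \<open>auto simp: simps dest!: embed_simps(7)\<close>)
  then interpret E: module "deg0 A" "embed M" .
  show ?thesis
  proof (intro dg_complex.intro dg_complex_axioms.intro mod)
    show "comm_dg_ring A" by (rule M.A.comm_dg_ring_axioms)
    show "submodule (mdeg (embed M) n) (deg0 A) (embed M)" for n
      unfolding E.submodule_iff using M.mdeg_closed M.mdeg_carrier
      by (auto simp: simps dest!: embed_simps(8))
    show "\<exists>h. null_homotopy A (embed M) e h" if e: "e \<in> boundaries0 A" for e
    proof -
      obtain h where h: "null_homotopy A M e h" using M.boundary_null_homotopic[OF e] by blast
      have "null_homotopy A (embed M) e (\<lambda>p. Elt (h (the_elt p)))"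
        unfolding null_homotopy_def
      proof (intro allI ballI)
        fix n p assume "p \<in> mdeg (embed M) n"
        then obtain x where x: "x \<in> mdeg M n" "p = Elt x" using embed_simps(8) by blast
        show "Elt (h (the_elt p)) \<in> mdeg (embed M) (n - 1) \<and>
          (\<forall>y\<in>mdeg (embed M) n. Elt (h (the_elt (p \<oplus>\<^bsub>embed M\<^esub> y))) = Elt (h (the_elt p)) \<oplus>\<^bsub>embed M\<^esub> Elt (h (the_elt y))) \<and>
          (\<forall>b\<in>deg A 0. Elt (h (the_elt (b \<odot>\<^bsub>embed M\<^esub> p))) = b \<odot>\<^bsub>embed M\<^esub> Elt (h (the_elt p))) \<and>
          e \<odot>\<^bsub>embed M\<^esub> p = mdiff (embed M) (Elt (h (the_elt p))) \<oplus>\<^bsub>embed M\<^esub> Elt (h (the_elt (mdiff (embed M) p)))"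
          using null_homotopyD[OF h x(1)] x(2) by (auto simp: simps dest!: embed_simps(8))
      qed
      then show ?thesis by blast
    qed
  qed (use M.d_deg M.d_add M.d_smult M.d_d in \<open>auto simp: simps dest!: embed_simps(8)\<close>)
qed

lemma embed_quasi_iso:
  assumes "dg_complex A M"
  shows "quasi_iso A (\<lambda>c. c) M (embed M) Elt"
  by (rule quasi_iso_isomorphism[OF assms embed_dg_complex[OF assms], where g = the_elt])
    (auto simp: embed_simps(1-6) dest!: embed_simps(8))

section \<open>Regular sequences over a local DG-ring\<close>

text \<open>The class of complexes to which the theory of depth applies, with the value \<open>i\<close> of \<open>inf(M)\<close> as a
  parameter: regularity of \<open>x\<close> will mean that \<open>K(M; x)\<close> has the same parameter as \<open>M\<close>.\<close>

definition inf_at :: "('a, 'b) dg_ring_scheme \<Rightarrow> ('a, 'm, 'c) dg_module_scheme \<Rightarrow> int \<Rightarrow> bool" where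
  "inf_at A M i \<longleftrightarrow> dg_complex A M \<and> (\<forall>n. noetherian_module (H0 A) (cohomology M n)) \<and>
     (\<forall>j<i. \<not> cohomology_nonzero M j) \<and> cohomology_nonzero M i"

lemma inf_atD:
  assumes "inf_at A M i"
  shows "dg_complex A M" "noetherian_module (H0 A) (cohomology M n)"
    "j < i \<Longrightarrow> y \<in> carrier (cohomology M j) \<Longrightarrow> y = \<zero>\<^bsub>cohomology M j\<^esub>"
    "\<exists>z\<in>carrier (cohomology M i). z \<noteq> \<zero>\<^bsub>cohomology M i\<^esub>"
    "cohomology_nonzero M i" "j < i \<Longrightarrow> \<not> cohomology_nonzero M j"
proof -
  show M: "dg_complex A M" and "noetherian_module (H0 A) (cohomology M n)"
    and nz: "cohomology_nonzero M i" and z: "j < i \<Longrightarrow> \<not> cohomology_nonzero M j" for j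
    using assms by (auto simp: inf_at_def)
  interpret H: module "H0 A" "cohomology M i" using dg_complex.cohomology_module[OF M] .
  show "\<exists>z\<in>carrier (cohomology M i). z \<noteq> \<zero>\<^bsub>cohomology M i\<^esub>"
    using nz H.M.zero_closed unfolding cohomology_nonzero_def by blast
  show "y = \<zero>\<^bsub>cohomology M j\<^esub>" if "j < i" "y \<in> carrier (cohomology M j)"
    using z[OF that(1)] that(2) unfolding cohomology_nonzero_def by simp
qed

lemma dg_complex_nonzero_iff:
  assumes "dg_complex A M"
  shows "cohomology_nonzero M n \<longleftrightarrow> (\<exists>y\<in>carrier (cohomology M n). y \<noteq> \<zero>\<^bsub>cohomology M n\<^esub>)"
proof -
  interpret H: module "H0 A" "cohomology M n" using dg_complex.cohomology_module[OF assms] .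
  show ?thesis unfolding cohomology_nonzero_def using H.M.zero_closed by auto
qed

lemma inf_at_inf_dg: "inf_at A M i \<Longrightarrow> inf_dg M = i"
  unfolding inf_dg_def by (rule cInf_eq_minimum) (auto simp: inf_at_def not_less[symmetric])

lemma inf_at_unique: "inf_at A M i \<Longrightarrow> inf_at A M j \<Longrightarrow> i = j"
  using inf_at_inf_dg by metis

lemma inf_at_quasi_iso:
  assumes "inf_at A M i" "dg_complex A N" "quasi_iso A (\<lambda>c. c) M N f"
  shows "inf_at A N i"
proof -
  have M: "dg_complex A M" using inf_atD(1)[OF assms(1)] .
  have "noetherian_module (H0 A) (cohomology N n)" for n
  proof -
    obtain g where g: "linear_map (H0 A) (cohomology M n) (cohomology N n) g"
      "g ` carrier (cohomology M n) = carrier (cohomology N n)"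
      by (rule quasi_iso_cohomology[OF M assms(2,3), of n], rule that)
    interpret H: module "H0 A" "cohomology M n" using dg_complex.cohomology_module[OF M] .
    interpret H': module "H0 A" "cohomology N n" using dg_complex.cohomology_module[OF assms(2)] .
    show ?thesis
    proof (rule noetherian_module_exact[OF H'.module_axioms _ _ g(1)])
      show "linear_map (H0 A) (cohomology N n) (cohomology M n) (\<lambda>_. \<zero>\<^bsub>cohomology M n\<^esub>)"
        by (simp add: linear_map_def)
    qed (use inf_atD(2)[OF assms(1)] g(2) in auto)
  qed
  then show ?thesis
    using assms(1,2) quasi_iso_nonzero_iff[OF M assms(2,3)] by (simp add: inf_at_def)
qed

text \<open>In contrast to the support of the bottom cohomology, this can only shrink from \<open>M\<close> to
  \<open>K(M; x)\<close>.\<close>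

definition total_support :: "('a, 'b) dg_ring_scheme \<Rightarrow> ('a, 'm, 'c) dg_module_scheme \<Rightarrow> 'a set set set" where
  "total_support A M = (\<Union>n. module_support (H0 A) (cohomology M n))"

locale local_dg_ring = comm_dg_ring A for A :: "('a, 'b) dg_ring_scheme" +
  fixes m :: "'a set set"
  assumes noetherian: "noetherian_ring (H0 A)" and local: "local_ring (H0 A) m"
begin

lemma m_subset: "m \<subseteq> carrier (H0 A)"
  using local_ringD(4)[OF local] by (meson ideal.Icarr subsetI)

lemma m_carrier: "x \<in> m \<Longrightarrow> x \<in> carrier (H0 A)"
  using m_subset by blast

lemma koszul_koszul_cone:
  assumes "dg_complex A M" "x \<in> m"
  shows "koszul_cone A M (rep x)" "koszul A M x = mult_cone A M (rep x)" "proj0 A (rep x) = x"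
  using rep[OF m_carrier[OF assms(2)]] assms(1)
  by (simp_all add: koszul_cone_def koszul_cone_axioms_def koszul_eq rep_def)

lemma koszul_dg_complex: "dg_complex A M \<Longrightarrow> x \<in> m \<Longrightarrow> dg_complex A (koszul A M x)"
  by (simp only: koszul_koszul_cone(2) koszul_cone.cone_dg_complex[OF koszul_koszul_cone(1)])

lemma koszul_exact_sequence:
  assumes "dg_complex A M" "x \<in> m"
  obtains \<iota> \<delta> where
    "linear_map (H0 A) (cohomology M n) (cohomology (koszul A M x) n) \<iota>"
    "linear_map (H0 A) (cohomology (koszul A M x) n) (cohomology M (n + 1)) \<delta>"
    "\<forall>y\<in>carrier (cohomology M n). \<iota> y = \<zero>\<^bsub>cohomology (koszul A M x) n\<^esub> \<longleftrightarrow>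
       (\<exists>w\<in>carrier (cohomology M n). y = x \<odot>\<^bsub>cohomology M n\<^esub> w)"
    "\<forall>y\<in>carrier (cohomology (koszul A M x) n).
       \<delta> y = \<zero>\<^bsub>cohomology M (n + 1)\<^esub> \<longleftrightarrow> y \<in> \<iota> ` carrier (cohomology M n)"
    "\<delta> ` carrier (cohomology (koszul A M x) n) =
       {y \<in> carrier (cohomology M (n + 1)). x \<odot>\<^bsub>cohomology M (n + 1)\<^esub> y = \<zero>\<^bsub>cohomology M (n + 1)\<^esub>}"
  using koszul_cone.cone_exact_sequence[OF koszul_koszul_cone(1)[OF assms], of n thesis]
  unfolding koszul_koszul_cone(2)[OF assms] koszul_koszul_cone(3)[OF assms] .

lemma ann_subset_m:
  assumes "module (H0 A) N" "z \<in> carrier N" "z \<noteq> \<zero>\<^bsub>N\<^esub>"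
  shows "ann (H0 A) N z \<subseteq> m"
proof (rule proper_ideal_subset_maximal[OF noetherian local])
  interpret module "H0 A" N by fact
  show "ideal (ann (H0 A) N z) (H0 A)" by (rule ann_ideal[OF assms(2)])
  have "\<one>\<^bsub>H0 A\<^esub> \<notin> ann (H0 A) N z" using assms by (simp add: ann_def)
  then show "ann (H0 A) N z \<noteq> carrier (H0 A)" by auto
qed

lemma regular_elt_inf_at:
  assumes "inf_at A M i"
  shows "regular_elt m M x \<longleftrightarrow> x \<in> m \<and> nonzerodivisor (cohomology M i) x"
  using dg_complex.regular_elt_iff[OF inf_atD(1)[OF assms] m_subset] inf_at_inf_dg[OF assms] by simp

text \<open>As \<open>H\<^sup>i\<^sup>-\<^sup>1(M) = 0\<close>, the connecting map identifies \<open>H\<^sup>i\<^sup>-\<^sup>1(K(M; x))\<close> with the kernel of \<open>x\<close> on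
  \<open>H\<^sup>i(M)\<close>.\<close>

lemma koszul_bottom:
  assumes M: "inf_at A M i" and x: "x \<in> m"
  obtains \<delta> where "linear_map (H0 A) (cohomology (koszul A M x) (i - 1)) (cohomology M i) \<delta>"
    "\<forall>y\<in>carrier (cohomology (koszul A M x) (i - 1)).
       \<delta> y = \<zero>\<^bsub>cohomology M i\<^esub> \<longrightarrow> y = \<zero>\<^bsub>cohomology (koszul A M x) (i - 1)\<^esub>"
    "\<delta> ` carrier (cohomology (koszul A M x) (i - 1)) =
       {y \<in> carrier (cohomology M i). x \<odot>\<^bsub>cohomology M i\<^esub> y = \<zero>\<^bsub>cohomology M i\<^esub>}"
proof -
  let ?K = "koszul A M x"
  note c = dg_complex.cohomology_module
  obtain \<iota> \<delta> where \<iota>: "linear_map (H0 A) (cohomology M (i - 1)) (cohomology ?K (i - 1)) \<iota>"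
    and \<delta>: "linear_map (H0 A) (cohomology ?K (i - 1)) (cohomology M (i - 1 + 1)) \<delta>"
    "\<forall>y\<in>carrier (cohomology ?K (i - 1)). \<delta> y = \<zero>\<^bsub>cohomology M (i - 1 + 1)\<^esub> \<longleftrightarrow> y \<in> \<iota> ` carrier (cohomology M (i - 1))"
    "\<delta> ` carrier (cohomology ?K (i - 1)) =
       {y \<in> carrier (cohomology M (i - 1 + 1)). x \<odot>\<^bsub>cohomology M (i - 1 + 1)\<^esub> y = \<zero>\<^bsub>cohomology M (i - 1 + 1)\<^esub>}"
    by (rule koszul_exact_sequence[OF inf_atD(1)[OF M] x, of "i - 1"], rule that)
  have "\<iota> y = \<zero>\<^bsub>cohomology ?K (i - 1)\<^esub>" if "y \<in> carrier (cohomology M (i - 1))" for y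
    using inf_atD(3)[OF M, of "i - 1" y] that
      linear_map_zero_minus(1)[OF \<iota> c[OF inf_atD(1)[OF M]] c[OF koszul_dg_complex[OF inf_atD(1)[OF M] x]]] by simp
  then have inj: "y = \<zero>\<^bsub>cohomology ?K (i - 1)\<^esub>"
    if "y \<in> carrier (cohomology ?K (i - 1))" "\<delta> y = \<zero>\<^bsub>cohomology M (i - 1 + 1)\<^esub>" for y
    using bspec[OF \<delta>(2) that(1)] that(2) by auto
  have i: "i - 1 + 1 = i" by simp
  show ?thesis
    by (rule that[OF \<delta>(1)[unfolded i] _ \<delta>(3)[unfolded i]]) (use inj[unfolded i] in simp)
qed

text \<open>Multiplication by \<open>x \<in> m\<close> is not surjective on \<open>H\<^sup>i(M)\<close>, by Nakayama. Hence
  \<open>inf K(M; x)\<close> is \<open>i\<close> if \<open>x\<close> is \<open>M\<close>-regular, and \<open>i - 1\<close> otherwise.\<close>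

lemma koszul_inf_at:
  assumes M: "inf_at A M i" and x: "x \<in> m"
  obtains k where "k \<le> i" "inf_at A (koszul A M x) k" "k = i \<longleftrightarrow> regular_elt m M x"
proof -
  let ?K = "koszul A M x"
  note Mc = inf_atD(1)[OF M]
  note Kc = koszul_dg_complex[OF Mc x]
  note c = dg_complex.cohomology_module
  have noeth: "noetherian_module (H0 A) (cohomology ?K n)" for n
  proof -
    obtain \<iota> \<delta> where 1: "linear_map (H0 A) (cohomology M n) (cohomology ?K n) \<iota>"
      "linear_map (H0 A) (cohomology ?K n) (cohomology M (n + 1)) \<delta>"
      "\<forall>y\<in>carrier (cohomology ?K n). \<delta> y = \<zero>\<^bsub>cohomology M (n + 1)\<^esub> \<longleftrightarrow> y \<in> \<iota> ` carrier (cohomology M n)"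
      by (rule koszul_exact_sequence[OF Mc x, of n], rule that)
    show ?thesis
      by (rule noetherian_module_exact[OF c[OF Kc] inf_atD(2)[OF M] inf_atD(2)[OF M] 1(1,2)]) (use bspec[OF 1(3)] in simp)
  qed
  have low: "\<not> cohomology_nonzero ?K j" if j: "j < i - 1" for j
  proof -
    obtain \<iota> \<delta> where 1: "linear_map (H0 A) (cohomology M j) (cohomology ?K j) \<iota>"
      "linear_map (H0 A) (cohomology ?K j) (cohomology M (j + 1)) \<delta>"
      "\<forall>y\<in>carrier (cohomology ?K j). \<delta> y = \<zero>\<^bsub>cohomology M (j + 1)\<^esub> \<longleftrightarrow> y \<in> \<iota> ` carrier (cohomology M j)"
      by (rule koszul_exact_sequence[OF Mc x, of j], rule that)
    have "y = \<zero>\<^bsub>cohomology ?K j\<^esub>" if y: "y \<in> carrier (cohomology ?K j)" for y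
    proof -
      have "\<delta> y = \<zero>\<^bsub>cohomology M (j + 1)\<^esub>" using inf_atD(3)[OF M, of "j + 1"] linear_mapD(1)[OF 1(2) y] j by simp
      then have "y \<in> \<iota> ` carrier (cohomology M j)" using bspec[OF 1(3) y] by simp
      then obtain w where "w \<in> carrier (cohomology M j)" "y = \<iota> w" by (rule imageE)
      then show ?thesis using inf_atD(3)[OF M, of j w] j linear_map_zero_minus(1)[OF 1(1) c[OF Mc] c[OF Kc]] by simp
    qed
    then show ?thesis unfolding dg_complex_nonzero_iff[OF Kc] by auto
  qed
  have nz: "cohomology_nonzero ?K i"
  proof -
    interpret H: module "H0 A" "cohomology M i" using c[OF Mc] .
    obtain z where z: "z \<in> carrier (cohomology M i)" "z \<noteq> \<zero>\<^bsub>cohomology M i\<^esub>" using inf_atD(4)[OF M] by blast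
    have "\<exists>z\<in>carrier (cohomology M i). \<forall>s\<in>carrier (H0 A) - m. \<forall>w\<in>carrier (cohomology M i).
        s \<odot>\<^bsub>cohomology M i\<^esub> z \<noteq> x \<odot>\<^bsub>cohomology M i\<^esub> w"
      by (rule nakayama_at_prime[OF inf_atD(2)[OF M] H.carrier_is_submodule local_ringD(3)[OF local] x z(1)
            ann_subset_m[OF H.module_axioms z]])
    then obtain y where y: "y \<in> carrier (cohomology M i)"
      "\<forall>s\<in>carrier (H0 A) - m. \<forall>w\<in>carrier (cohomology M i). s \<odot>\<^bsub>cohomology M i\<^esub> y \<noteq> x \<odot>\<^bsub>cohomology M i\<^esub> w"
      by blast
    have "\<one>\<^bsub>H0 A\<^esub> \<in> carrier (H0 A) - m" using local_ringD(5)[OF local] H.R.one_closed by blast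
    then have ne: "\<forall>w\<in>carrier (cohomology M i). y \<noteq> x \<odot>\<^bsub>cohomology M i\<^esub> w"
      using y H.smult_one[OF y(1)] by metis
    obtain \<iota> where \<iota>: "linear_map (H0 A) (cohomology M i) (cohomology ?K i) \<iota>"
      "\<forall>y\<in>carrier (cohomology M i). \<iota> y = \<zero>\<^bsub>cohomology ?K i\<^esub> \<longleftrightarrow>
        (\<exists>w\<in>carrier (cohomology M i). y = x \<odot>\<^bsub>cohomology M i\<^esub> w)"
      by (rule koszul_exact_sequence[OF Mc x, of i], rule that)
    have "\<iota> y \<noteq> \<zero>\<^bsub>cohomology ?K i\<^esub>" using bspec[OF \<iota>(2) y(1)] ne by simp
    then show ?thesis using linear_mapD(1)[OF \<iota>(1) y(1)] unfolding dg_complex_nonzero_iff[OF Kc]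
      by (intro bexI[of _ "\<iota> y"])
  qed
  have reg: "cohomology_nonzero ?K (i - 1) \<longleftrightarrow> \<not> regular_elt m M x"
  proof -
    obtain \<delta> where \<delta>: "linear_map (H0 A) (cohomology ?K (i - 1)) (cohomology M i) \<delta>"
      "\<forall>y\<in>carrier (cohomology ?K (i - 1)). \<delta> y = \<zero>\<^bsub>cohomology M i\<^esub> \<longrightarrow> y = \<zero>\<^bsub>cohomology ?K (i - 1)\<^esub>"
      "\<delta> ` carrier (cohomology ?K (i - 1)) =
        {y \<in> carrier (cohomology M i). x \<odot>\<^bsub>cohomology M i\<^esub> y = \<zero>\<^bsub>cohomology M i\<^esub>}"
      by (rule koszul_bottom[OF M x], rule that)
    interpret HK: module "H0 A" "cohomology ?K (i - 1)" using c[OF Kc] .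
    have d0: "\<delta> \<zero>\<^bsub>cohomology ?K (i - 1)\<^esub> = \<zero>\<^bsub>cohomology M i\<^esub>"
      by (rule linear_map_zero_minus(1)[OF \<delta>(1) c[OF Kc] c[OF Mc]])
    have "\<delta> y = \<zero>\<^bsub>cohomology M i\<^esub> \<longleftrightarrow> y = \<zero>\<^bsub>cohomology ?K (i - 1)\<^esub>"
      if "y \<in> carrier (cohomology ?K (i - 1))" for y
      using bspec[OF \<delta>(2) that] d0 by auto
    then have "cohomology_nonzero ?K (i - 1) \<longleftrightarrow>
      (\<exists>y\<in>carrier (cohomology ?K (i - 1)). \<delta> y \<noteq> \<zero>\<^bsub>cohomology M i\<^esub>)"
      unfolding dg_complex_nonzero_iff[OF Kc] by (intro bex_cong) auto
    also have "\<dots> \<longleftrightarrow> (\<exists>y\<in>\<delta> ` carrier (cohomology ?K (i - 1)). y \<noteq> \<zero>\<^bsub>cohomology M i\<^esub>)" by simp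
    also have "\<dots> \<longleftrightarrow> \<not> nonzerodivisor (cohomology M i) x" unfolding \<delta>(3) nonzerodivisor_def by auto
    finally show ?thesis using regular_elt_inf_at[OF M] x by simp
  qed
  show ?thesis
  proof (cases "regular_elt m M x")
    case True
    have "\<not> cohomology_nonzero ?K j" if "j < i" for j
      using low[of j] reg True that by (cases "j = i - 1") auto
    then have "inf_at A ?K i" using noeth nz Kc by (simp add: inf_at_def)
    then show ?thesis using True by (intro that[of i]) auto
  next
    case False
    then have "inf_at A ?K (i - 1)" using noeth reg Kc low by (simp add: inf_at_def)
    then show ?thesis using False by (intro that[of "i - 1"]) auto
  qed
qed

lemma regular_elt_m: "regular_elt m M x \<Longrightarrow> x \<in> m"
  by (simp add: regular_elt_def)

lemma regular_seq_m: "regular_seq A m M xs \<Longrightarrow> set xs \<subseteq> m"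
  by (induction xs arbitrary: M) (auto dest: regular_elt_m)

lemma regular_elt_iff_koszul_inf:
  assumes "inf_at A M i" "x \<in> m"
  shows "regular_elt m M x \<longleftrightarrow> inf_at A (koszul A M x) i"
proof -
  obtain k where "inf_at A (koszul A M x) k" "k = i \<longleftrightarrow> regular_elt m M x"
    by (rule koszul_inf_at[OF assms], rule that)
  then show ?thesis using inf_at_unique by metis
qed

lemma koszul_swap:
  assumes "dg_complex A M" "x \<in> m" "y \<in> m"
  obtains f where "quasi_iso A (\<lambda>c. c) (koszul A (koszul A M x) y) (koszul A (koszul A M y) x) f"
  using quasi_iso_swap[OF assms(1), of "rep x" "rep y"] rep(1)[OF m_carrier] assms that
  by (simp add: koszul_eq rep_def)

text \<open>Regular sequences can be permuted, since regularity of \<open>x, z\<close> amounts to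
  \<open>inf K(M; x, z) = inf(M)\<close>.\<close>

lemma regular_pair_swap:
  assumes M: "inf_at A M i" and x: "regular_elt m M x" and z: "regular_elt m (koszul A M x) z"
  shows "regular_elt m M z" "regular_elt m (koszul A M z) x"
proof -
  have xm: "x \<in> m" and zm: "z \<in> m" using x z regular_elt_m by auto
  note Mc = inf_atD(1)[OF M]
  have 1: "inf_at A (koszul A M x) i" using regular_elt_iff_koszul_inf[OF M xm] x by simp
  then have 2: "inf_at A (koszul A (koszul A M x) z) i" using regular_elt_iff_koszul_inf[OF _ zm] z by blast
  obtain f where "quasi_iso A (\<lambda>c. c) (koszul A (koszul A M x) z) (koszul A (koszul A M z) x) f"
    by (rule koszul_swap[OF Mc xm zm])
  then have 3: "inf_at A (koszul A (koszul A M z) x) i"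
    using inf_at_quasi_iso[OF 2] koszul_dg_complex Mc xm zm by blast
  obtain k where k: "k \<le> i" "inf_at A (koszul A M z) k" "k = i \<longleftrightarrow> regular_elt m M z"
    by (rule koszul_inf_at[OF M zm], rule that)
  obtain l where l: "l \<le> k" "inf_at A (koszul A (koszul A M z) x) l" "l = k \<longleftrightarrow> regular_elt m (koszul A M z) x"
    by (rule koszul_inf_at[OF k(2) xm], rule that)
  have "l = i" using inf_at_unique[OF l(2) 3] .
  then show "regular_elt m M z" "regular_elt m (koszul A M z) x" using k l by auto
qed

lemma regular_seq_koszul_swap:
  assumes "dg_complex A M" "x \<in> m" "y \<in> m" "set zs \<subseteq> m"
  shows "regular_seq A m (koszul A (koszul A M x) y) zs \<longleftrightarrow> regular_seq A m (koszul A (koszul A M y) x) zs"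
proof -
  obtain f where f: "quasi_iso A (\<lambda>c. c) (koszul A (koszul A M x) y) (koszul A (koszul A M y) x) f"
    by (rule koszul_swap[OF assms(1-3)])
  show ?thesis
  proof (rule quasi_iso_regular_seq_iff[OF _ _ f])
    show "list_all2 (\<lambda>x x'. x \<in> carrier (H0 A) \<and> x' \<in> carrier (H0 A) \<and>
      proj0 A (SOME a. a \<in> x) = x' \<and> (x \<in> m \<longleftrightarrow> x' \<in> m)) zs zs"
      using assms(4) m_carrier rep(2)[unfolded rep_def] by (auto simp: list_all2_same)
  qed (use assms m_subset in \<open>auto intro: koszul_dg_complex\<close>)
qed

subsection \<open>Independence of the length\<close>

text \<open>The kernel of \<open>x \<in> m\<close> contains the whole socle.\<close>

lemma annihilated_koszul_bottom_iff:
  assumes M: "inf_at A M i" and x: "x \<in> m"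
  shows "(\<exists>w\<in>carrier (cohomology (koszul A M x) (i - 1)). w \<noteq> \<zero>\<^bsub>cohomology (koszul A M x) (i - 1)\<^esub> \<and>
      m \<subseteq> ann (H0 A) (cohomology (koszul A M x) (i - 1)) w) \<longleftrightarrow>
    (\<exists>u\<in>carrier (cohomology M i). u \<noteq> \<zero>\<^bsub>cohomology M i\<^esub> \<and> m \<subseteq> ann (H0 A) (cohomology M i) u)"
proof -
  let ?K = "koszul A M x"
  note Mc = inf_atD(1)[OF M]
  note Kc = koszul_dg_complex[OF Mc x]
  interpret H: module "H0 A" "cohomology M i" using dg_complex.cohomology_module[OF Mc] .
  interpret HK: module "H0 A" "cohomology ?K (i - 1)" using dg_complex.cohomology_module[OF Kc] .
  obtain \<delta> where \<delta>: "linear_map (H0 A) (cohomology ?K (i - 1)) (cohomology M i) \<delta>"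
    "\<forall>y\<in>carrier (cohomology ?K (i - 1)). \<delta> y = \<zero>\<^bsub>cohomology M i\<^esub> \<longrightarrow> y = \<zero>\<^bsub>cohomology ?K (i - 1)\<^esub>"
    "\<delta> ` carrier (cohomology ?K (i - 1)) =
      {y \<in> carrier (cohomology M i). x \<odot>\<^bsub>cohomology M i\<^esub> y = \<zero>\<^bsub>cohomology M i\<^esub>}"
    by (rule koszul_bottom[OF M x], rule that)
  have d0: "\<delta> \<zero>\<^bsub>cohomology ?K (i - 1)\<^esub> = \<zero>\<^bsub>cohomology M i\<^esub>"
    by (rule linear_map_zero_minus(1)[OF \<delta>(1) HK.module_axioms H.module_axioms])
  have zero: "\<delta> w = \<zero>\<^bsub>cohomology M i\<^esub> \<longleftrightarrow> w = \<zero>\<^bsub>cohomology ?K (i - 1)\<^esub>"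
    if "w \<in> carrier (cohomology ?K (i - 1))" for w using bspec[OF \<delta>(2) that] d0 by auto
  have ann: "ann (H0 A) (cohomology M i) (\<delta> w) = ann (H0 A) (cohomology ?K (i - 1)) w"
    if w: "w \<in> carrier (cohomology ?K (i - 1))" for w
    using linear_mapD(3)[OF \<delta>(1) _ w] zero[OF HK.smult_closed[OF _ w]] by (auto simp: ann_def)
  show ?thesis
  proof
    assume "\<exists>w\<in>carrier (cohomology ?K (i - 1)). w \<noteq> \<zero>\<^bsub>cohomology ?K (i - 1)\<^esub> \<and>
      m \<subseteq> ann (H0 A) (cohomology ?K (i - 1)) w"
    then obtain w where "w \<in> carrier (cohomology ?K (i - 1))" "w \<noteq> \<zero>\<^bsub>cohomology ?K (i - 1)\<^esub>"
      "m \<subseteq> ann (H0 A) (cohomology ?K (i - 1)) w" by (elim bexE conjE)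
    then show "\<exists>u\<in>carrier (cohomology M i). u \<noteq> \<zero>\<^bsub>cohomology M i\<^esub> \<and> m \<subseteq> ann (H0 A) (cohomology M i) u"
      using ann zero linear_mapD(1)[OF \<delta>(1)] by (intro bexI[of _ "\<delta> w"]) simp_all
  next
    assume "\<exists>u\<in>carrier (cohomology M i). u \<noteq> \<zero>\<^bsub>cohomology M i\<^esub> \<and> m \<subseteq> ann (H0 A) (cohomology M i) u"
    then obtain u where u: "u \<in> carrier (cohomology M i)" "u \<noteq> \<zero>\<^bsub>cohomology M i\<^esub>" "m \<subseteq> ann (H0 A) (cohomology M i) u"
      by (elim bexE conjE)
    have "x \<odot>\<^bsub>cohomology M i\<^esub> u = \<zero>\<^bsub>cohomology M i\<^esub>" using u(3) x by (auto simp: ann_def)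
    then have "u \<in> \<delta> ` carrier (cohomology ?K (i - 1))" unfolding \<delta>(3) using u(1) by simp
    then obtain w where "u = \<delta> w" "w \<in> carrier (cohomology ?K (i - 1))" by (rule imageE)
    then show "\<exists>w\<in>carrier (cohomology ?K (i - 1)). w \<noteq> \<zero>\<^bsub>cohomology ?K (i - 1)\<^esub> \<and>
      m \<subseteq> ann (H0 A) (cohomology ?K (i - 1)) w" using u(2,3) ann zero by (intro bexI[of _ w]) simp_all
  qed
qed

text \<open>If \<open>x\<close> and \<open>y\<close> are \<open>M\<close>-regular, the socles of the bottom cohomology of \<open>K(M; x)\<close> and \<open>K(M; y)\<close>
  both agree with that of \<open>K(M; x, y)\<close> one degree lower.\<close>

lemma socle_koszul_transfer:
  assumes M: "inf_at A M i" and x: "regular_elt m M x" and y: "regular_elt m M y"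
    and u: "\<exists>u\<in>carrier (cohomology (koszul A M x) i). u \<noteq> \<zero>\<^bsub>cohomology (koszul A M x) i\<^esub> \<and>
      m \<subseteq> ann (H0 A) (cohomology (koszul A M x) i) u"
  shows "\<exists>u\<in>carrier (cohomology (koszul A M y) i). u \<noteq> \<zero>\<^bsub>cohomology (koszul A M y) i\<^esub> \<and>
      m \<subseteq> ann (H0 A) (cohomology (koszul A M y) i) u"
proof -
  have xm: "x \<in> m" and ym: "y \<in> m" using x y regular_elt_m by auto
  note Mc = inf_atD(1)[OF M]
  have ix: "inf_at A (koszul A M x) i" and iy: "inf_at A (koszul A M y) i"
    using regular_elt_iff_koszul_inf[OF M] x y xm ym by auto
  let ?X = "koszul A (koszul A M x) y" and ?Y = "koszul A (koszul A M y) x"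
  have Xc: "dg_complex A ?X" and Yc: "dg_complex A ?Y" using koszul_dg_complex Mc xm ym by auto
  obtain w where w: "w \<in> carrier (cohomology ?X (i - 1))" "w \<noteq> \<zero>\<^bsub>cohomology ?X (i - 1)\<^esub>"
    "m \<subseteq> ann (H0 A) (cohomology ?X (i - 1)) w"
    using iffD2[OF annihilated_koszul_bottom_iff[OF ix ym] u] by (elim bexE conjE)
  obtain f where f: "quasi_iso A (\<lambda>c. c) ?X ?Y f" by (rule koszul_swap[OF Mc xm ym])
  obtain g where g: "linear_map (H0 A) (cohomology ?X (i - 1)) (cohomology ?Y (i - 1)) g"
    "\<forall>y\<in>carrier (cohomology ?X (i - 1)). g y = \<zero>\<^bsub>cohomology ?Y (i - 1)\<^esub> \<longrightarrow> y = \<zero>\<^bsub>cohomology ?X (i - 1)\<^esub>"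
    by (rule quasi_iso_cohomology[OF Xc Yc f, of "i - 1"], rule that)
  have g0: "g \<zero>\<^bsub>cohomology ?X (i - 1)\<^esub> = \<zero>\<^bsub>cohomology ?Y (i - 1)\<^esub>"
    by (rule linear_map_zero_minus(1)[OF g(1) dg_complex.cohomology_module[OF Xc] dg_complex.cohomology_module[OF Yc]])
  have "m \<subseteq> ann (H0 A) (cohomology ?Y (i - 1)) (g w)"
  proof
    fix r assume "r \<in> m"
    then have r: "r \<in> carrier (H0 A)" "r \<odot>\<^bsub>cohomology ?X (i - 1)\<^esub> w = \<zero>\<^bsub>cohomology ?X (i - 1)\<^esub>"
      using w(3) by (auto simp: ann_def)
    then show "r \<in> ann (H0 A) (cohomology ?Y (i - 1)) (g w)"
      using linear_mapD(3)[OF g(1) r(1) w(1)] g0 by (simp add: ann_def)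
  qed
  moreover have "g w \<noteq> \<zero>\<^bsub>cohomology ?Y (i - 1)\<^esub>" using bspec[OF g(2) w(1)] w(2) by auto
  ultimately show ?thesis
    using linear_mapD(1)[OF g(1) w(1)]
    by (intro iffD1[OF annihilated_koszul_bottom_iff[OF iy xm]] bexI[of _ "g w"] conjI)
qed

text \<open>The exchange property behind the invariance of the length of maximal regular sequences. By
  induction on the length: since \<open>K(M; y)\<close> has a regular element, its bottom cohomology has no
  socle, and neither has that of \<open>K(M; x)\<close>. So some \<open>z\<close> is regular on both. Now exchange first
  \<open>y\<close> against \<open>z\<close> and then \<open>z\<close> against \<open>x\<close>, using permutability.\<close>

lemma regular_seq_exchange:
  assumes "inf_at A M i" "regular_elt m M x" "regular_seq A m M ys" "length ys = Suc d"
  shows "\<exists>zs. length zs = d \<and> regular_seq A m (koszul A M x) zs"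
  using assms
proof (induction d arbitrary: M x ys)
  case 0
  then show ?case by (intro exI[of _ "[]"]) simp
next
  case (Suc d)
  note M = Suc.prems(1) and x = Suc.prems(2)
  note Mc = inf_atD(1)[OF M]
  obtain y ys' where ys: "ys = y # ys'" "length ys' = Suc d" using Suc.prems(4) by (cases ys) auto
  then have y: "regular_elt m M y" and ys': "regular_seq A m (koszul A M y) ys'" using Suc.prems(3) by auto
  have xm: "x \<in> m" and ym: "y \<in> m" using x y regular_elt_m by auto
  have ix: "inf_at A (koszul A M x) i" and iy: "inf_at A (koszul A M y) i"
    using regular_elt_iff_koszul_inf[OF M] x y xm ym by auto
  obtain t ts where "ys' = t # ts" using ys(2) by (cases ys') auto
  then have t: "regular_elt m (koszul A M y) t" using ys' by auto
  have no_socle: "u = \<zero>\<^bsub>cohomology (koszul A M y) i\<^esub>"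
    if "u \<in> carrier (cohomology (koszul A M y) i)" "m \<subseteq> ann (H0 A) (cohomology (koszul A M y) i) u" for u
    using t that unfolding regular_elt_inf_at[OF iy] by (auto simp: nonzerodivisor_def ann_def)
  have no_socle': "u = \<zero>\<^bsub>cohomology (koszul A M x) i\<^esub>"
    if u: "u \<in> carrier (cohomology (koszul A M x) i)" "m \<subseteq> ann (H0 A) (cohomology (koszul A M x) i) u" for u
  proof (rule ccontr)
    assume "u \<noteq> \<zero>\<^bsub>cohomology (koszul A M x) i\<^esub>"
    then have "\<exists>u\<in>carrier (cohomology (koszul A M y) i). u \<noteq> \<zero>\<^bsub>cohomology (koszul A M y) i\<^esub> \<and>
      m \<subseteq> ann (H0 A) (cohomology (koszul A M y) i) u"
      using u by (intro socle_koszul_transfer[OF M x y] bexI[of _ u] conjI)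
    then show False using no_socle by auto
  qed
  have "\<exists>z\<in>m. nonzerodivisor (cohomology (koszul A M x) i) z \<and> nonzerodivisor (cohomology (koszul A M y) i) z"
    by (rule common_nonzerodivisor[OF noetherian local_ringD(4)[OF local] inf_atD(2)[OF ix] no_socle'
          inf_atD(2)[OF iy] no_socle])
  then obtain z where "z \<in> m" "nonzerodivisor (cohomology (koszul A M x) i) z" "nonzerodivisor (cohomology (koszul A M y) i) z"
    by blast
  then have zx: "regular_elt m (koszul A M x) z" and zy: "regular_elt m (koszul A M y) z" and zm: "z \<in> m"
    using regular_elt_inf_at[OF ix] regular_elt_inf_at[OF iy] by auto
  have z: "regular_elt m M z" "regular_elt m (koszul A M z) x" "regular_elt m (koszul A M z) y"
    using regular_pair_swap[OF M x zx] regular_pair_swap[OF M y zy] by auto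
  have iz: "inf_at A (koszul A M z) i" using regular_elt_iff_koszul_inf[OF M zm] z(1) by simp
  obtain us where us: "length us = d" "regular_seq A m (koszul A (koszul A M y) z) us"
    using Suc.IH[OF iy zy ys' ys(2)] by blast
  then have "regular_seq A m (koszul A M z) (y # us)"
    using regular_seq_koszul_swap[OF Mc ym zm regular_seq_m[OF us(2)]] z(3) by simp
  then obtain vs where vs: "length vs = d" "regular_seq A m (koszul A (koszul A M z) x) vs"
    using Suc.IH[OF iz z(2), of "y # us"] us(1) by auto
  then have "regular_seq A m (koszul A M x) (z # vs)"
    using regular_seq_koszul_swap[OF Mc zm xm regular_seq_m[OF vs(2)]] zx by simp
  then show ?case using vs(1) by (intro exI[of _ "z # vs"]) simp
qed

text \<open>The iterated Koszul complex \<open>K(M; x\<^sub>1, \<dots>, x\<^sub>n)\<close> along which \<open>regular_seq\<close> recurs.\<close>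

definition koszul_list :: "('a, 'm cone_elt) dg_module \<Rightarrow> 'a set list \<Rightarrow> ('a, 'm cone_elt) dg_module" where
  "koszul_list = foldl (koszul A)"

lemma koszul_list_simps [simp]:
  "koszul_list M [] = M" "koszul_list M (x # xs) = koszul_list (koszul A M x) xs"
  "koszul_list M (xs @ [x]) = koszul A (koszul_list M xs) x"
  by (simp_all add: koszul_list_def)

lemma regular_seq_append:
  "regular_seq A m M (xs @ ys) \<longleftrightarrow> regular_seq A m M xs \<and> regular_seq A m (koszul_list M xs) ys"
  by (induction xs arbitrary: M) auto

lemma inf_at_koszul_list:
  "inf_at A M i \<Longrightarrow> regular_seq A m M xs \<Longrightarrow> inf_at A (koszul_list M xs) i"
proof (induction xs arbitrary: M)
  case (Cons x xs)
  then show ?case using regular_elt_iff_koszul_inf[OF Cons.prems(1), of x] regular_elt_m[of M x] by simp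
qed simp

lemma regular_seq_exchange_list:
  assumes "inf_at A M i" "regular_seq A m M xs" "regular_seq A m M ys" "length ys = length xs + d"
  shows "\<exists>zs. length zs = d \<and> regular_seq A m (koszul_list M xs) zs"
  using assms
proof (induction xs arbitrary: M ys)
  case (Cons x xs)
  then obtain zs where "length zs = length xs + d" "regular_seq A m (koszul A M x) zs"
    using regular_seq_exchange[of M i x ys "length xs + d"] by auto
  then show ?case
    using Cons.IH[of "koszul A M x" zs] Cons.prems regular_elt_iff_koszul_inf[OF Cons.prems(1)]
    by (auto dest: regular_elt_m)
qed auto


subsection \<open>Chains of primes from regular sequences\<close>

text \<open>The elements of \<open>N = H\<^sup>i(M)\<close> killed by \<open>P = Ann z\<close> form a submodule \<open>W \<noteq> 0\<close>, and
  \<open>W \<inter> x N = x W \<noteq> W\<close> by Nakayama. An element of \<open>W\<close> outside \<open>x N\<close> survives in \<open>H\<^sup>i(K(M; x))\<close> and is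
  killed by \<open>P\<close> and \<open>x\<close>.\<close>

lemma larger_associated_prime:
  assumes M: "inf_at A M i" and x: "regular_elt m M x"
    and z: "z \<in> carrier (cohomology M i)" "z \<noteq> \<zero>\<^bsub>cohomology M i\<^esub>"
    and P: "P = ann (H0 A) (cohomology M i) z"
  obtains y where "y \<in> carrier (cohomology (koszul A M x) i)" "y \<noteq> \<zero>\<^bsub>cohomology (koszul A M x) i\<^esub>"
    "primeideal (ann (H0 A) (cohomology (koszul A M x) i) y) (H0 A)"
    "P \<subset> ann (H0 A) (cohomology (koszul A M x) i) y"
proof -
  let ?N = "cohomology M i" and ?K = "cohomology (koszul A M x) i"
  have xm: "x \<in> m" and nzd: "nonzerodivisor ?N x" using x regular_elt_inf_at[OF M] by auto
  have xc: "x \<in> carrier (H0 A)" by (rule m_carrier[OF xm])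
  note Mc = inf_atD(1)[OF M]
  interpret N: module "H0 A" ?N using dg_complex.cohomology_module[OF Mc] .
  interpret K: module "H0 A" ?K using dg_complex.cohomology_module[OF koszul_dg_complex[OF Mc xm]] .
  define W where "W = {w \<in> carrier ?N. \<forall>r\<in>P. r \<odot>\<^bsub>?N\<^esub> w = \<zero>\<^bsub>?N\<^esub>}"
  have Pc: "r \<in> carrier (H0 A)" if "r \<in> P" for r using that P by (simp add: ann_def)
  have sub: "submodule W (H0 A) ?N"
    unfolding N.submodule_iff
  proof (intro conjI ballI)
    show "t \<odot>\<^bsub>?N\<^esub> w \<in> W" if t: "t \<in> carrier (H0 A)" and w: "w \<in> W" for t w
    proof -
      have wc: "w \<in> carrier ?N" using w by (simp add: W_def)
      have "r \<odot>\<^bsub>?N\<^esub> (t \<odot>\<^bsub>?N\<^esub> w) = \<zero>\<^bsub>?N\<^esub>" if r: "r \<in> P" for r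
      proof -
        have "r \<odot>\<^bsub>?N\<^esub> (t \<odot>\<^bsub>?N\<^esub> w) = t \<odot>\<^bsub>?N\<^esub> (r \<odot>\<^bsub>?N\<^esub> w)" by (rule N.smult_commute[OF t Pc[OF r] wc])
        then show ?thesis using w r t by (simp add: W_def)
      qed
      then show ?thesis using t wc by (simp add: W_def)
    qed
  qed (auto simp: W_def Pc N.smult_r_distr)
  have zW: "z \<in> W" using z P by (auto simp: W_def ann_def)
  have "\<exists>w\<in>W. \<forall>s\<in>carrier (H0 A) - m. \<forall>v\<in>W. s \<odot>\<^bsub>?N\<^esub> w \<noteq> x \<odot>\<^bsub>?N\<^esub> v"
    by (rule nakayama_at_prime[OF inf_atD(2)[OF M] sub local_ringD(3)[OF local] xm zW
          ann_subset_m[OF N.module_axioms z]])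
  then obtain w where w: "w \<in> W" "\<forall>s\<in>carrier (H0 A) - m. \<forall>v\<in>W. s \<odot>\<^bsub>?N\<^esub> w \<noteq> x \<odot>\<^bsub>?N\<^esub> v" by blast
  have wc: "w \<in> carrier ?N" using w(1) by (simp add: W_def)
  have one: "\<one>\<^bsub>H0 A\<^esub> \<in> carrier (H0 A) - m" using local_ringD(5)[OF local] N.R.one_closed by blast
  have wx: "w \<noteq> x \<odot>\<^bsub>?N\<^esub> v" if v: "v \<in> carrier ?N" for v
  proof
    assume e: "w = x \<odot>\<^bsub>?N\<^esub> v"
    have "r \<odot>\<^bsub>?N\<^esub> v = \<zero>\<^bsub>?N\<^esub>" if r: "r \<in> P" for r
    proof -
      have "x \<odot>\<^bsub>?N\<^esub> (r \<odot>\<^bsub>?N\<^esub> v) = r \<odot>\<^bsub>?N\<^esub> w" unfolding e by (rule N.smult_commute[OF Pc[OF r] xc v])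
      then have "x \<odot>\<^bsub>?N\<^esub> (r \<odot>\<^bsub>?N\<^esub> v) = \<zero>\<^bsub>?N\<^esub>" using w(1) r by (simp add: W_def)
      then show ?thesis using nzd Pc[OF r] v by (simp add: nonzerodivisor_def)
    qed
    then have "v \<in> W" using v by (simp add: W_def)
    then have "\<one>\<^bsub>H0 A\<^esub> \<odot>\<^bsub>?N\<^esub> w \<noteq> x \<odot>\<^bsub>?N\<^esub> v" using w(2) one by blast
    then show False using e N.smult_one[OF wc] by simp
  qed
  obtain \<iota> where \<iota>: "linear_map (H0 A) ?N ?K \<iota>"
    "\<forall>y\<in>carrier ?N. \<iota> y = \<zero>\<^bsub>?K\<^esub> \<longleftrightarrow> (\<exists>w\<in>carrier ?N. y = x \<odot>\<^bsub>?N\<^esub> w)"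
    by (rule koszul_exact_sequence[OF Mc xm, of i], rule that)
  have iw: "\<iota> w \<in> carrier ?K" "\<iota> w \<noteq> \<zero>\<^bsub>?K\<^esub>" using linear_mapD(1)[OF \<iota>(1) wc] bspec[OF \<iota>(2) wc] wx by auto
  have i0: "\<iota> \<zero>\<^bsub>?N\<^esub> = \<zero>\<^bsub>?K\<^esub>" by (rule linear_map_zero_minus(1)[OF \<iota>(1) N.module_axioms K.module_axioms])
  have "P \<subseteq> ann (H0 A) ?K (\<iota> w)"
  proof
    fix r assume r: "r \<in> P"
    have "r \<odot>\<^bsub>?K\<^esub> \<iota> w = \<iota> (r \<odot>\<^bsub>?N\<^esub> w)" using linear_mapD(3)[OF \<iota>(1) Pc[OF r] wc] by simp
    then show "r \<in> ann (H0 A) ?K (\<iota> w)" using w(1) r i0 Pc by (simp add: W_def ann_def)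
  qed
  moreover have "x \<in> ann (H0 A) ?K (\<iota> w)"
  proof -
    have "x \<odot>\<^bsub>?K\<^esub> \<iota> w = \<iota> (x \<odot>\<^bsub>?N\<^esub> w)" using linear_mapD(3)[OF \<iota>(1) xc wc] by simp
    moreover have "\<iota> (x \<odot>\<^bsub>?N\<^esub> w) = \<zero>\<^bsub>?K\<^esub>" using bspec[OF \<iota>(2) N.smult_closed[OF xc wc]] wc by auto
    ultimately show ?thesis using xc by (simp add: ann_def)
  qed
  moreover have "x \<notin> P" using nzd z P by (auto simp: nonzerodivisor_def ann_def)
  ultimately have "P \<subset> ann (H0 A) ?K (\<iota> w)" by blast
  moreover obtain y where "y \<in> carrier ?K" "y \<noteq> \<zero>\<^bsub>?K\<^esub>" "ann (H0 A) ?K (\<iota> w) \<subseteq> ann (H0 A) ?K y"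
    "primeideal (ann (H0 A) ?K y) (H0 A)"
    using exists_maximal_ann[OF noetherian K.module_axioms iw] by (elim bexE conjE) (rule that)
  ultimately show ?thesis by (intro that[of y]) auto
qed

text \<open>The DG-version of the inequality \<open>depth M \<le> dim R/P\<close> for associated primes \<open>P\<close>.\<close>

lemma prime_chain_above_associated_prime:
  assumes "inf_at A M i" "regular_seq A m M xs"
    and "z \<in> carrier (cohomology M i)" "z \<noteq> \<zero>\<^bsub>cohomology M i\<^esub>"
    and "primeideal (ann (H0 A) (cohomology M i) z) (H0 A)"
  shows "\<exists>P. prime_chain (H0 A) (length xs) P \<and> P 0 = ann (H0 A) (cohomology M i) z"
  using assms
proof (induction xs arbitrary: M z)
  case Nil
  then show ?case by (intro exI[of _ "\<lambda>_. ann (H0 A) (cohomology M i) z"]) (auto simp: prime_chain_def)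
next
  case (Cons x xs)
  have x: "regular_elt m M x" and xs: "regular_seq A m (koszul A M x) xs" using Cons.prems(2) by auto
  have iK: "inf_at A (koszul A M x) i" using regular_elt_iff_koszul_inf[OF Cons.prems(1) regular_elt_m[OF x]] x by simp
  obtain y where y: "y \<in> carrier (cohomology (koszul A M x) i)" "y \<noteq> \<zero>\<^bsub>cohomology (koszul A M x) i\<^esub>"
    "primeideal (ann (H0 A) (cohomology (koszul A M x) i) y) (H0 A)"
    "ann (H0 A) (cohomology M i) z \<subset> ann (H0 A) (cohomology (koszul A M x) i) y"
    by (rule larger_associated_prime[OF Cons.prems(1) x Cons.prems(3,4) refl])
  obtain P where P: "prime_chain (H0 A) (length xs) P" "P 0 = ann (H0 A) (cohomology (koszul A M x) i) y"
    using Cons.IH[OF iK xs y(1-3)] by blast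
  let ?P = "case_nat (ann (H0 A) (cohomology M i) z) P"
  have "prime_chain (H0 A) (length (x # xs)) ?P"
    using P y(4) Cons.prems(5) by (auto simp: prime_chain_def split: nat.split)
  then show ?case by (intro exI[of _ ?P]) simp
qed

text \<open>The exact sequence shows that \<open>x\<^sup>2\<close> annihilates the cohomology of \<open>K(M; x)\<close>.\<close>

lemma total_support_koszul:
  assumes Mc: "dg_complex A M" and x: "x \<in> m" and P: "P \<in> total_support A (koszul A M x)"
  shows "P \<in> total_support A M" "x \<in> P"
proof -
  obtain n z where z: "z \<in> carrier (cohomology (koszul A M x) n)" "ann (H0 A) (cohomology (koszul A M x) n) z \<subseteq> P"
    and P: "primeideal P (H0 A)" using P by (auto simp: total_support_def module_support_def)
  let ?K = "cohomology (koszul A M x) n"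
  let ?N = "cohomology M n" and ?N' = "cohomology M (n + 1)"
  interpret P: primeideal P "H0 A" by fact
  have xc: "x \<in> carrier (H0 A)" by (rule m_carrier[OF x])
  interpret N: module "H0 A" ?N using dg_complex.cohomology_module[OF Mc] .
  interpret N': module "H0 A" ?N' using dg_complex.cohomology_module[OF Mc] .
  interpret K: module "H0 A" ?K using dg_complex.cohomology_module[OF koszul_dg_complex[OF Mc x]] .
  obtain \<iota> \<delta> where \<iota>: "linear_map (H0 A) ?N ?K \<iota>" and \<delta>: "linear_map (H0 A) ?K ?N' \<delta>"
    and \<iota>0: "\<forall>y\<in>carrier ?N. \<iota> y = \<zero>\<^bsub>?K\<^esub> \<longleftrightarrow> (\<exists>w\<in>carrier ?N. y = x \<odot>\<^bsub>?N\<^esub> w)"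
    and ker: "\<forall>y\<in>carrier ?K. \<delta> y = \<zero>\<^bsub>?N'\<^esub> \<longleftrightarrow> y \<in> \<iota> ` carrier ?N"
    and im: "\<delta> ` carrier ?K = {y \<in> carrier ?N'. x \<odot>\<^bsub>?N'\<^esub> y = \<zero>\<^bsub>?N'\<^esub>}"
    by (rule koszul_exact_sequence[OF Mc x, of n], rule that)
  have dz: "\<delta> z \<in> carrier ?N'" "x \<odot>\<^bsub>?N'\<^esub> \<delta> z = \<zero>\<^bsub>?N'\<^esub>" using im z(1) by auto
  show "x \<in> P"
  proof -
    have xz: "x \<odot>\<^bsub>?K\<^esub> z \<in> carrier ?K" using xc z(1) by simp
    have "\<delta> (x \<odot>\<^bsub>?K\<^esub> z) = \<zero>\<^bsub>?N'\<^esub>" using linear_mapD(3)[OF \<delta> xc z(1)] dz by simp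
    then have "x \<odot>\<^bsub>?K\<^esub> z \<in> \<iota> ` carrier ?N" using bspec[OF ker xz] by simp
    then obtain w where w: "x \<odot>\<^bsub>?K\<^esub> z = \<iota> w" "w \<in> carrier ?N" by (rule imageE)
    have "x \<odot>\<^bsub>?K\<^esub> (x \<odot>\<^bsub>?K\<^esub> z) = \<iota> (x \<odot>\<^bsub>?N\<^esub> w)" using linear_mapD(3)[OF \<iota> xc w(2)] w(1) by simp
    also have "\<dots> = \<zero>\<^bsub>?K\<^esub>" using bspec[OF \<iota>0 N.smult_closed[OF xc w(2)]] w(2) by auto
    finally have "x \<otimes>\<^bsub>H0 A\<^esub> x \<in> ann (H0 A) ?K z" using xc z(1) by (simp add: ann_def K.smult_assoc1)
    then show ?thesis using z(2) P.I_prime[OF xc xc] by blast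
  qed
  show "P \<in> total_support A M"
  proof (cases "ann (H0 A) ?N' (\<delta> z) \<subseteq> P")
    case True
    then show ?thesis using dz(1) P by (auto simp: total_support_def module_support_def)
  next
    case False
    then obtain s where s: "s \<in> carrier (H0 A)" "s \<notin> P" "s \<odot>\<^bsub>?N'\<^esub> \<delta> z = \<zero>\<^bsub>?N'\<^esub>" by (auto simp: ann_def)
    have sz: "s \<odot>\<^bsub>?K\<^esub> z \<in> carrier ?K" using s z(1) by simp
    have "\<delta> (s \<odot>\<^bsub>?K\<^esub> z) = \<zero>\<^bsub>?N'\<^esub>" using linear_mapD(3)[OF \<delta> s(1) z(1)] s(3) by simp
    then have "s \<odot>\<^bsub>?K\<^esub> z \<in> \<iota> ` carrier ?N" using bspec[OF ker sz] by simp
    then obtain w where w: "s \<odot>\<^bsub>?K\<^esub> z = \<iota> w" "w \<in> carrier ?N" by (rule imageE)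
    have "ann (H0 A) ?N w \<subseteq> P"
    proof
      fix r assume r: "r \<in> ann (H0 A) ?N w"
      then have rc: "r \<in> carrier (H0 A)" "r \<odot>\<^bsub>?N\<^esub> w = \<zero>\<^bsub>?N\<^esub>" by (auto simp: ann_def)
      have "r \<odot>\<^bsub>?K\<^esub> (s \<odot>\<^bsub>?K\<^esub> z) = \<iota> (r \<odot>\<^bsub>?N\<^esub> w)" using linear_mapD(3)[OF \<iota> rc(1) w(2)] w(1) by simp
      also have "\<dots> = \<zero>\<^bsub>?K\<^esub>" using rc(2) linear_map_zero_minus(1)[OF \<iota> N.module_axioms K.module_axioms] by simp
      finally have "r \<otimes>\<^bsub>H0 A\<^esub> s \<in> ann (H0 A) ?K z" using rc s z(1) by (simp add: ann_def K.smult_assoc1)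
      then show "r \<in> P" using z(2) P.I_prime[OF rc(1) s(1)] s(2) by blast
    qed
    then show ?thesis using w(2) P by (auto simp: total_support_def module_support_def)
  qed
qed

text \<open>By Nakayama at \<open>P\<close>, some \<open>w \<in> H\<^sup>i(M)\<close> stays outside \<open>x H\<^sup>i(M)\<close> after localizing at \<open>P \<ni> x\<close>, and
  \<open>H\<^sup>i(M) / x H\<^sup>i(M)\<close> embeds into \<open>H\<^sup>i(K(M; x))\<close>.\<close>

lemma module_support_koszul:
  assumes M: "inf_at A M i" and x: "x \<in> m" and P: "P \<in> module_support (H0 A) (cohomology M i)" "x \<in> P"
  shows "P \<in> module_support (H0 A) (cohomology (koszul A M x) i)"
proof -
  let ?N = "cohomology M i" and ?K = "cohomology (koszul A M x) i"
  note Mc = inf_atD(1)[OF M]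
  interpret N: module "H0 A" ?N using dg_complex.cohomology_module[OF Mc] .
  obtain z where z: "z \<in> carrier ?N" "ann (H0 A) ?N z \<subseteq> P" and Pp: "primeideal P (H0 A)"
    using P(1) by (auto simp: module_support_def)
  have "\<exists>w\<in>carrier ?N. \<forall>s\<in>carrier (H0 A) - P. \<forall>v\<in>carrier ?N. s \<odot>\<^bsub>?N\<^esub> w \<noteq> x \<odot>\<^bsub>?N\<^esub> v"
    by (rule nakayama_at_prime[OF inf_atD(2)[OF M] N.carrier_is_submodule Pp P(2) z])
  then obtain w where w: "w \<in> carrier ?N" "\<forall>s\<in>carrier (H0 A) - P. \<forall>v\<in>carrier ?N. s \<odot>\<^bsub>?N\<^esub> w \<noteq> x \<odot>\<^bsub>?N\<^esub> v"
    by blast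
  obtain \<iota> where \<iota>: "linear_map (H0 A) ?N ?K \<iota>"
    "\<forall>y\<in>carrier ?N. \<iota> y = \<zero>\<^bsub>?K\<^esub> \<longleftrightarrow> (\<exists>w\<in>carrier ?N. y = x \<odot>\<^bsub>?N\<^esub> w)"
    by (rule koszul_exact_sequence[OF Mc x, of i], rule that)
  have "ann (H0 A) ?K (\<iota> w) \<subseteq> P"
  proof
    fix r assume r: "r \<in> ann (H0 A) ?K (\<iota> w)"
    then have rc: "r \<in> carrier (H0 A)" by (simp add: ann_def)
    then have "\<iota> (r \<odot>\<^bsub>?N\<^esub> w) = \<zero>\<^bsub>?K\<^esub>" using r linear_mapD(3)[OF \<iota>(1) rc w(1)] by (simp add: ann_def)
    then have "\<exists>v\<in>carrier ?N. r \<odot>\<^bsub>?N\<^esub> w = x \<odot>\<^bsub>?N\<^esub> v" using bspec[OF \<iota>(2) N.smult_closed[OF rc w(1)]] by simp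
    then show "r \<in> P" using w(2) rc by auto
  qed
  then show ?thesis using linear_mapD(1)[OF \<iota>(1) w(1)] Pp by (auto simp: module_support_def)
qed

text \<open>Constant amplitude, in the form \<open>total_support A M \<subseteq> Supp H\<^sup>i(M)\<close>, is inherited by
  \<open>K(M; x)\<close> for regular \<open>x\<close>: both sides are cut down to the primes that contain \<open>x\<close>.\<close>

lemma constant_amplitude_koszul_list:
  assumes M: "inf_at A M i" and ca: "total_support A M \<subseteq> module_support (H0 A) (cohomology M i)"
    and xs: "regular_seq A m M xs"
  shows "total_support A (koszul_list M xs) \<subseteq> module_support (H0 A) (cohomology (koszul_list M xs) i)"
  using assms
proof (induction xs arbitrary: M)
  case (Cons x xs)
  have x: "regular_elt m M x" and xs: "regular_seq A m (koszul A M x) xs" using Cons.prems(3) by auto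
  note xm = regular_elt_m[OF x]
  have iK: "inf_at A (koszul A M x) i" using regular_elt_iff_koszul_inf[OF Cons.prems(1) xm] x by simp
  have "total_support A (koszul A M x) \<subseteq> module_support (H0 A) (cohomology (koszul A M x) i)"
    using total_support_koszul[OF inf_atD(1)[OF Cons.prems(1)] xm] module_support_koszul[OF Cons.prems(1) xm]
      Cons.prems(2) by blast
  then show ?case using Cons.IH[OF iK _ xs] by simp
qed simp

text \<open>A prime in the support of \<open>K(M; x\<^sub>1, \<dots>, x\<^sub>n)\<close> contains \<open>x\<^sub>n\<close>, whereas \<open>x\<^sub>n\<close>, being regular, avoids some
  smaller prime of the support of \<open>K(M; x\<^sub>1, \<dots>, x\<^sub>n\<^sub>-\<^sub>1)\<close>. So each element contributes a step.\<close>

lemma prime_chain_below: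
  assumes M: "inf_at A M i" and ca: "total_support A M \<subseteq> module_support (H0 A) (cohomology M i)"
    and xs: "regular_seq A m M xs" and P: "P \<in> total_support A (koszul_list M xs)"
  shows "\<exists>Q. prime_chain (H0 A) (length xs) Q \<and> Q (length xs) = P"
  using xs P
proof (induction xs arbitrary: P rule: rev_induct)
  case Nil
  then show ?case
    by (intro exI[of _ "\<lambda>_. P"]) (auto simp: prime_chain_def total_support_def module_support_def)
next
  case (snoc x xs)
  have xs: "regular_seq A m M xs" and x: "regular_elt m (koszul_list M xs) x"
    using snoc.prems(1) by (auto simp: regular_seq_append)
  note iN = inf_at_koszul_list[OF M xs]
  have PN: "P \<in> total_support A (koszul_list M xs)" and xP: "x \<in> P"
    using total_support_koszul[OF inf_atD(1)[OF iN] regular_elt_m[OF x], of P] snoc.prems(2) by auto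
  have "P \<in> module_support (H0 A) (cohomology (koszul_list M xs) i)"
    using constant_amplitude_koszul_list[OF M ca xs] PN by blast
  then obtain Q where Q: "Q \<in> module_support (H0 A) (cohomology (koszul_list M xs) i)" "Q \<subseteq> P" "x \<notin> Q"
    using nonzerodivisor_avoids_smaller_support_prime[OF noetherian
        dg_complex.cohomology_module[OF inf_atD(1)[OF iN]], of P i x] x regular_elt_inf_at[OF iN] m_carrier by blast
  obtain C where C: "prime_chain (H0 A) (length xs) C" "C (length xs) = Q"
    using snoc.IH[OF xs, of Q] Q(1) by (auto simp: total_support_def)
  have "primeideal P (H0 A)" using PN by (auto simp: total_support_def module_support_def)
  then have "prime_chain (H0 A) 1 (\<lambda>j. if j = 0 then Q else P)"
    using Q xP C by (auto simp: prime_chain_def module_support_def)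
  from prime_chain_append[OF C(1) this] C(2) show ?case by fastforce
qed

lemma total_support_koszul_list:
  assumes M: "inf_at A M i" and xs: "regular_seq A m M xs"
    and P: "P \<in> module_support (H0 A) (cohomology M i)" "set xs \<subseteq> P"
  shows "P \<in> total_support A (koszul_list M xs)"
  using assms
proof (induction xs arbitrary: M)
  case Nil
  then show ?case by (auto simp: total_support_def)
next
  case (Cons x xs)
  have x: "regular_elt m M x" and xs: "regular_seq A m (koszul A M x) xs" using Cons.prems(2) by auto
  note xm = regular_elt_m[OF x]
  have iK: "inf_at A (koszul A M x) i" using regular_elt_iff_koszul_inf[OF Cons.prems(1) xm] x by simp
  show ?case using Cons.IH[OF iK xs module_support_koszul[OF Cons.prems(1) xm Cons.prems(3)]] Cons.prems(4) by simp
qed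

text \<open>Each extension of a regular sequence by a further regular element enlarges the intersection of
  the primes in the support, so that the ascending chain condition provides a maximal sequence.\<close>

lemma exists_maximal_regular_seq:
  assumes M: "inf_at A M i"
  shows "\<exists>xs. set xs \<subseteq> I \<and> regular_seq A m M xs \<and> (\<forall>x\<in>I. \<not> regular_elt m (koszul_list M xs) x)"
proof -
  interpret R: noetherian_ring "H0 A" by (rule noetherian)
  define J where "J xs = \<Inter>(total_support A (koszul_list M xs))" for xs
  define F where "F = {J xs | xs. set xs \<subseteq> I \<and> regular_seq A m M xs}"
  have bottom: "\<exists>P. P \<in> module_support (H0 A) (cohomology N i)" if N: "inf_at A N i"
    for N :: "('a, 'd cone_elt) dg_module"
  proof -
    obtain z where z: "z \<in> carrier (cohomology N i)" "z \<noteq> \<zero>\<^bsub>cohomology N i\<^esub>" using inf_atD(4)[OF N] by blast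
    have "ann (H0 A) (cohomology N i) z \<subseteq> m"
      by (rule ann_subset_m[OF dg_complex.cohomology_module[OF inf_atD(1)[OF N]] z])
    then show ?thesis using z(1) local_ringD(3)[OF local] by (auto simp: module_support_def)
  qed
  have ideal: "ideal (J xs) (H0 A)" if xs: "regular_seq A m M xs" for xs
    unfolding J_def
  proof (rule R.i_Intersect)
    show "total_support A (koszul_list M xs) \<noteq> {}"
      using bottom[OF inf_at_koszul_list[OF M xs]] by (auto simp: total_support_def)
  qed (auto simp: total_support_def module_support_def dest: primeideal.axioms(1))
  have "F \<subseteq> {I. ideal I (H0 A)}" using ideal by (auto simp: F_def)
  moreover have "J [] \<in> F" unfolding F_def by (auto intro!: exI[of _ "[]"])
  ultimately have "\<exists>K\<in>F. J [] \<subseteq> K \<and> (\<forall>L\<in>F. K \<subseteq> L \<longrightarrow> L = K)" by (rule R.maximal_ideal_of_family)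
  then obtain xs where xs: "set xs \<subseteq> I" "regular_seq A m M xs" and max: "\<forall>L\<in>F. J xs \<subseteq> L \<longrightarrow> L = J xs"
    unfolding F_def by auto
  have "\<not> regular_elt m (koszul_list M xs) x" if xI: "x \<in> I" for x
  proof
    let ?N = "koszul_list M xs"
    assume x: "regular_elt m ?N x"
    note xm = regular_elt_m[OF x] and iN = inf_at_koszul_list[OF M xs(2)]
    have "regular_seq A m M (xs @ [x])" using xs x by (simp add: regular_seq_append)
    then have "J (xs @ [x]) \<in> F" unfolding F_def using xs(1) xI by (auto intro!: exI[of _ "xs @ [x]"])
    moreover note ts = total_support_koszul[OF inf_atD(1)[OF iN] xm]
    have "J xs \<subseteq> J (xs @ [x])" unfolding J_def using ts(1) by auto
    ultimately have "J (xs @ [x]) = J xs" using max by blast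
    moreover have "x \<in> J (xs @ [x])" unfolding J_def using ts(2) by auto
    moreover have "x \<notin> J xs"
    proof -
      obtain P where "P \<in> module_support (H0 A) (cohomology ?N i)" using bottom[OF iN] by blast
      then obtain Q where "Q \<in> module_support (H0 A) (cohomology ?N i)" "x \<notin> Q"
        using nonzerodivisor_avoids_smaller_support_prime[OF noetherian
            dg_complex.cohomology_module[OF inf_atD(1)[OF iN]], of P i x] x regular_elt_inf_at[OF iN] m_carrier by blast
      then show ?thesis by (auto simp: J_def total_support_def)
    qed
    ultimately show False by simp
  qed
  then show ?thesis using xs by blast
qed

end

subsection \<open>The depth formula\<close>

lemma Sup_of_greatest_nat:
  assumes "Q d" "\<And>n. Q n \<Longrightarrow> n \<le> d"
  shows "Sup {ereal (real n) | n. Q n} = ereal (real d)"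
  by (rule Sup_eqI) (use assms in auto)

lemma greatest_nat_exists:
  assumes "Q (k::nat)" "\<And>n. Q n \<Longrightarrow> n \<le> b"
  obtains d where "Q d" "\<And>n. Q n \<Longrightarrow> n \<le> d"
proof -
  have "finite {n. Q n}" using assms(2) by (auto intro: finite_subset[of _ "{..b}"])
  then show ?thesis using that[of "Max {n. Q n}"] Max_in[of "{n. Q n}"] Max_ge[of "{n. Q n}"] assms(1) by blast
qed

text \<open>Let \<open>d = dim H\<^sup>0(A)\<close>. A regular sequence of length \<open>n\<close> in \<open>I\<close> provides a chain of \<open>n\<close>
  primes below any prime containing \<open>I\<close>, so that \<open>n + dim H\<^sup>0(A)/I \<le> d\<close>. For a maximal one, the bottom
  cohomology of the Koszul complex has an associated prime \<open>P\<close> containing \<open>I\<close>, and a regular sequence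
  of length \<open>d - n\<close> by exchange; this gives \<open>d - n \<le> dim H\<^sup>0(A)/P\<close>.\<close>

lemma (in local_dg_ring) seq_depth_formula:
  assumes E: "inf_at A (embed M) i"
    and full: "\<And>P. primeideal P (H0 A) \<Longrightarrow> P \<in> module_support (H0 A) (cohomology (embed M) i)"
    and cm: "\<And>n P. prime_chain (H0 A) n P \<Longrightarrow> \<exists>xs. length xs = n \<and> regular_seq A m (embed M) xs"
    and I: "ideal I (H0 A)" "I \<noteq> carrier (H0 A)"
  shows "seq_depth A m I M = krull_dim (H0 A) - krull_dim (H0 A Quot I)"
proof -
  let ?R = "H0 A" and ?E = "embed M"
  note R = H0_cring
  have Im: "I \<subseteq> m" by (rule proper_ideal_subset_maximal[OF noetherian local I])
  have ca: "total_support A ?E \<subseteq> module_support ?R (cohomology ?E i)"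
    using full by (auto simp: total_support_def module_support_def)
  define D where "D n \<longleftrightarrow> (\<exists>P. prime_chain ?R n P)" for n
  define DI where "DI n \<longleftrightarrow> (\<exists>P. prime_chain ?R n P \<and> I \<subseteq> P 0)" for n
  define Sq where "Sq n \<longleftrightarrow> (\<exists>xs. n = length xs \<and> set xs \<subseteq> I \<and> regular_seq A m ?E xs)" for n
  have chain0: "prime_chain ?R 0 (\<lambda>_. m)" using local_ringD(3)[OF local] by (simp add: prime_chain_def)
  have D0: "D 0" and DI0: "DI 0" using chain0 Im by (auto simp: D_def DI_def)
  obtain xs0 where xs0: "regular_seq A m ?E xs0" "\<forall>x\<in>m. \<not> regular_elt m (koszul_list ?E xs0) x"
    using exists_maximal_regular_seq[OF E, of m] by blast
  \<comment> \<open>No regular sequence is longer than a maximal one, by exchange. So \<open>dim H\<^sup>0(A)\<close> is finite.\<close>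
  have bound: "n \<le> length xs0" if n: "D n" for n
  proof (rule ccontr)
    assume "\<not> n \<le> length xs0"
    then obtain k where k: "n = length xs0 + Suc k" by (metis add_Suc_right less_imp_Suc_add not_le)
    obtain ys where ys: "length ys = n" "regular_seq A m ?E ys" using cm n by (auto simp: D_def)
    obtain zs where zs: "length zs = Suc k" "regular_seq A m (koszul_list ?E xs0) zs"
      using regular_seq_exchange_list[OF E xs0(1) ys(2)] ys(1) k by blast
    obtain w ws where "zs = w # ws" using zs(1) by (cases zs) auto
    then show False using zs(2) xs0(2) regular_elt_m by auto
  qed
  obtain d where d: "D d" "\<And>n. D n \<Longrightarrow> n \<le> d" using greatest_nat_exists[of D, OF D0 bound] by blast
  have "n \<le> d" if "DI n" for n using that d(2) by (auto simp: D_def DI_def)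
  then obtain e where e: "DI e" "\<And>n. DI n \<Longrightarrow> n \<le> e" using greatest_nat_exists[of DI, OF DI0] by blast
  have upper: "n + k \<le> d" if n: "Sq n" and k: "DI k" for n k
  proof -
    obtain xs where xs: "n = length xs" "set xs \<subseteq> I" "regular_seq A m ?E xs" using n by (auto simp: Sq_def)
    obtain P where P: "prime_chain ?R k P" "I \<subseteq> P 0" using k by (auto simp: DI_def)
    have "primeideal (P 0) ?R" using P(1) by (simp add: prime_chain_def)
    then have "P 0 \<in> total_support A (koszul_list ?E xs)"
      using total_support_koszul_list[OF E xs(3) full] xs(2) P(2) by blast
    then obtain Q where Q: "prime_chain ?R n Q" "Q n = P 0"
      using prime_chain_below[OF E ca xs(3)] xs(1) by blast
    then have "D (n + k)" using prime_chain_append[OF Q(1) P(1)] by (auto simp: D_def)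
    then show ?thesis by (rule d(2))
  qed
  obtain xs where xs: "set xs \<subseteq> I" "regular_seq A m ?E xs" "\<forall>x\<in>I. \<not> regular_elt m (koszul_list ?E xs) x"
    using exists_maximal_regular_seq[OF E, of I] by blast
  let ?n = "length xs" and ?N = "koszul_list ?E xs"
  have Sn: "Sq ?n" using xs by (auto simp: Sq_def)
  have nd: "?n \<le> d" using upper[OF Sn DI0] by simp
  note iN = inf_at_koszul_list[OF E xs(2)]
  have "DI (d - ?n)"
  proof -
    obtain ys where ys: "length ys = d" "regular_seq A m ?E ys" using cm d(1) by (auto simp: D_def)
    obtain zs where zs: "length zs = d - ?n" "regular_seq A m ?N zs"
      using regular_seq_exchange_list[OF E xs(2) ys(2), of "d - ?n"] ys(1) nd by auto
    have "\<exists>z\<in>carrier (cohomology ?N i). z \<noteq> \<zero>\<^bsub>cohomology ?N i\<^esub> \<and> I \<subseteq> ann ?R (cohomology ?N i) z"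
    proof (rule ccontr)
      assume neg: "\<not> ?thesis"
      have z0: "z = \<zero>\<^bsub>cohomology ?N i\<^esub>" if "z \<in> carrier (cohomology ?N i)" "I \<subseteq> ann ?R (cohomology ?N i) z" for z
        using neg that by auto
      have "\<exists>x\<in>I. nonzerodivisor (cohomology ?N i) x \<and> nonzerodivisor (cohomology ?N i) x"
        by (rule common_nonzerodivisor[OF noetherian I(1) inf_atD(2)[OF iN] z0 inf_atD(2)[OF iN] z0])
      then show False using xs(3) Im regular_elt_inf_at[OF iN] by auto
    qed
    then obtain z where z: "z \<in> carrier (cohomology ?N i)" "z \<noteq> \<zero>\<^bsub>cohomology ?N i\<^esub>" "I \<subseteq> ann ?R (cohomology ?N i) z"
      by (elim bexE conjE)
    obtain y where y: "y \<in> carrier (cohomology ?N i)" "y \<noteq> \<zero>\<^bsub>cohomology ?N i\<^esub>"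
      "ann ?R (cohomology ?N i) z \<subseteq> ann ?R (cohomology ?N i) y" "primeideal (ann ?R (cohomology ?N i) y) ?R"
      using exists_maximal_ann[OF noetherian dg_complex.cohomology_module[OF inf_atD(1)[OF iN]] z(1,2)]
      by (elim bexE conjE) (rule that)
    obtain P where "prime_chain ?R (length zs) P" "P 0 = ann ?R (cohomology ?N i) y"
      using prime_chain_above_associated_prime[OF iN zs(2) y(1,2,4)] by blast
    then show ?thesis using zs(1) z(3) y(3) by (auto simp: DI_def)
  qed
  then have "d - ?n \<le> e" by (rule e(2))
  moreover have "?n + e \<le> d" by (rule upper[OF Sn e(1)])
  ultimately have n: "?n = d - e" "e \<le> d" using nd by auto
  have "Sup {ereal (real k) | k. Sq k} = ereal (real (d - e))"
    by (rule Sup_of_greatest_nat) (use Sn n upper[OF _ e(1)] in \<open>auto simp: le_diff_conv2\<close>)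
  moreover have "{ereal (real (length xs)) | xs. set xs \<subseteq> I \<and> regular_seq A m ?E xs} = {ereal (real k) | k. Sq k}"
    unfolding Sq_def by auto
  ultimately have "seq_depth A m I M = ereal (real (d - e))" unfolding seq_depth_def by simp
  moreover have "krull_dim ?R = ereal (real d)"
    unfolding krull_dim_prime_chain D_def[symmetric] by (rule Sup_of_greatest_nat[of D d, OF d])
  moreover have "krull_dim (?R Quot I) = ereal (real e)"
    unfolding krull_dim_prime_chain prime_chain_quotient_iff[OF R I(1)] DI_def[symmetric]
    by (rule Sup_of_greatest_nat[of DI e, OF e])
  ultimately show ?thesis using n(2) by (simp add: of_nat_diff)
qed


section \<open>Localization at the maximal ideal\<close>

context comm_dg_ring
begin

lemma homogeneous_induct:
  assumes x: "x \<in> carrier A" and zero: "P \<zero>" and hom: "\<And>n y. y \<in> deg A n \<Longrightarrow> P y"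
    and add: "\<And>y z. \<lbrakk>y \<in> carrier A; z \<in> carrier A; P y; P z\<rbrakk> \<Longrightarrow> P (y \<oplus> z)"
  shows "P x"
proof -
  obtain c where c: "\<And>n. c n \<in> deg A n" "finite {n. c n \<noteq> \<zero>}" "x = (\<Oplus>n\<in>{n. c n \<noteq> \<zero>}. c n)"
    using grading x unfolding direct_sum_grading_def decomposition_def by blast
  have cc: "c n \<in> carrier A" for n using c(1) deg_carrier by blast
  have "P (\<Oplus>n\<in>F. c n)" if "finite F" for F
    using that by (induction F rule: finite_induct) (auto simp: zero cc intro!: add hom[OF c(1)])
  then show ?thesis using c(2,3) by simp
qed

text \<open>Fractions consist of arbitrary representatives, homogeneous or not, so that centrality and
  linearity are needed on all of \<open>A\<close>.\<close>

lemma deg0_central: "a \<in> deg A 0 \<Longrightarrow> x \<in> carrier A \<Longrightarrow> x \<otimes> a = a \<otimes> x"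
proof (rule homogeneous_induct[of x])
  show "y \<otimes> a = a \<otimes> y" if "a \<in> deg A 0" "y \<in> deg A n" for n y using that by (rule deg0_mult(2))
qed (auto simp: deg_carrier l_distr r_distr)

lemma diff_deg0_linear: "a \<in> deg A 0 \<Longrightarrow> x \<in> carrier A \<Longrightarrow> diff A x \<in> carrier A \<and> diff A (a \<otimes> x) = a \<otimes> diff A x"
proof (rule homogeneous_induct[of x])
  fix n y assume "a \<in> deg A 0" "y \<in> deg A n"
  then show "diff A y \<in> carrier A \<and> diff A (a \<otimes> y) = a \<otimes> diff A y"
    using diff_mult_deg0 diff_deg deg_carrier by blast
qed (auto simp: deg_carrier diff_zero diff_add r_distr)

lemma deg0_lcomm:
  "a \<in> deg A 0 \<Longrightarrow> b \<in> deg A 0 \<Longrightarrow> x \<in> carrier A \<Longrightarrow> a \<otimes> (b \<otimes> x) = b \<otimes> (a \<otimes> x)"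
  using deg0_central[of b a] deg_carrier by (simp flip: m_assoc)

end

locale dg_localization = comm_dg_ring A for A :: "('a, 'b) dg_ring_scheme" (structure) +
  fixes S :: "'a set"
  assumes S_deg: "s \<in> S \<Longrightarrow> s \<in> deg A 0" and S_one: "\<one> \<in> S"
    and S_mult: "s \<in> S \<Longrightarrow> t \<in> S \<Longrightarrow> s \<otimes> t \<in> S"
begin

abbreviation "fr \<equiv> mod_frac (self_module A) S"
abbreviation "L \<equiv> localize A S"

lemma S_carrier: "s \<in> S \<Longrightarrow> s \<in> carrier A"
  using S_deg deg_carrier by blast

lemma fr_mem: "(y, t) \<in> fr x s \<longleftrightarrow> y \<in> carrier A \<and> t \<in> S \<and> (\<exists>u\<in>S. u \<otimes> (t \<otimes> x) = u \<otimes> (s \<otimes> y))"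
  by (simp add: mod_frac_def)

lemma fr_trans:
  assumes "(y, t) \<in> fr x s" "(z, r) \<in> fr y t" "x \<in> carrier A" "s \<in> S"
  shows "(z, r) \<in> fr x s"
proof -
  obtain u v where u: "u \<in> S" "u \<otimes> (t \<otimes> x) = u \<otimes> (s \<otimes> y)" and v: "v \<in> S" "v \<otimes> (r \<otimes> y) = v \<otimes> (t \<otimes> z)"
    and c: "y \<in> carrier A" "t \<in> S" "z \<in> carrier A" "r \<in> S" using assms by (auto simp: fr_mem)
  note simps = m_assoc deg0_lcomm S_deg S_carrier m_closed
  have "(u \<otimes> (v \<otimes> t)) \<otimes> (r \<otimes> x) = (v \<otimes> r) \<otimes> (u \<otimes> (t \<otimes> x))"
    using u(1) v(1) c assms by (simp add: simps)
  also have "\<dots> = (u \<otimes> s) \<otimes> (v \<otimes> (r \<otimes> y))" unfolding u(2) using u(1) v(1) c assms by (simp add: simps)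
  also have "\<dots> = (u \<otimes> (v \<otimes> t)) \<otimes> (s \<otimes> z)" unfolding v(2) using u(1) v(1) c assms by (simp add: simps)
  finally show ?thesis using c u(1) v(1) S_mult by (auto simp: fr_mem intro!: bexI[of _ "u \<otimes> (v \<otimes> t)"])
qed

lemma fr_eq_iff:
  assumes "x \<in> carrier A" "s \<in> S" "y \<in> carrier A" "t \<in> S"
  shows "fr x s = fr y t \<longleftrightarrow> (\<exists>u\<in>S. u \<otimes> (t \<otimes> x) = u \<otimes> (s \<otimes> y))"
proof
  assume eq: "fr x s = fr y t"
  have "(y, t) \<in> fr y t" using assms S_one by (auto simp: fr_mem)
  then have "(y, t) \<in> fr x s" unfolding eq .
  then show "\<exists>u\<in>S. u \<otimes> (t \<otimes> x) = u \<otimes> (s \<otimes> y)" by (simp add: fr_mem)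
next
  assume "\<exists>u\<in>S. u \<otimes> (t \<otimes> x) = u \<otimes> (s \<otimes> y)"
  then obtain u where u: "u \<in> S" "u \<otimes> (t \<otimes> x) = u \<otimes> (s \<otimes> y)" by blast
  then have xy: "(y, t) \<in> fr x s" and yx: "(x, s) \<in> fr y t"
    unfolding fr_mem using assms by (auto intro!: bexI[of _ u] dest: sym)
  show "fr x s = fr y t"
  proof (rule Set.set_eqI)
    fix p show "p \<in> fr x s \<longleftrightarrow> p \<in> fr y t"
      using fr_trans[OF xy _ assms(1,2)] fr_trans[OF yx _ assms(3,4)] by (cases p) blast
  qed
qed

lemma fr_self: "x \<in> carrier A \<Longrightarrow> s \<in> S \<Longrightarrow> (x, s) \<in> fr x s"
  using S_one by (auto simp: fr_mem)

lemma fr_memD: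
  assumes "(y, t) \<in> fr x s" "x \<in> carrier A" "s \<in> S"
  shows "y \<in> carrier A" "t \<in> S" "\<exists>u\<in>S. u \<otimes> (t \<otimes> x) = u \<otimes> (s \<otimes> y)"
  using assms by (auto simp: fr_mem)

lemma localize_simps:
  "carrier L = {fr x s | x s. x \<in> carrier A \<and> s \<in> S}"
  "\<zero>\<^bsub>L\<^esub> = fr \<zero> \<one>" "\<one>\<^bsub>L\<^esub> = fr \<one> \<one>"
  "deg L n = {fr x s | x s. x \<in> deg A n \<and> s \<in> S}"
  by (simp_all add: localize_def Let_def fractions_def)

lemma localize_mult:
  assumes a: "a \<in> carrier A" "s \<in> S" and b: "b \<in> carrier A" "t \<in> S"
  shows "fr a s \<otimes>\<^bsub>L\<^esub> fr b t = fr (a \<otimes> b) (s \<otimes> t)"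
proof -
  have "fr (a' \<otimes> b') (s' \<otimes> t') = fr (a \<otimes> b) (s \<otimes> t)" if a': "(a', s') \<in> fr a s" and b': "(b', t') \<in> fr b t" for a' s' b' t'
  proof -
    note ca = fr_memD[OF a' a] and cb = fr_memD[OF b' b]
    obtain u where u: "u \<in> S" "u \<otimes> (s' \<otimes> a) = u \<otimes> (s \<otimes> a')" using ca by blast
    obtain v where v: "v \<in> S" "v \<otimes> (t' \<otimes> b) = v \<otimes> (t \<otimes> b')" using cb by blast
    \<comment> \<open>Denominators are central, so that a product of cross-multiplied fractions can be regrouped.\<close>
    have aux: "(p \<otimes> (q \<otimes> x)) \<otimes> (p' \<otimes> (q' \<otimes> y)) = (p \<otimes> p') \<otimes> ((q \<otimes> q') \<otimes> (x \<otimes> y))"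
      if c: "p \<in> S" "q \<in> S" "p' \<in> S" "q' \<in> S" "x \<in> carrier A" "y \<in> carrier A" for p q p' q' x y
    proof -
      have "(p \<otimes> (q \<otimes> x)) \<otimes> (p' \<otimes> (q' \<otimes> y)) = (p \<otimes> q) \<otimes> ((x \<otimes> (p' \<otimes> q')) \<otimes> y)"
        using c S_carrier by (simp add: m_assoc)
      also have "x \<otimes> (p' \<otimes> q') = (p' \<otimes> q') \<otimes> x" using c S_mult S_deg deg0_central by blast
      finally show ?thesis using c S_carrier S_deg by (simp add: m_assoc deg0_lcomm)
    qed
    have "(u \<otimes> v) \<otimes> ((s \<otimes> t) \<otimes> (a' \<otimes> b')) = (u \<otimes> v) \<otimes> ((s' \<otimes> t') \<otimes> (a \<otimes> b))"
      using aux[of u s' v t' a b] aux[of u s v t a' b'] u v a b ca cb by simp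
    then show ?thesis using u v a b ca cb S_mult
      by (subst fr_eq_iff) (auto intro!: bexI[of _ "u \<otimes> v"])
  qed
  then have "(\<Union>(a', s')\<in>fr a s. \<Union>(b', t')\<in>fr b t. fr (a' \<otimes> b') (s' \<otimes> t')) = fr (a \<otimes> b) (s \<otimes> t)"
    using fr_self[OF a] fr_self[OF b] by fast
  then show ?thesis by (simp add: localize_def Let_def)
qed

lemma localize_add:
  assumes a: "a \<in> carrier A" "s \<in> S" and b: "b \<in> carrier A" "t \<in> S"
  shows "fr a s \<oplus>\<^bsub>L\<^esub> fr b t = fr (t \<otimes> a \<oplus> s \<otimes> b) (s \<otimes> t)"
proof -
  have "fr (t' \<otimes> a' \<oplus> s' \<otimes> b') (s' \<otimes> t') = fr (t \<otimes> a \<oplus> s \<otimes> b) (s \<otimes> t)"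
    if a': "(a', s') \<in> fr a s" and b': "(b', t') \<in> fr b t" for a' s' b' t'
  proof -
    note ca = fr_memD[OF a' a] and cb = fr_memD[OF b' b]
    obtain u where u: "u \<in> S" "u \<otimes> (s' \<otimes> a) = u \<otimes> (s \<otimes> a')" using ca by blast
    obtain v where v: "v \<in> S" "v \<otimes> (t' \<otimes> b) = v \<otimes> (t \<otimes> b')" using cb by blast
    note simps = m_assoc deg0_lcomm S_deg S_carrier m_closed r_distr
    have c: "a \<in> carrier A" "b \<in> carrier A" "a' \<in> carrier A" "b' \<in> carrier A" using a b ca cb by auto
    have S: "s \<in> S" "t \<in> S" "s' \<in> S" "t' \<in> S" "u \<in> S" "v \<in> S" using a b ca cb u v by auto
    have "(u \<otimes> v) \<otimes> ((s' \<otimes> t') \<otimes> (t \<otimes> a \<oplus> s \<otimes> b))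
      = (v \<otimes> (t' \<otimes> t)) \<otimes> (u \<otimes> (s' \<otimes> a)) \<oplus> (u \<otimes> (s' \<otimes> s)) \<otimes> (v \<otimes> (t' \<otimes> b))"
      using c S by (simp add: simps)
    also have "\<dots> = (u \<otimes> v) \<otimes> ((s \<otimes> t) \<otimes> (t' \<otimes> a' \<oplus> s' \<otimes> b'))"
      unfolding u(2) v(2) using c S by (simp add: simps)
    finally have "(u \<otimes> v) \<otimes> ((s \<otimes> t) \<otimes> (t' \<otimes> a' \<oplus> s' \<otimes> b')) = (u \<otimes> v) \<otimes> ((s' \<otimes> t') \<otimes> (t \<otimes> a \<oplus> s \<otimes> b))" ..
    moreover have "t' \<otimes> a' \<oplus> s' \<otimes> b' \<in> carrier A" "t \<otimes> a \<oplus> s \<otimes> b \<in> carrier A" using c S S_carrier by auto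
    ultimately show ?thesis using S S_mult
      by (subst fr_eq_iff) (auto intro!: bexI[of _ "u \<otimes> v"])
  qed
  then have "(\<Union>(a', s')\<in>fr a s. \<Union>(b', t')\<in>fr b t. fr (t' \<otimes> a' \<oplus> s' \<otimes> b') (s' \<otimes> t')) = fr (t \<otimes> a \<oplus> s \<otimes> b) (s \<otimes> t)"
    using fr_self[OF a] fr_self[OF b] by fast
  then show ?thesis by (simp add: localize_def Let_def)
qed

lemma localize_diff:
  assumes a: "a \<in> carrier A" "s \<in> S"
  shows "diff L (fr a s) = fr (diff A a) s"
proof -
  have "fr (diff A a') s' = fr (diff A a) s" if a': "(a', s') \<in> fr a s" for a' s'
  proof -
    note ca = fr_memD[OF a' a]
    obtain u where u: "u \<in> S" "u \<otimes> (s' \<otimes> a) = u \<otimes> (s \<otimes> a')" using ca by blast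
    have d: "diff A (p \<otimes> (q \<otimes> x)) = p \<otimes> (q \<otimes> diff A x)" if "p \<in> S" "q \<in> S" "x \<in> carrier A" for p q x
      using that S_deg S_carrier diff_deg0_linear by simp
    have "u \<otimes> (s \<otimes> diff A a') = u \<otimes> (s' \<otimes> diff A a)"
      using d[of u s' a] d[of u s a'] u a ca by simp
    moreover have "diff A a \<in> carrier A" "diff A a' \<in> carrier A"
      using diff_deg0_linear[OF one_deg] a ca by auto
    ultimately show ?thesis using u ca a by (subst fr_eq_iff) auto
  qed
  then have "(\<Union>(a', s')\<in>fr a s. fr (diff A a') s') = fr (diff A a) s"
    using fr_self[OF a] by fast
  then show ?thesis by (simp add: localize_def Let_def)
qed

definition loc :: "'a \<Rightarrow> ('a \<times> 'a) set" where "loc a = fr a \<one>"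

lemma loc_deg: "a \<in> deg A n \<Longrightarrow> loc a \<in> deg L n"
  using S_one by (auto simp: loc_def localize_simps)

lemma loc_ops:
  "a \<in> carrier A \<Longrightarrow> b \<in> carrier A \<Longrightarrow> loc (a \<oplus> b) = loc a \<oplus>\<^bsub>L\<^esub> loc b"
  "a \<in> carrier A \<Longrightarrow> b \<in> carrier A \<Longrightarrow> loc (a \<otimes> b) = loc a \<otimes>\<^bsub>L\<^esub> loc b"
  "a \<in> carrier A \<Longrightarrow> loc (diff A a) = diff L (loc a)"
  "loc \<one> = \<one>\<^bsub>L\<^esub>" "loc \<zero> = \<zero>\<^bsub>L\<^esub>"
  using S_one by (simp_all add: loc_def localize_add localize_mult localize_diff localize_simps)

text \<open>If the elements of \<open>S\<close> are invertible in \<open>H\<^sup>0(A)\<close>, localization does not change the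
  cohomology: if \<open>v s = 1 + d c\<close>, a cocycle \<open>a / s\<close> is cohomologous to \<open>v a\<close>.\<close>

lemma localization_quasi_iso:
  assumes L: "comm_dg_ring L" and inv: "\<And>s. s \<in> S \<Longrightarrow> \<exists>v\<in>deg A 0. \<exists>c\<in>deg A (-1). v \<otimes> s = \<one> \<oplus> diff A c"
  shows "quasi_iso A loc (self_module A) (self_module L) loc"
proof -
  interpret L: comm_dg_ring L by (rule L)
  interpret X: dg_complex A "self_module A" by (rule self_module_dg_complex) (rule comm_dg_ring_axioms)
  interpret Y: dg_complex L "self_module L" by (rule self_module_dg_complex[OF L])
  let ?X = "self_module A" and ?Y = "self_module L"
  have inj: "z \<in> coboundaries ?X n" if z: "z \<in> cocycles ?X n" "loc z \<in> coboundaries ?Y n" for z n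
  proof -
    obtain w where w: "w \<in> deg L (n - 1)" "loc z = diff L w" using z(2) unfolding Y.coboundaries_iff by auto
    obtain a s where a: "a \<in> deg A (n - 1)" "s \<in> S" "w = fr a s" using w(1) by (auto simp: localize_simps)
    have zc: "z \<in> carrier A" using X.cocycles_mdeg(3)[OF z(1)] by simp
    have ac: "a \<in> carrier A" "diff A a \<in> carrier A" using a deg_carrier diff_deg by blast+
    have "fr z \<one> = fr (diff A a) s" using w a ac by (simp add: loc_def localize_diff)
    then obtain u where u: "u \<in> S" "u \<otimes> (s \<otimes> z) = u \<otimes> (\<one> \<otimes> diff A a)"
      using fr_eq_iff[OF zc S_one ac(2) a(2)] by blast
    have us: "u \<otimes> s \<in> S" using S_mult u a by blast
    obtain v c where v: "v \<in> deg A 0" "c \<in> deg A (-1)" "v \<otimes> (u \<otimes> s) = \<one> \<oplus> diff A c" using inv[OF us] by blast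
    have e: "diff A c \<in> boundaries0 A" "diff A c \<in> carrier A"
      using v(2) diff_deg deg_carrier by (auto simp: boundaries0_iff)
    have vc: "v \<in> carrier A" using v(1) deg_carrier by blast
    have "u \<otimes> (s \<otimes> z) = diff A (u \<otimes> a)" using u ac diff_deg0_linear[OF S_deg[OF u(1)] ac(1)] by simp
    moreover have ua: "u \<otimes> a \<in> deg A (n - 1)" using deg0_mult(1)[OF S_deg[OF u(1)] a(1)] .
    ultimately have usz: "u \<otimes> (s \<otimes> z) \<in> coboundaries ?X n" using X.coboundariesI[of "u \<otimes> a" n] by simp
    have "v \<otimes> (u \<otimes> (s \<otimes> z)) = z \<oplus> diff A c \<otimes> z"
    proof -
      have "v \<otimes> (u \<otimes> (s \<otimes> z)) = (v \<otimes> (u \<otimes> s)) \<otimes> z" using vc u a zc S_carrier by (simp add: m_assoc)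
      then show ?thesis using v(3) e(2) zc by (simp add: l_distr)
    qed
    then have "z = v \<otimes> (u \<otimes> (s \<otimes> z)) \<oplus> \<ominus> (diff A c \<otimes> z)" using e(2) zc by (simp add: a_assoc r_neg)
    moreover have "v \<otimes> (u \<otimes> (s \<otimes> z)) \<in> coboundaries ?X n" using X.coboundaries_closed(4)[OF v(1) usz] by simp
    moreover have "\<ominus> (diff A c \<otimes> z) \<in> coboundaries ?X n"
    proof -
      have b: "diff A c \<otimes> z \<in> coboundaries ?X n" using X.boundary_smult[OF e(1) z(1)] by simp
      have "(\<ominus> \<one>) \<otimes> (diff A c \<otimes> z) \<in> coboundaries ?X n"
        using X.coboundaries_closed(4)[OF deg_closed(3)[OF one_deg] b] by simp
      then show ?thesis using e(2) zc by (simp add: l_minus)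
    qed
    ultimately show ?thesis using X.coboundaries_closed(2)[of "v \<otimes> (u \<otimes> (s \<otimes> z))" n "\<ominus> (diff A c \<otimes> z)"] by simp
  qed
  have surj: "\<exists>z\<in>cocycles ?X n. \<exists>b\<in>coboundaries ?Y n. w = loc z \<oplus>\<^bsub>?Y\<^esub> b" if w: "w \<in> cocycles ?Y n" for w n
  proof -
    have wd: "w \<in> deg L n" "diff L w = \<zero>\<^bsub>L\<^esub>" using Y.cocycles_mdeg[OF w] by auto
    obtain a s where a: "a \<in> deg A n" "s \<in> S" "w = fr a s" using wd(1) by (auto simp: localize_simps)
    have ac: "a \<in> carrier A" "diff A a \<in> carrier A" using a deg_carrier diff_deg by blast+
    have "fr (diff A a) s = fr \<zero> \<one>" using wd(2) a ac by (simp add: localize_diff localize_simps)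
    then obtain u where u: "u \<in> S" "u \<otimes> (\<one> \<otimes> diff A a) = u \<otimes> (s \<otimes> \<zero>)"
      using fr_eq_iff[OF ac(2) a(2) zero_closed S_one] by blast
    have uc: "u \<in> carrier A" "s \<in> carrier A" using u a S_carrier by auto
    have da: "diff A (u \<otimes> a) = \<zero>" using diff_deg0_linear[OF S_deg[OF u(1)] ac(1)] u(2) ac uc by simp
    have ua: "u \<otimes> a \<in> deg A n" using deg0_mult(1)[OF S_deg[OF u(1)] a(1)] .
    have us: "u \<otimes> s \<in> S" using S_mult u a by blast
    obtain v c where v: "v \<in> deg A 0" "c \<in> deg A (-1)" "v \<otimes> (u \<otimes> s) = \<one> \<oplus> diff A c" using inv[OF us] by blast
    have cc: "c \<in> carrier A" "diff A c \<in> carrier A" "v \<in> carrier A" "u \<otimes> a \<in> carrier A"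
      using v diff_deg deg_carrier ua by blast+
    let ?z = "v \<otimes> (u \<otimes> a)"
    have "diff A ?z = \<zero>" using diff_deg0_linear[OF v(1) cc(4)] da cc by simp
    then have z: "?z \<in> cocycles ?X n" using deg0_mult(1)[OF v(1) ua] by (intro X.cocyclesI) auto
    let ?y = "\<ominus> (c \<otimes> (u \<otimes> a))"
    have cu: "c \<otimes> (u \<otimes> a) \<in> deg A (n - 1)" using mult_deg[OF v(2) ua] by simp
    have "diff A (c \<otimes> (u \<otimes> a)) = diff A c \<otimes> (u \<otimes> a)"
      using leibniz[OF v(2) ua] da cc by (simp add: sgn_pow_def a_neg_zero)
    then have dy: "diff A ?y = \<ominus> (diff A c \<otimes> (u \<otimes> a))"
      using X.d_minus[of "c \<otimes> (u \<otimes> a)" "n - 1"] cu X.neg_one(2)[of "c \<otimes> (u \<otimes> a)"] X.neg_one(2)[of "diff A c \<otimes> (u \<otimes> a)"] cc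
      by (simp add: l_minus)
    let ?b = "fr ?y (u \<otimes> s)"
    have yc: "?y \<in> carrier A" using cc by simp
    have b: "diff L ?b = fr (\<ominus> (diff A c \<otimes> (u \<otimes> a))) (u \<otimes> s)" using localize_diff[OF yc us] dy by simp
    have "?b \<in> deg L (n - 1)" using deg_closed(3)[OF cu] us by (auto simp: localize_simps)
    then have "diff L ?b \<in> coboundaries ?Y n" using Y.coboundariesI[of ?b n] by simp
    moreover have "w = loc ?z \<oplus>\<^bsub>?Y\<^esub> diff L ?b"
    proof -
      have "loc ?z \<oplus>\<^bsub>L\<^esub> diff L ?b = fr ((u \<otimes> s) \<otimes> ?z \<oplus> \<one> \<otimes> \<ominus> (diff A c \<otimes> (u \<otimes> a))) (\<one> \<otimes> (u \<otimes> s))"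
        unfolding loc_def b using cc us S_one by (intro localize_add) auto
      also have "(u \<otimes> s) \<otimes> ?z = (v \<otimes> (u \<otimes> s)) \<otimes> (u \<otimes> a)"
        using deg0_lcomm[OF S_deg[OF us] v(1) cc(4)] cc us S_carrier by (simp add: m_assoc)
      also have "\<dots> \<oplus> \<one> \<otimes> \<ominus> (diff A c \<otimes> (u \<otimes> a)) = u \<otimes> a"
        unfolding v(3) using cc by (simp add: l_distr a_assoc r_neg)
      also have "fr (u \<otimes> a) (\<one> \<otimes> (u \<otimes> s)) = fr a s"
        using cc(4) us a ac u S_carrier S_deg
        by (subst fr_eq_iff) (auto intro!: bexI[of _ \<one>] simp: S_one deg0_lcomm m_assoc)
      finally show ?thesis using a(3) by simp
    qed
    ultimately show ?thesis using z by blast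
  qed
  show ?thesis unfolding quasi_iso_def
    using inj surj loc_deg loc_ops deg_carrier by auto
qed

text \<open>The isomorphism is the degree zero part of the quasi-isomorphism, computed on representatives.\<close>

lemma localization_H0_iso:
  assumes L: "comm_dg_ring L" and inv: "\<And>s. s \<in> S \<Longrightarrow> \<exists>v\<in>deg A 0. \<exists>c\<in>deg A (-1). v \<otimes> s = \<one> \<oplus> diff A c"
  shows "(\<lambda>x. proj0 L (loc (rep x))) \<in> ring_iso (H0 A) (H0 L)"
proof -
  interpret L: comm_dg_ring L by (rule L)
  have X: "dg_complex A (self_module A)" by (rule self_module_dg_complex) (rule comm_dg_ring_axioms)
  have Y: "dg_complex L (self_module L)" by (rule self_module_dg_complex[OF L])
  have q: "quasi_iso A loc (self_module A) (self_module L) loc" by (rule localization_quasi_iso[OF L inv])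
  note qD = quasi_isoD[OF q] and qb = quasi_iso_basic[OF X Y q]
  have minus: "\<ominus>\<^bsub>self_module B\<^esub> x = \<ominus>\<^bsub>B\<^esub> x" for B :: "('e, 'f) dg_ring_scheme" and x
    by (simp add: a_inv_def m_inv_def self_module_def)
  have eq: "proj0 L (loc a) = proj0 L (loc b) \<longleftrightarrow> proj0 A a = proj0 A b" if ab: "a \<in> deg A 0" "b \<in> deg A 0" for a b
  proof -
    have z: "a \<oplus> \<ominus> b \<in> cocycles (self_module A) 0"
      using cocycles_self_0 deg_closed(2)[OF ab(1) deg_closed(3)[OF ab(2)]] by simp
    have "loc (a \<oplus> \<ominus> b) = loc a \<oplus>\<^bsub>L\<^esub> \<ominus>\<^bsub>L\<^esub> loc b"
      using loc_ops(1)[of a "\<ominus> b"] qb(2)[of b 0] ab deg_carrier by (simp add: minus)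
    then show ?thesis
      unfolding L.proj0_eq_iff[OF loc_deg[OF ab(1)] loc_deg[OF ab(2)]] proj0_eq_iff[OF ab]
      using qb(5)[OF z] by simp
  qed
  define \<theta> where "\<theta> x = proj0 L (loc (rep x))" for x
  have \<theta>: "\<theta> (proj0 A a) = proj0 L (loc a)" if a: "a \<in> deg A 0" for a
    unfolding \<theta>_def using eq rep[OF proj0_closed[OF a]] a by blast
  have "\<theta> \<in> ring_iso (H0 A) (H0 L)"
  proof (rule ring_iso_memI)
    fix x assume "x \<in> carrier (H0 A)"
    then obtain a where a: "a \<in> deg A 0" "x = proj0 A a" by (auto simp: H0_carrier)
    show "\<theta> x \<in> carrier (H0 L)" using a \<theta> L.proj0_closed loc_deg by simp
    fix y assume "y \<in> carrier (H0 A)"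
    then obtain b where b: "b \<in> deg A 0" "y = proj0 A b" by (auto simp: H0_carrier)
    show "\<theta> (x \<otimes>\<^bsub>H0 A\<^esub> y) = \<theta> x \<otimes>\<^bsub>H0 L\<^esub> \<theta> y"
      using a b \<theta> H0_ops(2) L.H0_ops(2) loc_deg deg0_mult(1) loc_ops(2) deg_carrier by simp
    show "\<theta> (x \<oplus>\<^bsub>H0 A\<^esub> y) = \<theta> x \<oplus>\<^bsub>H0 L\<^esub> \<theta> y"
      using a b \<theta> H0_ops(1) L.H0_ops(1) loc_deg deg_closed(2) loc_ops(1) deg_carrier by simp
  next
    show "\<theta> \<one>\<^bsub>H0 A\<^esub> = \<one>\<^bsub>H0 L\<^esub>" using \<theta>[OF one_deg] by (simp add: H0_ops(3) L.H0_ops(3) loc_ops(4))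
    show "bij_betw \<theta> (carrier (H0 A)) (carrier (H0 L))"
      unfolding bij_betw_def
    proof
      show "inj_on \<theta> (carrier (H0 A))"
        by (rule inj_onI) (auto simp: H0_carrier \<theta> eq)
      show "\<theta> ` carrier (H0 A) = carrier (H0 L)"
      proof (intro equalityI subsetI)
        fix y assume "y \<in> carrier (H0 L)"
        then obtain w where w: "w \<in> deg L 0" "y = proj0 L w" by (auto simp: L.H0_carrier)
        then have "w \<in> cocycles (self_module L) 0" using L.cocycles_self_0 by simp
        then obtain z b where z: "z \<in> cocycles (self_module A) 0" "b \<in> boundaries0 L" "w = loc z \<oplus>\<^bsub>L\<^esub> b"
          using qD(6) by fastforce
        have z0: "z \<in> deg A 0" using z(1) cocycles_self_0 by simp
        have bc: "b \<in> carrier L" using z(2) L.diff_deg L.deg_carrier by (auto simp: L.boundaries0_iff)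
        have "loc z \<in> carrier L" using loc_deg[OF z0] L.deg_carrier by blast
        then have "w \<oplus>\<^bsub>L\<^esub> \<ominus>\<^bsub>L\<^esub> loc z = b" unfolding z(3) using bc by algebra
        then have "y = \<theta> (proj0 A z)" using L.proj0_eq_iff[OF w(1) loc_deg[OF z0]] z(2) w(2) \<theta>[OF z0] by simp
        then show "y \<in> \<theta> ` carrier (H0 A)" using proj0_closed[OF z0] by blast
      qed (auto simp: H0_carrier \<theta> L.proj0_closed loc_deg)
    qed
  qed
  then show ?thesis unfolding \<theta>_def .
qed

end

lemma embed_quasi_iso_map:
  assumes M: "dg_complex A M" and N: "dg_complex A' N" and f: "quasi_iso A \<phi> M N f"
    and \<phi>: "\<And>b. b \<in> deg A 0 \<Longrightarrow> \<phi> b \<in> deg A' 0"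
  shows "\<exists>g. quasi_iso A \<phi> (embed M) (embed N) g"
proof -
  have eM: "dg_complex A (embed M)" and eN: "dg_complex A' (embed N)" using embed_dg_complex M N by auto
  have 1: "quasi_iso A (\<lambda>c. c) (embed M) M the_elt"
    by (rule quasi_iso_isomorphism[OF eM M, where g = Elt])
      (auto simp: embed_simps(1-6) dest!: embed_simps(8))
  have 2: "quasi_iso A (\<phi> \<circ> (\<lambda>c. c)) (embed M) N (f \<circ> the_elt)"
    by (rule quasi_iso_comp[OF eM M N 1 f])
  have "quasi_iso A ((\<lambda>c. c) \<circ> (\<phi> \<circ> (\<lambda>c. c))) (embed M) (embed N) (Elt \<circ> (f \<circ> the_elt))"
    by (rule quasi_iso_comp[OF eM N eN 2 embed_quasi_iso[OF N]]) (simp add: \<phi>)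
  moreover have "(\<lambda>c. c) \<circ> (\<phi> \<circ> (\<lambda>c. c)) = \<phi>" by auto
  ultimately show ?thesis by auto
qed

text \<open>As the supremum may be infinite a priori, it is not known to be attained.\<close>

lemma long_element_of_Sup:
  assumes "ereal (real n) \<le> Sup {ereal (real (length xs)) | xs. Q xs}" "Q []"
  shows "\<exists>xs. n \<le> length xs \<and> Q xs"
proof (rule ccontr)
  assume "\<not> ?thesis"
  then have less: "length xs < n" if "Q xs" for xs using that by (meson not_le)
  then have n: "0 < n" using assms(2) by fastforce
  have "Sup {ereal (real (length xs)) | xs. Q xs} \<le> ereal (real (n - 1))"
    by (rule Sup_least) (use less in fastforce)
  also have "\<dots> < ereal (real n)" using n by simp
  finally show False using assms(1) by simp
qed

text \<open>The Cohen-Macaulay condition at the maximal ideal, carried over from \<open>A\<^sub>m\<close> to \<open>A\<close>. Since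
  \<open>A \<rightarrow> A\<^sub>m\<close> is a quasi-isomorphism, but in general no isomorphism, regular sequences have to be
  compared through it.\<close>

lemma (in local_dg_ring) regular_seq_of_prime_chain:
  assumes cm: "local_cohen_macaulay (localize_at A m)" and P: "prime_chain (H0 A) n P"
  shows "\<exists>xs. length xs = n \<and> regular_seq A m (embed (self_module A)) xs"
proof -
  define S where "S = {a \<in> deg A 0. proj0 A a \<notin> m}"
  note mP = local_ringD(3)[OF local]
  interpret m: primeideal m "H0 A" by (rule mP)
  interpret dg_localization A S
  proof
    show "\<one>\<^bsub>A\<^esub> \<in> S" using one_deg local_ringD(5)[OF local] by (simp add: S_def H0_ops(3))
    show "s \<otimes>\<^bsub>A\<^esub> t \<in> S" if "s \<in> S" "t \<in> S" for s t
      using that deg0_mult(1) m.I_prime[OF proj0_closed proj0_closed, of s t] H0_ops(2)[of s t] by (auto simp: S_def)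
  qed (simp add: S_def)
  have inv: "\<exists>v\<in>deg A 0. \<exists>c\<in>deg A (-1). v \<otimes>\<^bsub>A\<^esub> s = \<one>\<^bsub>A\<^esub> \<oplus>\<^bsub>A\<^esub> diff A c" if s: "s \<in> S" for s
  proof -
    have sd: "s \<in> deg A 0" "proj0 A s \<notin> m" using s by (auto simp: S_def)
    obtain y where y: "y \<in> carrier (H0 A)" "y \<otimes>\<^bsub>H0 A\<^esub> proj0 A s = \<one>\<^bsub>H0 A\<^esub>"
      using local_ring_unit[OF noetherian local proj0_closed[OF sd(1)] sd(2)] by blast
    obtain v where v: "v \<in> deg A 0" "y = proj0 A v" using y(1) by (auto simp: H0_carrier)
    have vs: "v \<otimes>\<^bsub>A\<^esub> s \<in> deg A 0" using deg0_mult(1) v sd by blast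
    have "proj0 A (v \<otimes>\<^bsub>A\<^esub> s) = proj0 A \<one>\<^bsub>A\<^esub>" using y(2) v sd H0_ops by simp
    then have "v \<otimes>\<^bsub>A\<^esub> s \<oplus>\<^bsub>A\<^esub> \<ominus>\<^bsub>A\<^esub> \<one>\<^bsub>A\<^esub> \<in> boundaries0 A" using proj0_eq_iff[OF vs one_deg] by simp
    then obtain c where c: "c \<in> deg A (-1)" "v \<otimes>\<^bsub>A\<^esub> s \<oplus>\<^bsub>A\<^esub> \<ominus>\<^bsub>A\<^esub> \<one>\<^bsub>A\<^esub> = diff A c" by (auto simp: boundaries0_iff)
    have "\<one>\<^bsub>A\<^esub> \<oplus>\<^bsub>A\<^esub> (v \<otimes>\<^bsub>A\<^esub> s \<oplus>\<^bsub>A\<^esub> \<ominus>\<^bsub>A\<^esub> \<one>\<^bsub>A\<^esub>) = v \<otimes>\<^bsub>A\<^esub> s"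
      using deg_carrier[OF vs] by algebra
    then show ?thesis using v(1) c by metis
  qed
  obtain m' where m': "noetherian_local_dg_ring L m'" "seq_depth L m' m' (self_module L) = krull_dim (H0 L)"
    using cm unfolding local_cohen_macaulay_def localize_at_def S_def[symmetric] by blast
  have L: "comm_dg_ring L" and locL: "local_ring (H0 L) m'" and noethL: "noetherian_ring (H0 L)"
    using m'(1) by (auto simp: noetherian_local_dg_ring_def noetherian_dg_ring_def)
  interpret L: comm_dg_ring L by (rule L)
  interpret R': cring "H0 L" by (rule L.H0_cring)
  interpret R: cring "H0 A" by (rule H0_cring)
  define \<theta> where "\<theta> x = proj0 L (loc (rep x))" for x
  have \<theta>: "\<theta> \<in> ring_iso (H0 A) (H0 L)" unfolding \<theta>_def by (rule localization_H0_iso[OF L inv])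
  define \<psi> where "\<psi> = inv_into (carrier (H0 A)) \<theta>"
  have \<psi>: "\<psi> \<in> ring_iso (H0 L) (H0 A)" unfolding \<psi>_def by (rule ring_iso_set_sym[OF cring.axioms(1)[OF H0_cring] \<theta>])
  have \<psi>h: "ring_hom_ring (H0 L) (H0 A) \<psi>" and \<psi>s: "\<psi> ` carrier (H0 L) = carrier (H0 A)"
    using \<psi> ring_hom_ringI2[OF cring.axioms(1)[OF L.H0_cring] cring.axioms(1)[OF H0_cring]] by (auto simp: ring_iso_def bij_betw_def)
  have \<theta>D: "\<theta> \<in> ring_hom (H0 A) (H0 L)" "bij_betw \<theta> (carrier (H0 A)) (carrier (H0 L))"
    using \<theta> by (auto simp: ring_iso_def)
  have "ereal (real n) \<le> krull_dim (H0 L)"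
    unfolding krull_dim_prime_chain using prime_chain_vimage[OF \<psi>h L.H0_cring \<psi>s P] by (intro Sup_upper) blast
  then have "ereal (real n) \<le> Sup {ereal (real (length xs)) | xs. set xs \<subseteq> m' \<and> regular_seq L m' (embed (self_module L)) xs}"
    using m'(2) by (simp add: seq_depth_def)
  from long_element_of_Sup[OF this] obtain xs' where
    xs': "n \<le> length xs'" "set xs' \<subseteq> m'" "regular_seq L m' (embed (self_module L)) xs'" by auto
  have m'c: "m' \<subseteq> carrier (H0 L)" using local_ringD(4)[OF locL] by (meson ideal.Icarr subsetI)
  have unit: "x \<in> m \<longleftrightarrow> \<theta> x \<in> m'" if x: "x \<in> carrier (H0 A)" for x
  proof
    assume xm: "x \<in> m"
    show "\<theta> x \<in> m'"
    proof (rule ccontr)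
      assume "\<theta> x \<notin> m'"
      then obtain y' where y': "y' \<in> carrier (H0 L)" "y' \<otimes>\<^bsub>H0 L\<^esub> \<theta> x = \<one>\<^bsub>H0 L\<^esub>"
        using local_ring_unit[OF noethL locL ring_hom_closed[OF \<theta>D(1) x]] by blast
      obtain y where y: "y \<in> carrier (H0 A)" "y' = \<theta> y" using y'(1) \<theta>D(2) by (auto simp: bij_betw_def)
      have "\<theta> (y \<otimes>\<^bsub>H0 A\<^esub> x) = \<theta> \<one>\<^bsub>H0 A\<^esub>"
        using y' y ring_hom_mult[OF \<theta>D(1) y(1) x] ring_hom_one[OF \<theta>D(1)] by simp
      then have "y \<otimes>\<^bsub>H0 A\<^esub> x = \<one>\<^bsub>H0 A\<^esub>"
        using \<theta>D(2) y(1) x by (auto simp: bij_betw_def dest: inj_onD)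
      then show False using m.I_l_closed[OF xm y(1)] local_ringD(5)[OF local] by simp
    qed
  next
    assume xm: "\<theta> x \<in> m'"
    show "x \<in> m"
    proof (rule ccontr)
      assume "x \<notin> m"
      then obtain y where y: "y \<in> carrier (H0 A)" "y \<otimes>\<^bsub>H0 A\<^esub> x = \<one>\<^bsub>H0 A\<^esub>"
        using local_ring_unit[OF noetherian local x] by blast
      then have "\<theta> y \<otimes>\<^bsub>H0 L\<^esub> \<theta> x = \<one>\<^bsub>H0 L\<^esub>"
        using ring_hom_mult[OF \<theta>D(1) y(1) x] ring_hom_one[OF \<theta>D(1)] by simp
      then show False
        using ideal.I_l_closed[OF local_ringD(4)[OF locL] xm ring_hom_closed[OF \<theta>D(1) y(1)]] local_ringD(5)[OF locL] by simp
    qed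
  qed
  have X: "dg_complex A (self_module A)" by (rule self_module_dg_complex) (rule comm_dg_ring_axioms)
  have Y: "dg_complex L (self_module L)" by (rule self_module_dg_complex[OF L])
  obtain g where g: "quasi_iso A loc (embed (self_module A)) (embed (self_module L)) g"
    using embed_quasi_iso_map[OF X Y localization_quasi_iso[OF L inv] loc_deg] by blast
  define xs where "xs = map \<psi> xs'"
  have rel: "\<psi> x' \<in> carrier (H0 A) \<and> \<theta> (\<psi> x') = x'" if x': "x' \<in> carrier (H0 L)" for x'
  proof -
    have im: "x' \<in> \<theta> ` carrier (H0 A)" using x' \<theta>D(2) by (simp add: bij_betw_def)
    show ?thesis unfolding \<psi>_def by (intro conjI inv_into_into[OF im] f_inv_into_f[OF im])
  qed
  have "list_all2 (\<lambda>x x'. x \<in> carrier (H0 A) \<and> x' \<in> carrier (H0 L) \<and>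
      proj0 L (loc (SOME a. a \<in> x)) = x' \<and> (x \<in> m \<longleftrightarrow> x' \<in> m')) xs xs'"
    unfolding xs_def list_all2_map1 list_all2_same
  proof
    fix x' assume "x' \<in> set xs'"
    then have x': "x' \<in> carrier (H0 L)" using xs'(2) m'c by blast
    show "\<psi> x' \<in> carrier (H0 A) \<and> x' \<in> carrier (H0 L) \<and>
      proj0 L (loc (SOME a. a \<in> \<psi> x')) = x' \<and> (\<psi> x' \<in> m \<longleftrightarrow> x' \<in> m')"
      using rel[OF x'] x' unit[of "\<psi> x'"] by (simp add: \<theta>_def rep_def)
  qed
  then have "regular_seq A m (embed (self_module A)) xs"
    using quasi_iso_regular_seq_iff[OF embed_dg_complex[OF X] embed_dg_complex[OF Y] g loc_deg m_subset m'c] xs'(3) by blast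
  then have "regular_seq A m (embed (self_module A)) (take n xs @ drop n xs)" by simp
  then have "regular_seq A m (embed (self_module A)) (take n xs)" unfolding regular_seq_append by blast
  moreover have "length (take n xs) = n" using xs'(1) by (simp add: xs_def)
  ultimately show ?thesis by blast
qed

lemma (in local_dg_ring) inf_at_self_module:
  assumes b: "bounded_dg_ring A" and fg: "\<And>n. fin_gen_module (H0 A) (cohomology (self_module A) n)"
  shows "inf_at A (self_module A) (inf_dg (self_module A))"
proof -
  have X: "dg_complex A (self_module A)" by (rule self_module_dg_complex) (rule comm_dg_ring_axioms)
  interpret X: dg_complex A "self_module A" by (rule X)
  obtain n0 where n0: "\<forall>n<n0. \<not> cohomology_nonzero (self_module A) n" using b by (auto simp: bounded_dg_ring_def)
  have "\<one>\<^bsub>A\<^esub> \<notin> boundaries0 A"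
  proof
    assume "\<one>\<^bsub>A\<^esub> \<in> boundaries0 A"
    then have "proj0 A \<one>\<^bsub>A\<^esub> = proj0 A \<zero>\<^bsub>A\<^esub>"
      using proj0_eq_iff[OF one_deg deg_closed(1)] a_neg_zero deg_carrier[OF one_deg] by simp
    moreover have "proj0 A \<zero>\<^bsub>A\<^esub> \<in> m"
    proof -
      interpret h: ring_hom_ring "deg0 A" "H0 A" "proj0 A" by (rule proj0_hom)
      have "proj0 A \<zero>\<^bsub>A\<^esub> = \<zero>\<^bsub>H0 A\<^esub>" using h.hom_zero by simp
      then show ?thesis using additive_subgroup.zero_closed[OF ideal.axioms(1)[OF local_ringD(4)[OF local]]] by simp
    qed
    ultimately show False using local_ringD(5)[OF local] by (simp add: H0_ops(3))
  qed
  then have "cohomology_nonzero (self_module A) 0"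
    using X.cohomology_nonzero_iff cocycles_self_0 one_deg by auto
  then obtain i where i: "cohomology_nonzero (self_module A) i"
    "\<And>j. cohomology_nonzero (self_module A) j \<Longrightarrow> nat (i - n0) \<le> nat (j - n0)"
    using ex_has_least_nat[of "cohomology_nonzero (self_module A)" 0 "\<lambda>j. nat (j - n0)"] by blast
  have low: "\<not> cohomology_nonzero (self_module A) j" if "j < i" for j
    using i(2)[of j] n0 that by (cases "j < n0") auto
  have "inf_at A (self_module A) i"
    using X i(1) low fin_gen_noetherian_module[OF noetherian X.cohomology_module fg] by (simp add: inf_at_def)
  then show ?thesis using inf_at_inf_dg by metis
qed

lemma module_support_quasi_iso:
  assumes M: "dg_complex A M" and N: "dg_complex A N" and f: "quasi_iso A (\<lambda>c. c) M N f"
  shows "module_support (H0 A) (cohomology M n) \<subseteq> module_support (H0 A) (cohomology N n)"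
proof -
  obtain g where g: "linear_map (H0 A) (cohomology M n) (cohomology N n) g"
    "\<forall>y\<in>carrier (cohomology M n). g y = \<zero>\<^bsub>cohomology N n\<^esub> \<longrightarrow> y = \<zero>\<^bsub>cohomology M n\<^esub>"
    by (rule quasi_iso_cohomology[OF M N f, of n], rule that)
  interpret H: module "H0 A" "cohomology M n" by (rule dg_complex.cohomology_module[OF M])
  have "ann (H0 A) (cohomology N n) (g z) \<subseteq> ann (H0 A) (cohomology M n) z" if z: "z \<in> carrier (cohomology M n)" for z
    using bspec[OF g(2) H.smult_closed[OF _ z]] linear_mapD(3)[OF g(1) _ z] by (auto simp: ann_def)
  then show ?thesis using linear_mapD(1)[OF g(1)] unfolding module_support_def by blast
qed

theorem theorem3p16:
  fixes A :: "('a, 'b) dg_ring_scheme" and m I :: "'a set set"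
  assumes "noetherian_local_dg_ring A m"
    and "cohen_macaulay A"
    and "constant_amplitude A"
    and "ideal I (H0 A)" and "I \<noteq> carrier (H0 A)"
  shows "seq_depth A m I (self_module A) = krull_dim (H0 A) - krull_dim (H0 A Quot I)"
proof -
  have A: "comm_dg_ring A" and R: "noetherian_ring (H0 A)" "local_ring (H0 A) m"
    and fg: "\<And>n. fin_gen_module (H0 A) (cohomology (self_module A) n)"
    using assms(1) by (auto simp: noetherian_local_dg_ring_def noetherian_dg_ring_def)
  interpret local_dg_ring A m using A R by (simp add: local_dg_ring_def local_dg_ring_axioms_def)
  have X: "dg_complex A (self_module A)" by (rule self_module_dg_complex[OF A])
  let ?i = "inf_dg (self_module A)"
  have "bounded_dg_ring A" using assms(2) by (simp add: cohen_macaulay_def)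
  then have inf: "inf_at A (self_module A) ?i" using fg by (rule inf_at_self_module)
  show ?thesis
  proof (rule seq_depth_formula[OF inf_at_quasi_iso[OF inf embed_dg_complex[OF X] embed_quasi_iso[OF X]] _ _ assms(4,5)])
    fix P assume "primeideal P (H0 A)"
    then have "P \<in> Supp (H0 A) (cohomology (self_module A) ?i)"
      using assms(3) by (simp add: constant_amplitude_def Spec_def)
    then show "P \<in> module_support (H0 A) (cohomology (embed (self_module A)) ?i)"
      using Supp_subset_module_support[OF dg_complex.cohomology_module[OF X]]
        module_support_quasi_iso[OF X embed_dg_complex[OF X] embed_quasi_iso[OF X]] by blast
  next
    fix n P assume P: "prime_chain (H0 A) n P"
    have "m \<in> Spec (H0 A)" using local_ringD(3)[OF local] by (simp add: Spec_def)
    then have "local_cohen_macaulay (localize_at A m)" using assms(2) by (simp add: cohen_macaulay_def)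
    then show "\<exists>xs. length xs = n \<and> regular_seq A m (embed (self_module A)) xs"
      using P by (rule regular_seq_of_prime_chain)
  qed
qed

end
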